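(* Let $p,\gamma$ be constants with $1\le p<d$ and $0\le\gamma\le\frac1d$, and let $q:=\frac{p}{1-p\gamma}$ (so that $\gamma=\frac1p-\frac1q$). There exists a constant $S(\Omega,\eta)>0$, depending only on $\Omega$ and $\eta$, such that the following holds. Assume: (i) for some $K\le S(\Omega,\eta)$ (with $K>0$) there is a sequence of Borel maps $T_n:\Omega\to V_n$ with $T_n\#\mu=\mu_n$ and $\sup_{x\in\Omega}|T_n(x)-x|\le K\varepsilon_n$ for every $n\in\mathbb N$; (ii) $\eta$ is continuous at $0$, non-increasing, and $\eta(0)>0$; (iii) there is $D>0$ with $\frac1D\le\rho(x)\le D$ for all $x\in\Omega$; (iv) there is $\mathfrak D>0$ such that $\frac{1}{\mathfrak D|V_n|}\le\mu_n(x)\le\frac{\mathfrak D}{|V_n|}$ for all $n\in\mathbb N$ and $x\in V_n$. Additionally assume there exists $t>q$ such that $\aleph_\eta^t<+\infty$, and that $(\varepsilon_n|V_n|^\gamma)_{n\in\mathbb N}$ is bounded. Let $(u_n)_{n\in\mathbb N}$ be a sequence of functions $u_n:V_n\to\mathbb R$ such that $(\|u_n\|_{L^p(V_n;\mu_n)})_{n\in\mathbb N}$ and $(\mathcal{GE}_n^p(u_n))_{n\in\mathbb N}$ are bounded. Then, for any $r\in\left[1,\frac{p}{1-p\gamma}\right)$, the sequence $\big((u_n,\mu_n)\big)_{n\in\mathbb N}$ is relatively compact in $TL^r(\Omega)$.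
   Context: $\mathbb N=\{1,2,\dots\}$; $d\in\mathbb N$; $\Omega\subset\mathbb R^d$ is open and bounded with Lipschitz boundary (near each boundary point, in suitable orthonormal coordinates, $\Omega$ is the region on one side of the graph of a Lipschitz function). $\mu$ is a probability measure on $\Omega$ with continuous density $\rho:\Omega\to\mathbb R$ with respect to Lebesgue measure. For $n\in\mathbb N$, $V_n\subset\Omega$ is a finite set, $\mu_n$ is a probability measure on $V_n$ (also regarded as a measure on $\Omega$, so that functions on $V_n$ are elements of $L^r(\Omega;\mu_n)$), $\mu_n(x):=\mu_n(\{x\})$. $(\varepsilon_n)_{n\in\mathbb N}$ is a sequence of positive reals with $\varepsilon_n\to0$. The kernel is a function $\eta:[0,\infty)\to[0,\infty)$, and $\eta_\varepsilon(r):=\varepsilon^{-d}\eta(r/\varepsilon)$ for $\varepsilon>0$. For $t\ge0$, $\aleph_\eta^t:=\int_0^\infty\eta(r)r^{d+t-1}\,dr$. The push-forward is $T\#\mu(A):=\mu(T^{-1}(A))$. For $u:V_n\to\mathbb R$ and $p\ge1$, $$\|u\|_{L^p(V_n;\mu_n)}:=\Big(\sum_{x\in V_n}|u(x)|^p\mu_n(x)\Big)^{1/p},\qquad \mathcal{GE}_n^p(u):=\frac1{\varepsilon_n^p}\sum_{x\in V_n}\sum_{y\in V_n}\eta_{\varepsilon_n}(|x-y|)|u(x)-u(y)|^p\mu_n(x)\mu_n(y).$$ For $r\ge1$, $TL^r(\Omega)$ is the set of pairs $(f,\nu)$ with $\nu$ a Borel probability measure on $\Omega$ with finite $r$-th moment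 and $f\in L^r(\Omega;\nu)$, with the metric $$d_{TL^r(\Omega)}\big((f,\nu),(g,\lambda)\big):=\inf_{\pi\in\Gamma(\nu,\lambda)}\Big(\int_{\Omega\times\Omega}|x-y|^r+|f(x)-g(y)|^r\,d\pi(x,y)\Big)^{1/r},$$ where $\Gamma(\nu,\lambda)$ is the set of couplings of $\nu$ and $\lambda$. A sequence is relatively compact if every subsequence has a further subsequence converging in $TL^r(\Omega)$. *)

theory Defs
  imports "HOL-Probability.Probability"
begin

text \<open>Near a boundary point, \<open>e\<close> is the last vector of the orthonormal coordinate system, \<open>x \<bullet> e\<close>
  the last coordinate of \<open>x\<close>, and \<open>x - (x \<bullet> e) *\<^sub>R e\<close> the orthogonal projection of \<open>x\<close> to the
  hyperplane spanned by the other coordinate vectors; only the values of \<open>g\<close> on that hyperplane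
  matter.\<close>

definition lipschitz_boundary :: "'a::euclidean_space set \<Rightarrow> bool" where
  "lipschitz_boundary \<Omega> \<longleftrightarrow>
     (\<forall>z\<in>frontier \<Omega>. \<exists>U e g L. open U \<and> z \<in> U \<and> norm e = 1 \<and>
        L-lipschitz_on {y. y \<bullet> e = 0} (g :: 'a \<Rightarrow> real) \<and>
        \<Omega> \<inter> U = {x \<in> U. g (x - (x \<bullet> e) *\<^sub>R e) < x \<bullet> e})"

definition borel_prob_on :: "'a::euclidean_space set \<Rightarrow> 'a measure \<Rightarrow> bool" where
  "borel_prob_on \<Omega> \<nu> \<longleftrightarrow> prob_space \<nu> \<and> sets \<nu> = sets (restrict_space borel \<Omega>)"

definition kernel_scaled :: "nat \<Rightarrow> (real \<Rightarrow> real) \<Rightarrow> real \<Rightarrow> real \<Rightarrow> real" where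
  "kernel_scaled d \<eta> \<epsilon> r = \<eta> (r / \<epsilon>) / \<epsilon> ^ d"

definition aleph :: "nat \<Rightarrow> (real \<Rightarrow> real) \<Rightarrow> real \<Rightarrow> ennreal" where
  "aleph d \<eta> t = (\<integral>\<^sup>+r\<in>{0..}. ennreal (\<eta> r * r powr (real d + t - 1)) \<partial>lborel)"

definition discrete_Lp_norm :: "real \<Rightarrow> 'a set \<Rightarrow> 'a measure \<Rightarrow> ('a \<Rightarrow> real) \<Rightarrow> real" where
  "discrete_Lp_norm p V \<nu> u = (\<Sum>x\<in>V. \<bar>u x\<bar> powr p * measure \<nu> {x}) powr (1 / p)"

definition graph_energy ::
  "(real \<Rightarrow> real) \<Rightarrow> real \<Rightarrow> real \<Rightarrow> 'a::euclidean_space set \<Rightarrow> 'a measure \<Rightarrow> ('a \<Rightarrow> real) \<Rightarrow> real" where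
  "graph_energy \<eta> p \<epsilon> V \<nu> u =
     1 / \<epsilon> powr p *
       (\<Sum>x\<in>V. \<Sum>y\<in>V. kernel_scaled DIM('a) \<eta> \<epsilon> (norm (x - y)) * \<bar>u x - u y\<bar> powr p
                         * measure \<nu> {x} * measure \<nu> {y})"

definition couplings :: "'a measure \<Rightarrow> 'b measure \<Rightarrow> ('a \<times> 'b) measure set" where
  "couplings \<nu> \<kappa> =
     {\<pi>. sets \<pi> = sets (\<nu> \<Otimes>\<^sub>M \<kappa>) \<and> distr \<pi> \<nu> fst = \<nu> \<and> distr \<pi> \<kappa> snd = \<kappa>}"

text \<open>Elements of \<open>L\<^sup>r\<close> are represented by functions rather than by classes modulo null sets,
  so \<open>TL_dist r\<close> is a pseudometric on \<open>TL \<Omega> r\<close>.  On \<open>TL \<Omega> r\<close> with \<open>r \<ge> 1\<close>, the integrand in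
  \<open>TL_dist\<close> is integrable for every coupling, and the product measure is a coupling.\<close>

definition TL :: "'a::euclidean_space set \<Rightarrow> real \<Rightarrow> (('a \<Rightarrow> real) \<times> 'a measure) set" where
  "TL \<Omega> r = {(f, \<nu>). borel_prob_on \<Omega> \<nu> \<and> integrable \<nu> (\<lambda>x. norm x powr r) \<and>
                    f \<in> borel_measurable \<nu> \<and> integrable \<nu> (\<lambda>x. \<bar>f x\<bar> powr r)}"

definition TL_dist ::
  "real \<Rightarrow> ('a::euclidean_space \<Rightarrow> real) \<times> 'a measure \<Rightarrow> ('a \<Rightarrow> real) \<times> 'a measure \<Rightarrow> real" where
  "TL_dist r = (\<lambda>(f, \<nu>) (g, \<kappa>).
     INF \<pi>\<in>couplings \<nu> \<kappa>.
       (\<integral>z. norm (fst z - snd z) powr r + \<bar>f (fst z) - g (snd z)\<bar> powr r \<partial>\<pi>) powr (1 / r))"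

definition TL_relatively_compact ::
  "'a::euclidean_space set \<Rightarrow> real \<Rightarrow> (nat \<Rightarrow> ('a \<Rightarrow> real) \<times> 'a measure) \<Rightarrow> bool" where
  "TL_relatively_compact \<Omega> r X \<longleftrightarrow>
     range X \<subseteq> TL \<Omega> r \<and>
     (\<forall>s :: nat \<Rightarrow> nat. strict_mono s \<longrightarrow>
        (\<exists>s' :: nat \<Rightarrow> nat. strict_mono s' \<and>
           (\<exists>Y\<in>TL \<Omega> r. (\<lambda>k. TL_dist r (X (s (s' k))) Y) \<longlonglongrightarrow> 0)))"

end

theory Submission
  imports Defs "HOL-Complex_Analysis.Great_Picard"
begin

text \<open>Transport the graph functions to \<open>\<Omega>\<close>: put \<open>w\<^sub>n = u\<^sub>n \<circ> T\<^sub>n\<close>.  The maps \<open>T\<^sub>n\<close> move points by at most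
  \<open>K \<epsilon>\<^sub>n\<close>, so if \<open>K\<close> is at most a quarter of a radius \<open>r0\<close> with \<open>\<eta> r0 > 0\<close>, then images of points at distance at
  most \<open>\<delta>\<^sub>n = (r0 / 2) \<epsilon>\<^sub>n\<close> stay within distance \<open>r0 \<epsilon>\<^sub>n\<close>, and the graph energy dominates a multiple
  of the nonlocal energy \<open>\<delta>\<^sub>n\<^sup>-\<^sup>p\<^sup>-\<^sup>d \<integral>\<integral> \<bar>w\<^sub>n x - w\<^sub>n y\<bar>\<^sup>p\<close> over pairs with \<open>\<bar>x - y\<bar> \<le> \<delta>\<^sub>n\<close>.  The positive radius \<open>r0\<close> exists
  by continuity of \<open>\<eta>\<close> at \<open>0\<close>, and \<open>S = r0 / 4\<close>.

  The nonlocal energy takes over the role of a gradient bound, without passing through Sobolev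
  functions.  Near each point of its closure, the Lipschitz domain admits a ball of directions along
  which whole segments starting in \<open>\<Omega>\<close> remain in \<open>\<Omega>\<close>.  Averaging over these directions at scale \<open>s\<close>
  gives a local average \<open>A\<^sub>s w\<close>.  A jump of length \<open>s \<ge> \<delta>\<^sub>n\<close> is a chain of about \<open>s / \<delta>\<^sub>n\<close> jumps of length
  at most \<open>\<delta>\<^sub>n\<close>, and convexity then yields \<open>\<parallel>w\<^sub>n - A\<^sub>s w\<^sub>n\<parallel>\<^sub>p \<le> C s\<close> for all \<open>\<delta>\<^sub>n \<le> s \<le> 1\<close>
  (\<open>increment_chain\<close>, \<open>local_average_error\<close>).  This single estimate is used twice.

  \<^item> It gives integrability up to the Sobolev exponent (\<open>nonlocal_higher_integrability\<close>).  Since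
    \<open>\<bar>A\<^sub>s w\<bar>\<^sup>R \<le> C s\<^sup>-\<^sup>d \<integral> \<bar>w\<bar>\<^sup>R\<close>, a value of \<open>w\<close> above the threshold attached to the scale \<open>s\<close> is at most
    twice \<open>\<bar>w - A\<^sub>s w\<bar>\<close>.  Summing over dyadic scales bounds \<open>\<integral> \<bar>w\<bar>\<^sup>R\<close> by a sublinear function of
    itself, because the resulting geometric series converges exactly for \<open>R < d p / (d - p)\<close>.  Scales
    below \<open>\<delta>\<^sub>n\<close> are not available; there the discreteness enters: the largest value of \<open>\<bar>w\<^sub>n\<bar>\<close> is attained
    on a cell of measure at least of order \<open>1 / \<bar>V\<^sub>n\<bar>\<close>, and the boundedness of \<open>\<epsilon>\<^sub>n \<bar>V\<^sub>n\<bar>\<^sup>\<gamma>\<close> turns this into a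
    bound for all \<open>R < q\<close>.

  \<^item> It gives compactness (\<open>nonlocal_AE_convergent_subsequence\<close>).  At a fixed scale the averages are
    equi-Lipschitz and equibounded, so a diagonal subsequence makes all of them converge; as they
    approximate \<open>w\<^sub>n\<close> in \<open>L\<^sup>1\<close> uniformly in large \<open>n\<close>, the subsequence is Cauchy in \<open>L\<^sup>1\<close>, and a further one
    converges almost everywhere.

  Almost everywhere convergence and a bound in \<open>L\<^sup>R\<close> with \<open>R > r\<close> give convergence in \<open>L\<^sup>r\<close>, and the
  coupling \<open>(T\<^sub>n, id)\<close> of \<open>\<mu>\<^sub>n\<close> and \<open>\<mu>\<close> carries it over to the transport distance
  (\<open>TL_dist_tendsto_zero\<close>).\<close>

section \<open>Convexity of powers\<close>

lemma convex_on_abs_powr: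
  fixes p :: real
  assumes "1 \<le> p"
  shows "convex_on UNIV (\<lambda>x::real. \<bar>x\<bar> powr p)"
proof (rule convex_onI)
  fix t x y :: real
  assume t: "0 < t" "t < 1"
  have *: "((1 - t) * a + t * b) powr p \<le> (1 - t) * a powr p + t * b powr p"
    if ab: "0 \<le> a" "0 \<le> b" for a b :: real
  proof -
    have shrink: "s powr p \<le> s" if "0 < s" "s < 1" for s :: real
      using powr_mono'[of 1 p s] that assms by simp
    consider "a = 0" | "b = 0" | "0 < a" "0 < b" using ab by linarith
    then show ?thesis
    proof cases
      case 1
      then show ?thesis using t ab shrink[of t] by (auto simp: powr_mult intro!: mult_right_mono)
    next
      case 2
      then show ?thesis using t ab shrink[of "1 - t"] by (auto simp: powr_mult intro!: mult_right_mono)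
    next
      case 3
      then show ?thesis
        using convex_onD[OF powr_convex[OF assms], of t a b] t by simp
    qed
  qed
  have "\<bar>(1 - t) *\<^sub>R x + t *\<^sub>R y\<bar> \<le> (1 - t) * \<bar>x\<bar> + t * \<bar>y\<bar>"
    using t abs_triangle_ineq[of "(1-t)*x" "t*y"] by (simp add: abs_mult)
  then have "\<bar>(1 - t) *\<^sub>R x + t *\<^sub>R y\<bar> powr p \<le> ((1 - t) * \<bar>x\<bar> + t * \<bar>y\<bar>) powr p"
    using assms by (intro powr_mono2) auto
  also have "\<dots> \<le> (1 - t) * \<bar>x\<bar> powr p + t * \<bar>y\<bar> powr p"
    by (rule *) auto
  finally show "\<bar>(1 - t) *\<^sub>R x + t *\<^sub>R y\<bar> powr p \<le> (1 - t) * \<bar>x\<bar> powr p + t * \<bar>y\<bar> powr p" .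
qed simp

lemma abs_sum_powr_le:
  fixes p :: real
  assumes "1 \<le> p" "0 < k"
  shows "\<bar>\<Sum>j<k. a j\<bar> powr p \<le> real k powr (p - 1) * (\<Sum>j<k. \<bar>a j\<bar> powr p)"
proof -
  have "\<bar>\<Sum>j<k. (1 / real k) *\<^sub>R a j\<bar> powr p \<le> (\<Sum>j<k. 1 / real k * \<bar>a j\<bar> powr p)"
    using assms by (intro convex_on_sum[OF _ _ convex_on_abs_powr]) auto
  also have "(\<Sum>j<k. (1 / real k) *\<^sub>R a j) = (\<Sum>j<k. a j) / real k"
    by (simp add: sum_divide_distrib)
  finally have "\<bar>\<Sum>j<k. a j\<bar> powr p / real k powr p \<le> (\<Sum>j<k. \<bar>a j\<bar> powr p) / real k"
    using assms by (simp add: powr_divide abs_divide flip: sum_divide_distrib)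
  then show ?thesis
    using assms by (simp add: powr_diff field_simps)
qed

section \<open>Local averages along admissible directions\<close>

text \<open>The support of \<open>\<phi>\<close> consists of displacements \<open>h\<close> for which the whole segment from \<open>x\<close> to \<open>x + h\<close> lies
  in \<open>\<Omega>\<close>, for every \<open>x \<in> P\<close>.  Whole segments are demanded because a long jump is going to be cut into
  short ones; the Lipschitz condition makes the averages equicontinuous.\<close>
definition averaging_kernel :: "'a::euclidean_space set \<Rightarrow> 'a set \<Rightarrow> ('a \<Rightarrow> real) \<Rightarrow> bool" where
  "averaging_kernel \<Omega> P \<phi> \<longleftrightarrow> open P \<and> P \<subseteq> \<Omega> \<and> (\<forall>h. 0 \<le> \<phi> h) \<and>
     (\<exists>L. L-lipschitz_on UNIV \<phi>) \<and> (\<integral>\<^sup>+h. \<phi> h \<partial>lborel) = 1 \<and>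
     (\<forall>h. \<phi> h \<noteq> 0 \<longrightarrow> norm h \<le> 1 \<and> (\<forall>x\<in>P. \<forall>\<theta>\<in>{0..1}. x + \<theta> *\<^sub>R h \<in> \<Omega>))"

definition increment_integral :: "'a::euclidean_space set \<Rightarrow> real \<Rightarrow> ('a \<Rightarrow> real) \<Rightarrow> 'a \<Rightarrow> ennreal" where
  "increment_integral \<Omega> p w v =
     (\<integral>\<^sup>+y. indicator \<Omega> y * indicator \<Omega> (y + v) * ennreal (\<bar>w (y + v) - w y\<bar> powr p) \<partial>lborel)"

definition local_average :: "('a::euclidean_space \<Rightarrow> real) \<Rightarrow> real \<Rightarrow> ('a \<Rightarrow> real) \<Rightarrow> 'a \<Rightarrow> real" where
  "local_average \<phi> s w x = (\<integral>h. \<phi> h * w (x + s *\<^sub>R h) \<partial>lborel)"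

lemma averaging_kernel_measurable:
  "averaging_kernel \<Omega> P \<phi> \<Longrightarrow> \<phi> \<in> borel_measurable borel"
  unfolding averaging_kernel_def
  using borel_measurable_continuous_onI lipschitz_on_continuous_on by blast

lemma averaging_kernel_prob_space:
  assumes "averaging_kernel \<Omega> P \<phi>"
  shows "prob_space (density lborel (\<lambda>h. ennreal (\<phi> h)))"
  using assms averaging_kernel_measurable[OF assms]
  by (intro prob_spaceI) (auto simp: averaging_kernel_def emeasure_density)

lemma averaging_kernel_bounded:
  assumes "averaging_kernel \<Omega> P \<phi>"
  shows "\<exists>B>0. \<forall>h. \<phi> h \<le> B"
proof -
  obtain L where L: "L-lipschitz_on UNIV \<phi>" using assms unfolding averaging_kernel_def by blast
  have "\<phi> h \<le> \<phi> 0 + L + 1" for h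
  proof (cases "\<phi> h = 0")
    case True
    then show ?thesis using assms lipschitz_on_nonneg[OF L] unfolding averaging_kernel_def by (simp add: add_nonneg_nonneg)
  next
    case False
    then have "norm h \<le> 1" using assms unfolding averaging_kernel_def by blast
    moreover have "\<bar>\<phi> h - \<phi> 0\<bar> \<le> L * norm h"
      using lipschitz_onD[OF L, of h 0] by (simp add: dist_real_def)
    ultimately show ?thesis using lipschitz_on_nonneg[OF L] mult_left_le[of "norm h" L] by auto
  qed
  moreover have "0 < \<phi> 0 + L + 1"
    using assms lipschitz_on_nonneg[OF L] unfolding averaging_kernel_def
    by (meson add_nonneg_nonneg add_nonneg_pos zero_less_one)
  ultimately show ?thesis by blast
qed

lemma prob_space_abs_powr_integral_le:
  assumes "prob_space N" "1 \<le> p" and [measurable]: "f \<in> borel_measurable N" and b: "\<And>x. \<bar>f x\<bar> \<le> c"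
  shows "ennreal (\<bar>\<integral>x. f x \<partial>N\<bar> powr p) \<le> (\<integral>\<^sup>+x. ennreal (\<bar>f x\<bar> powr p) \<partial>N)"
proof -
  interpret prob_space N by fact
  have 1: "integrable N f" 
    by (rule integrable_const_bound[of _ c]) (use b in auto)
  have 2: "integrable N (\<lambda>x. \<bar>f x\<bar> powr p)"
    by (rule integrable_const_bound[of _ "c powr p"]) (use b assms(2) in \<open>auto intro!: powr_mono2\<close>)
  have "\<bar>\<integral>x. f x \<partial>N\<bar> powr p \<le> (\<integral>x. \<bar>f x\<bar> powr p \<partial>N)"
    by (rule jensens_inequality[where I=UNIV]) (use 1 2 convex_on_abs_powr[OF assms(2)] in auto)
  then have "ennreal (\<bar>\<integral>x. f x \<partial>N\<bar> powr p) \<le> ennreal (\<integral>x. \<bar>f x\<bar> powr p \<partial>N)"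
    by (rule ennreal_leI)
  also have "\<dots> = (\<integral>\<^sup>+x. ennreal (\<bar>f x\<bar> powr p) \<partial>N)"
    using 2 by (subst nn_integral_eq_integral) auto
  finally show ?thesis .
qed

lemma local_average_density:
  assumes "averaging_kernel \<Omega> P \<phi>" and [measurable]: "w \<in> borel_measurable borel"
  shows "local_average \<phi> s w x = (\<integral>h. w (x + s *\<^sub>R h) \<partial>density lborel (\<lambda>h. ennreal (\<phi> h)))"
  using assms averaging_kernel_measurable[OF assms(1)] unfolding local_average_def
  by (subst integral_density) (auto simp: averaging_kernel_def)

lemma nn_integral_lborel_translate:
  fixes f :: "'a::euclidean_space \<Rightarrow> ennreal"
  assumes [measurable]: "f \<in> borel_measurable borel"
  shows "(\<integral>\<^sup>+x. f (x + c) \<partial>lborel) = (\<integral>\<^sup>+x. f x \<partial>lborel)"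
proof -
  have "(\<integral>\<^sup>+x. f x \<partial>lborel) = (\<integral>\<^sup>+x. f x \<partial>distr lborel borel ((+) c))"
    by (simp add: lborel_distr_plus)
  also have "\<dots> = (\<integral>\<^sup>+x. f (c + x) \<partial>lborel)"
    by (subst nn_integral_distr) auto
  finally show ?thesis by (simp add: add.commute)
qed

lemma nn_integral_lborel_scale:
  fixes f :: "'a::euclidean_space \<Rightarrow> ennreal"
  assumes [measurable]: "f \<in> borel_measurable borel" and "0 < c"
  shows "(\<integral>\<^sup>+x. f x \<partial>lborel) = ennreal (c ^ DIM('a)) * (\<integral>\<^sup>+x. f (t + c *\<^sub>R x) \<partial>lborel)"
proof -
  have "(\<integral>\<^sup>+x. f x \<partial>lborel) =
     (\<integral>\<^sup>+x. f x \<partial>density (distr lborel borel (\<lambda>x. t + c *\<^sub>R x)) (\<lambda>_. \<bar>c\<bar>^DIM('a)))"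
    using assms lborel_affine[of c t] by simp
  also have "\<dots> = (\<integral>\<^sup>+x. ennreal (c ^ DIM('a)) * f (t + c *\<^sub>R x) \<partial>lborel)"
    using assms by (subst nn_integral_density; (subst nn_integral_distr)?) auto
  also have "\<dots> = ennreal (c ^ DIM('a)) * (\<integral>\<^sup>+x. f (t + c *\<^sub>R x) \<partial>lborel)"
    by (subst nn_integral_cmult) auto
  finally show ?thesis .
qed

text \<open>The jump \<open>s h\<close> is the sum of \<open>k\<close> consecutive jumps \<open>v = (s / k) h\<close>.  Only the starting point of the
  chain is confined to \<open>P\<close>: the intermediate points are translates of it which lie in \<open>\<Omega>\<close>, so by translation
  invariance each of the \<open>k\<close> links costs at most the full increment integral for \<open>v\<close>.  Convexity adds
  a factor \<open>k\<^sup>p\<^sup>-\<^sup>1\<close> in front of the sum of \<open>k\<close> links.\<close>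
lemma increment_chain:
  assumes ker: "averaging_kernel \<Omega> P \<phi>" "\<phi> h \<noteq> 0" and [measurable]: "\<Omega> \<in> sets borel" "w \<in> borel_measurable borel"
    and "1 \<le> p" "0 < k" "0 \<le> s" "s \<le> 1"
  shows "(\<integral>\<^sup>+x\<in>P. ennreal (\<bar>w (x + s *\<^sub>R h) - w x\<bar> powr p) \<partial>lborel)
       \<le> ennreal (real k powr p) * increment_integral \<Omega> p w ((s / real k) *\<^sub>R h)"
proof -
  define v where "v = (s / real k) *\<^sub>R h"
  have [measurable]: "P \<in> sets borel" using ker unfolding averaging_kernel_def by auto
  let ?g = "\<lambda>y. indicator \<Omega> y * indicator \<Omega> (y + v) * ennreal (\<bar>w (y + v) - w y\<bar> powr p)"
  have step: "x + real j *\<^sub>R v \<in> \<Omega>" if "x \<in> P" "j \<le> k" for x j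
  proof -
    have "real j * (s / real k) \<in> {0..1}"
      using that assms mult_mono[of "real j" "real k" s 1] by (auto simp: divide_le_eq)
    then have "x + (real j * (s / real k)) *\<^sub>R h \<in> \<Omega>"
      using ker that unfolding averaging_kernel_def by blast
    then show ?thesis by (simp add: v_def)
  qed
  have pw: "ennreal (\<bar>w (x + s *\<^sub>R h) - w x\<bar> powr p) * indicator P x
     \<le> (\<Sum>j<k. ennreal (real k powr (p - 1)) * ?g (x + real j *\<^sub>R v))" for x
  proof (cases "x \<in> P")
    case True
    have "x + real (Suc j) *\<^sub>R v = x + real j *\<^sub>R v + v" for j
      by (simp add: algebra_simps)
    moreover have "x + real k *\<^sub>R v = x + s *\<^sub>R h"
      using assms by (simp add: v_def)
    ultimately have tel: "w (x + s *\<^sub>R h) - w x = (\<Sum>j<k. w (x + real j *\<^sub>R v + v) - w (x + real j *\<^sub>R v))"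
      using sum_lessThan_telescope[of "\<lambda>j. w (x + real j *\<^sub>R v)" k] by (simp add: add.assoc del: of_nat_Suc)
    have "ennreal (\<bar>w (x + s *\<^sub>R h) - w x\<bar> powr p) \<le>
       ennreal (\<Sum>j<k. real k powr (p - 1) * \<bar>w (x + real j *\<^sub>R v + v) - w (x + real j *\<^sub>R v)\<bar> powr p)"
      using abs_sum_powr_le[OF \<open>1 \<le> p\<close> \<open>0 < k\<close>] unfolding tel
      by (intro ennreal_leI) (simp add: sum_distrib_left)
    also have "\<dots> = (\<Sum>j<k. ennreal (real k powr (p - 1)) * ennreal (\<bar>w (x + real j *\<^sub>R v + v) - w (x + real j *\<^sub>R v)\<bar> powr p))"
      by (subst sum_ennreal[symmetric]) (auto simp: ennreal_mult)
    also have "\<dots> = (\<Sum>j<k. ennreal (real k powr (p - 1)) * ?g (x + real j *\<^sub>R v))"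
    proof (rule sum.cong)
      fix j assume "j \<in> {..<k}"
      then have "x + real j *\<^sub>R v \<in> \<Omega>" "x + real j *\<^sub>R v + v \<in> \<Omega>"
        using step[OF True, of j] step[OF True, of "Suc j"] by (auto simp: algebra_simps)
      then show "ennreal (real k powr (p - 1)) * ennreal (\<bar>w (x + real j *\<^sub>R v + v) - w (x + real j *\<^sub>R v)\<bar> powr p)
        = ennreal (real k powr (p - 1)) * ?g (x + real j *\<^sub>R v)" by simp
    qed simp
    finally show ?thesis using True by simp
  qed simp
  have "(\<integral>\<^sup>+x\<in>P. ennreal (\<bar>w (x + s *\<^sub>R h) - w x\<bar> powr p) \<partial>lborel)
     \<le> (\<integral>\<^sup>+x. (\<Sum>j<k. ennreal (real k powr (p - 1)) * ?g (x + real j *\<^sub>R v)) \<partial>lborel)"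
    by (rule nn_integral_mono) (use pw in auto)
  also have "\<dots> = (\<Sum>j<k. ennreal (real k powr (p - 1)) * (\<integral>\<^sup>+x. ?g (x + real j *\<^sub>R v) \<partial>lborel))"
    by (subst nn_integral_sum) (auto simp: nn_integral_cmult)
  also have "\<dots> = (\<Sum>j<k. ennreal (real k powr (p - 1)) * increment_integral \<Omega> p w v)"
    by (subst nn_integral_lborel_translate) (auto simp: increment_integral_def)
  also have "\<dots> = ennreal (real k) * ennreal (real k powr (p - 1)) * increment_integral \<Omega> p w v"
    by (simp add: mult.assoc ennreal_of_nat_eq_real_of_nat)
  also have "ennreal (real k) * ennreal (real k powr (p - 1)) = ennreal (real k powr p)"
    using assms by (subst ennreal_mult[symmetric]) (auto simp: powr_diff)
  finally show ?thesis by (simp add: v_def)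
qed

lemma increment_integral_measurable [measurable]:
  assumes [measurable]: "\<Omega> \<in> sets borel" "w \<in> borel_measurable borel"
  shows "increment_integral \<Omega> p w \<in> borel_measurable borel"
  unfolding increment_integral_def by measurable

lemma abs_diff_average_powr_le:
  fixes w :: "'a::euclidean_space \<Rightarrow> real"
  assumes ker: "averaging_kernel \<Omega> P \<phi>" and [measurable]: "w \<in> borel_measurable borel"
    and b: "\<And>x. \<bar>w x\<bar> \<le> c" and "1 \<le> p"
  shows "ennreal (\<bar>a - local_average \<phi> s w x\<bar> powr p)
     \<le> (\<integral>\<^sup>+h. ennreal (\<phi> h) * ennreal (\<bar>w (x + s *\<^sub>R h) - a\<bar> powr p) \<partial>lborel)"
proof -
  note [measurable] = averaging_kernel_measurable[OF ker]
  let ?N = "density lborel (\<lambda>h. ennreal (\<phi> h))"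
  interpret N: prob_space ?N by (rule averaging_kernel_prob_space[OF ker])
  have int: "integrable ?N (\<lambda>h. w (x + s *\<^sub>R h))"
    by (rule N.integrable_const_bound[of _ c]) (use b in auto)
  have "local_average \<phi> s w x - a = (\<integral>h. w (x + s *\<^sub>R h) - a \<partial>?N)"
    using int by (simp add: local_average_density[OF ker] N.prob_space[simplified])
  then have "ennreal (\<bar>a - local_average \<phi> s w x\<bar> powr p) = ennreal (\<bar>\<integral>h. w (x + s *\<^sub>R h) - a \<partial>?N\<bar> powr p)"
    by (simp only: abs_minus_commute[of a])
  also have "\<dots> \<le> (\<integral>\<^sup>+h. ennreal (\<bar>w (x + s *\<^sub>R h) - a\<bar> powr p) \<partial>?N)"
  proof (rule prob_space_abs_powr_integral_le[OF N.prob_space_axioms \<open>1 \<le> p\<close>])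
    show "\<bar>w (x + s *\<^sub>R h) - a\<bar> \<le> c + \<bar>a\<bar>" for h using b[of "x + s *\<^sub>R h"] by linarith
  qed simp
  also have "\<dots> = (\<integral>\<^sup>+h. ennreal (\<phi> h) * ennreal (\<bar>w (x + s *\<^sub>R h) - a\<bar> powr p) \<partial>lborel)"
    by (subst nn_integral_density) auto
  finally show ?thesis .
qed

text \<open>By Jensen, followed by \<open>\<phi> \<le> B\<close> and the substitution \<open>y = x + s h\<close>.\<close>
lemma local_average_powr_le:
  fixes w :: "'a::euclidean_space \<Rightarrow> real"
  assumes ker: "averaging_kernel \<Omega> P \<phi>" and [measurable]: "w \<in> borel_measurable borel"
    and b: "\<And>x. \<bar>w x\<bar> \<le> c" and "1 \<le> p" and B: "\<And>h. \<phi> h \<le> B" and s: "0 < s"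
  shows "ennreal (\<bar>local_average \<phi> s w x\<bar> powr p)
     \<le> ennreal (B / s ^ DIM('a)) * (\<integral>\<^sup>+y. ennreal (\<bar>w y\<bar> powr p) \<partial>lborel)"
proof -
  have "0 \<le> B" using ker B[of 0] unfolding averaging_kernel_def by (meson order_trans)
  have "ennreal (\<bar>local_average \<phi> s w x\<bar> powr p)
     \<le> (\<integral>\<^sup>+h. ennreal (\<phi> h) * ennreal (\<bar>w (x + s *\<^sub>R h)\<bar> powr p) \<partial>lborel)"
    using abs_diff_average_powr_le[where a=0 and s=s and x=x and w=w, OF ker _ b \<open>1 \<le> p\<close>] by simp
  also have "\<dots> \<le> (\<integral>\<^sup>+h. ennreal B * ennreal (\<bar>w (x + s *\<^sub>R h)\<bar> powr p) \<partial>lborel)"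
    by (intro nn_integral_mono mult_right_mono) (auto intro!: ennreal_leI B)
  also have "\<dots> = ennreal B * (\<integral>\<^sup>+h. ennreal (\<bar>w (x + s *\<^sub>R h)\<bar> powr p) \<partial>lborel)"
    by (subst nn_integral_cmult) auto
  also have "(\<integral>\<^sup>+h. ennreal (\<bar>w (x + s *\<^sub>R h)\<bar> powr p) \<partial>lborel)
     = ennreal (1 / s ^ DIM('a)) * (\<integral>\<^sup>+y. ennreal (\<bar>w y\<bar> powr p) \<partial>lborel)"
    using nn_integral_lborel_scale[of "\<lambda>y. ennreal (\<bar>w y\<bar> powr p)" s x] s
    by (simp add: mult.assoc[symmetric] flip: ennreal_mult)
  also have "ennreal B * (ennreal (1 / s ^ DIM('a)) * (\<integral>\<^sup>+y. ennreal (\<bar>w y\<bar> powr p) \<partial>lborel))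
    = ennreal (B / s ^ DIM('a)) * (\<integral>\<^sup>+y. ennreal (\<bar>w y\<bar> powr p) \<partial>lborel)"
    using s \<open>0 \<le> B\<close> by (simp add: mult.assoc[symmetric] flip: ennreal_mult)
  finally show ?thesis .
qed

text \<open>The substitute for the Poincare inequality.  By Jensen and Fubini the left-hand side is an average
  over \<open>h\<close> of the integrals in \<open>increment_chain\<close>; rescaling \<open>h\<close> to \<open>v = (s / k) h\<close> leaves an integral
  over \<open>\<bar>v\<bar> \<le> \<delta>\<close>, which is what the energy hypothesis controls.\<close>
lemma local_average_error:
  fixes w :: "'a::euclidean_space \<Rightarrow> real"
  assumes ker: "averaging_kernel \<Omega> P \<phi>" and \<Omega>[measurable]: "\<Omega> \<in> sets borel" and w[measurable]: "w \<in> borel_measurable borel"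
    and b: "\<And>x. \<bar>w x\<bar> \<le> c" and p: "1 \<le> p" and B: "\<And>h. \<phi> h \<le> B" and s: "0 < \<delta>" "\<delta> \<le> s" "s \<le> 1"
    and E: "(\<integral>\<^sup>+v\<in>cball 0 \<delta>. increment_integral \<Omega> p w v \<partial>lborel) \<le> ennreal (C * \<delta> powr (p + DIM('a)))"
    and "0 \<le> C"
  shows "(\<integral>\<^sup>+x\<in>P. ennreal (\<bar>w x - local_average \<phi> s w x\<bar> powr p) \<partial>lborel)
       \<le> ennreal (B * 2 powr (p + DIM('a)) * C * s powr p)"
proof -
  note [measurable] = averaging_kernel_measurable[OF ker]
  have [measurable]: "P \<in> sets borel" using ker unfolding averaging_kernel_def by auto
  have "0 \<le> B" using ker B[of 0] unfolding averaging_kernel_def by (meson order_trans)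
  \<comment> \<open>The least number of links that makes each link at most \<open>\<delta>\<close> long.\<close>
  define k where "k = nat \<lceil>s / \<delta>\<rceil>"
  have "1 \<le> s / \<delta>" using s by simp
  have rk: "real k = of_int \<lceil>s / \<delta>\<rceil>" using \<open>1 \<le> s / \<delta>\<close> by (simp add: k_def)
  have k1: "s / \<delta> \<le> real k" unfolding rk by (rule le_of_int_ceiling)
  have k2: "real k \<le> 2 * (s / \<delta>)" unfolding rk using \<open>1 \<le> s / \<delta>\<close> of_int_ceiling_le_add_one[of "s / \<delta>"] by linarith
  have k0: "0 < k" using k1 \<open>1 \<le> s / \<delta>\<close> by (cases k) auto
  define \<sigma> where "\<sigma> = s / real k"
  have \<sigma>: "0 < \<sigma>" "\<sigma> \<le> \<delta>" using k1 k0 s by (auto simp: \<sigma>_def field_simps)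
  have [measurable]: "cball (0::'a) \<delta> \<in> sets borel" by simp
  have meas: "(\<lambda>v. increment_integral \<Omega> p w v * indicator (cball 0 \<delta>) v) \<in> borel_measurable borel"
    by measurable
  have "(\<integral>\<^sup>+x\<in>P. ennreal (\<bar>w x - local_average \<phi> s w x\<bar> powr p) \<partial>lborel)
     \<le> (\<integral>\<^sup>+x. (\<integral>\<^sup>+h. ennreal (\<phi> h) * ennreal (\<bar>w (x + s *\<^sub>R h) - w x\<bar> powr p) * indicator P x \<partial>lborel) \<partial>lborel)"
    by (intro nn_integral_mono, subst nn_integral_multc)
       (auto intro!: mult_right_mono abs_diff_average_powr_le[OF ker _ b p])
  also have "\<dots> = (\<integral>\<^sup>+h. (\<integral>\<^sup>+x. ennreal (\<phi> h) * ennreal (\<bar>w (x + s *\<^sub>R h) - w x\<bar> powr p) * indicator P x \<partial>lborel) \<partial>lborel)"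
    by (rule lborel_pair.Fubini') measurable
  also have "\<dots> = (\<integral>\<^sup>+h. ennreal (\<phi> h) * (\<integral>\<^sup>+x\<in>P. ennreal (\<bar>w (x + s *\<^sub>R h) - w x\<bar> powr p) \<partial>lborel) \<partial>lborel)"
    by (simp add: nn_integral_cmult mult.assoc)
  also have "\<dots> \<le> (\<integral>\<^sup>+h. ennreal (B * real k powr p) * (increment_integral \<Omega> p w (\<sigma> *\<^sub>R h) * indicator (cball 0 \<delta>) (\<sigma> *\<^sub>R h)) \<partial>lborel)"
  proof (rule nn_integral_mono)
    fix h
    show "ennreal (\<phi> h) * (\<integral>\<^sup>+x\<in>P. ennreal (\<bar>w (x + s *\<^sub>R h) - w x\<bar> powr p) \<partial>lborel)
      \<le> ennreal (B * real k powr p) * (increment_integral \<Omega> p w (\<sigma> *\<^sub>R h) * indicator (cball 0 \<delta>) (\<sigma> *\<^sub>R h))"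
    proof (cases "\<phi> h = 0")
      case False
      then have "norm h \<le> 1" using ker unfolding averaging_kernel_def by blast
      then have "norm (\<sigma> *\<^sub>R h) \<le> \<delta>" using \<sigma> mult_mono[of \<sigma> \<delta> "norm h" 1] by auto
      then have "indicator (cball 0 \<delta>) (\<sigma> *\<^sub>R h) = (1::ennreal)" by simp
      moreover have "ennreal (\<phi> h) * (\<integral>\<^sup>+x\<in>P. ennreal (\<bar>w (x + s *\<^sub>R h) - w x\<bar> powr p) \<partial>lborel)
        \<le> ennreal B * (ennreal (real k powr p) * increment_integral \<Omega> p w (\<sigma> *\<^sub>R h))"
        unfolding \<sigma>_def
        by (intro mult_mono ennreal_leI B increment_chain[OF ker False \<Omega> w p k0]) (use s in auto)
      ultimately show ?thesis using \<open>0 \<le> B\<close> by (simp add: ennreal_mult mult.assoc)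
    qed simp
  qed
  also have "\<dots> = ennreal (B * real k powr p) * (\<integral>\<^sup>+h. (increment_integral \<Omega> p w (\<sigma> *\<^sub>R h) * indicator (cball 0 \<delta>) (\<sigma> *\<^sub>R h)) \<partial>lborel)"
  proof (rule nn_integral_cmult)
    from measurable_compose[OF _ meas, of "\<lambda>h. \<sigma> *\<^sub>R h" lborel]
    show "(\<lambda>h. increment_integral \<Omega> p w (\<sigma> *\<^sub>R h) * indicator (cball 0 \<delta>) (\<sigma> *\<^sub>R h)) \<in> borel_measurable lborel"
      by simp
  qed
  also have "(\<integral>\<^sup>+h. (increment_integral \<Omega> p w (\<sigma> *\<^sub>R h) * indicator (cball 0 \<delta>) (\<sigma> *\<^sub>R h)) \<partial>lborel)
     = ennreal (1 / \<sigma> ^ DIM('a)) * (\<integral>\<^sup>+v\<in>cball 0 \<delta>. increment_integral \<Omega> p w v \<partial>lborel)"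
    using nn_integral_lborel_scale[OF meas, of \<sigma> 0] \<sigma>
    by (simp add: mult.assoc[symmetric] flip: ennreal_mult)
  also have "ennreal (B * real k powr p) * (ennreal (1 / \<sigma> ^ DIM('a)) * (\<integral>\<^sup>+v\<in>cball 0 \<delta>. increment_integral \<Omega> p w v \<partial>lborel))
     \<le> ennreal (B * real k powr p) * (ennreal (1 / \<sigma> ^ DIM('a)) * ennreal (C * \<delta> powr (p + DIM('a))))"
    by (intro mult_left_mono E) auto
  also have "\<dots> = ennreal (B * real k powr p * (1 / \<sigma> ^ DIM('a)) * (C * \<delta> powr (p + DIM('a))))"
    using \<open>0 \<le> B\<close> \<sigma> \<open>0 \<le> C\<close> by (simp add: mult.assoc flip: ennreal_mult)
  also have "\<dots> \<le> ennreal (B * 2 powr (p + DIM('a)) * C * s powr p)"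
  proof (rule ennreal_leI)
    have pd: "\<sigma> ^ DIM('a) = s powr DIM('a) / real k powr DIM('a)"
      using \<sigma> s k0 by (simp add: powr_divide \<sigma>_def powr_realpow power_divide)
    have "B * real k powr p * (1 / \<sigma> ^ DIM('a)) * (C * \<delta> powr (p + DIM('a)))
       = B * C * (real k powr (p + DIM('a)) * (\<delta> powr (p + DIM('a)) / s powr DIM('a)))"
      using k0 s by (simp add: pd powr_add)
    also have "\<dots> \<le> B * C * ((2 * (s / \<delta>)) powr (p + DIM('a)) * (\<delta> powr (p + DIM('a)) / s powr DIM('a)))"
      using \<open>0 \<le> B\<close> \<open>0 \<le> C\<close> k2 p by (intro mult_left_mono mult_right_mono powr_mono2) auto
    also have "\<dots> = B * 2 powr (p + DIM('a)) * C * s powr p"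
      using s by (simp add: powr_mult powr_divide powr_add)
    finally show "B * real k powr p * (1 / \<sigma> ^ DIM('a)) * (C * \<delta> powr (p + DIM('a)))
      \<le> B * 2 powr (p + DIM('a)) * C * s powr p" .
  qed
  finally show ?thesis .
qed

lemma integral_lborel_scale:
  fixes f :: "'a::euclidean_space \<Rightarrow> real"
  assumes [measurable]: "f \<in> borel_measurable borel" and "0 < c"
  shows "(\<integral>x. f x \<partial>lborel) = c ^ DIM('a) * (\<integral>x. f (t + c *\<^sub>R x) \<partial>lborel)"
proof -
  have "(\<integral>x. f x \<partial>lborel) =
     (\<integral>x. f x \<partial>density (distr lborel borel (\<lambda>x. t + c *\<^sub>R x)) (\<lambda>_. ennreal (\<bar>c\<bar>^DIM('a))))"
    using assms lborel_affine[of c t] by simp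
  also have "\<dots> = (\<integral>x. c ^ DIM('a) * f (t + c *\<^sub>R x) \<partial>lborel)"
    using assms by (subst integral_density; (subst integral_distr)?) auto
  finally show ?thesis by simp
qed

text \<open>After the substitution \<open>y = x + s h\<close> the point \<open>x\<close> occurs only in the argument of \<open>\<phi>\<close>.\<close>
lemma local_average_lipschitz:
  fixes w :: "'a::euclidean_space \<Rightarrow> real"
  assumes L: "L-lipschitz_on UNIV \<phi>" and w: "integrable lborel w" and s: "0 < s"
    and ker: "averaging_kernel \<Omega> P \<phi>"
  shows "\<bar>local_average \<phi> s w x - local_average \<phi> s w x'\<bar>
      \<le> L / s ^ Suc DIM('a) * (\<integral>y. \<bar>w y\<bar> \<partial>lborel) * norm (x - x')"
proof -
  note [measurable] = averaging_kernel_measurable[OF ker] borel_measurable_integrable[OF w, simplified]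
  obtain B where B: "\<And>h. \<phi> h \<le> B" using averaging_kernel_bounded[OF ker] by auto
  have nn: "0 \<le> \<phi> h" for h using ker unfolding averaging_kernel_def by auto
  have eq: "local_average \<phi> s w x = (\<integral>y. \<phi> ((1 / s) *\<^sub>R (y - x)) * w y \<partial>lborel) / s ^ DIM('a)" for x
    using integral_lborel_scale[of "\<lambda>y. \<phi> ((1 / s) *\<^sub>R (y - x)) * w y" s x] s
    by (simp add: local_average_def)
  have int: "integrable lborel (\<lambda>y. \<phi> ((1 / s) *\<^sub>R (y - x)) * w y)" for x
  proof (rule Bochner_Integration.integrable_bound)
    show "integrable lborel (\<lambda>y. B * w y)" using w by simp
    show "AE y in lborel. norm (\<phi> ((1 / s) *\<^sub>R (y - x)) * w y) \<le> norm (B * w y)"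
      using order_trans[OF nn B] nn B by (auto simp: abs_mult intro!: AE_I2 mult_right_mono)
  qed measurable
  have "\<bar>(\<integral>y. \<phi> ((1 / s) *\<^sub>R (y - x)) * w y \<partial>lborel) - (\<integral>y. \<phi> ((1 / s) *\<^sub>R (y - x')) * w y \<partial>lborel)\<bar>
     = \<bar>\<integral>y. (\<phi> ((1 / s) *\<^sub>R (y - x)) - \<phi> ((1 / s) *\<^sub>R (y - x'))) * w y \<partial>lborel\<bar>"
    using int by (simp add: left_diff_distrib)
  also have "\<dots> \<le> (\<integral>y. L / s * norm (x - x') * \<bar>w y\<bar> \<partial>lborel)"
  proof (rule integral_abs_bound[THEN order_trans], rule integral_mono')
    fix y
    have "\<bar>\<phi> ((1 / s) *\<^sub>R (y - x)) - \<phi> ((1 / s) *\<^sub>R (y - x'))\<bar> \<le> L * norm ((1 / s) *\<^sub>R (y - x) - (1 / s) *\<^sub>R (y - x'))"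
      using lipschitz_onD[OF L] by (simp add: dist_norm)
    also have "norm ((1 / s) *\<^sub>R (y - x) - (1 / s) *\<^sub>R (y - x')) = norm (x - x') / s"
      using s by (simp flip: scaleR_diff_right) (simp add: norm_minus_commute)
    finally show "\<bar>(\<phi> ((1 / s) *\<^sub>R (y - x)) - \<phi> ((1 / s) *\<^sub>R (y - x'))) * w y\<bar> \<le> L / s * norm (x - x') * \<bar>w y\<bar>"
      using mult_right_mono[of _ _ "\<bar>w y\<bar>"] by (fastforce simp: abs_mult)
  qed (use w s lipschitz_on_nonneg[OF L] in auto)
  also have "\<dots> = L / s * norm (x - x') * (\<integral>y. \<bar>w y\<bar> \<partial>lborel)" by simp
  finally show ?thesis
    using s unfolding eq by (simp add: field_simps abs_divide flip: diff_divide_distrib)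
qed

section \<open>Lipschitz domains are covered by finitely many averaging kernels\<close>

text \<open>A ball of admissible directions carries the normalised cone function \<open>h \<mapsto> max 0 (\<rho> - dist c h)\<close>.\<close>
lemma averaging_kernel_exists:
  fixes c :: "'a::euclidean_space"
  assumes "open P" "P \<subseteq> \<Omega>" "0 < \<rho>"
    and star: "\<And>h. dist c h < \<rho> \<Longrightarrow> norm h \<le> 1 \<and> (\<forall>x\<in>P. \<forall>\<theta>\<in>{0..1}. x + \<theta> *\<^sub>R h \<in> \<Omega>)"
  shows "\<exists>\<phi>. averaging_kernel \<Omega> P \<phi>"
proof -
  define f where "f h = max 0 (\<rho> - dist c h)" for h
  have f0: "0 \<le> f h" for h by (simp add: f_def)
  have lip: "1-lipschitz_on UNIV f"
  proof (rule lipschitz_onI)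
    fix x y
    show "dist (f x) (f y) \<le> 1 * dist x y"
      using dist_triangle2[of c x y] dist_triangle[of c y x]
      by (auto simp: f_def dist_real_def dist_commute)
  qed simp
  have [measurable]: "f \<in> borel_measurable borel"
    by (rule borel_measurable_continuous_onI[OF lipschitz_on_continuous_on[OF lip]])
  define Z where "Z = (\<integral>\<^sup>+h. f h \<partial>lborel)"
  have "Z \<le> (\<integral>\<^sup>+h. ennreal \<rho> * indicator (ball c \<rho>) h \<partial>lborel)"
    unfolding Z_def f_def by (rule nn_integral_mono) (auto simp: indicator_def ennreal_neg intro!: ennreal_leI)
  also have "\<dots> < \<infinity>"
    using emeasure_lborel_ball_finite[of c \<rho>]
    by (subst nn_integral_cmult_indicator) (auto simp: ennreal_mult_less_top)
  finally have Zfin: "Z < \<infinity>" .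
  have "0 < ennreal (\<rho> / 2) * emeasure lborel (ball c (\<rho> / 2))"
    using \<open>0 < \<rho>\<close> content_ball_pos[of "\<rho> / 2" c]
    by (auto simp: ennreal_zero_less_mult_iff measure_def enn2real_positive_iff)
  also have "\<dots> = (\<integral>\<^sup>+h. ennreal (\<rho> / 2) * indicator (ball c (\<rho> / 2)) h \<partial>lborel)"
    by (subst nn_integral_cmult_indicator) auto
  also have "\<dots> \<le> Z"
    unfolding Z_def f_def by (rule nn_integral_mono) (auto simp: indicator_def intro!: ennreal_leI)
  finally have "0 < Z" .
  define z where "z = enn2real Z"
  have z: "0 < z" "Z = ennreal z"
    using Zfin \<open>0 < Z\<close> by (auto simp: z_def enn2real_positive_iff)
  have "averaging_kernel \<Omega> P (\<lambda>h. f h / z)"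
    unfolding averaging_kernel_def
  proof (intro conjI allI impI)
    show "0 \<le> f h / z" for h using f0 z by simp
    have "(1 / z)-lipschitz_on UNIV (\<lambda>h. f h / z)"
      using z lip unfolding lipschitz_on_def dist_real_def
      by (simp add: divide_right_mono flip: diff_divide_distrib)
    then show "\<exists>L. L-lipschitz_on UNIV (\<lambda>h. f h / z)" by blast
    have "(\<integral>\<^sup>+h. ennreal (f h / z) \<partial>lborel) = (\<integral>\<^sup>+h. ennreal (1 / z) * ennreal (f h) \<partial>lborel)"
      using z f0 by (simp flip: ennreal_mult)
    also have "\<dots> = ennreal (1 / z) * Z" unfolding Z_def by (rule nn_integral_cmult) simp
    also have "\<dots> = 1" using z by (simp flip: ennreal_mult ennreal_1)
    finally show "(\<integral>\<^sup>+h. ennreal (f h / z) \<partial>lborel) = 1" .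
    fix h assume "f h / z \<noteq> 0"
    then have "dist c h < \<rho>" by (auto simp: f_def max_def split: if_splits)
    then show "norm h \<le> 1" "\<forall>x\<in>P. \<forall>\<theta>\<in>{0..1}. x + \<theta> *\<^sub>R h \<in> \<Omega>" using star by auto
  qed (use assms in auto)
  then show ?thesis by blast
qed

lemma averaging_kernel_near_interior:
  fixes \<Omega> :: "'a::euclidean_space set"
  assumes "open \<Omega>" "z \<in> \<Omega>"
  shows "\<exists>A \<phi>. open A \<and> z \<in> A \<and> averaging_kernel \<Omega> (A \<inter> \<Omega>) \<phi>"
proof -
  obtain e where e: "0 < e" "ball z e \<subseteq> \<Omega>" using assms openE by blast
  define \<delta> where "\<delta> = min 1 (e / 2)"
  have \<delta>: "0 < \<delta>" "\<delta> \<le> 1" "2 * \<delta> \<le> e" using e by (auto simp: \<delta>_def)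
  have "\<exists>\<phi>. averaging_kernel \<Omega> (ball z \<delta> \<inter> \<Omega>) \<phi>"
  proof (rule averaging_kernel_exists[where c=0 and \<rho>=\<delta>], goal_cases)
    case (4 h)
    have "x + \<theta> *\<^sub>R h \<in> \<Omega>" if "x \<in> ball z \<delta>" "\<theta> \<in> {0..1}" for x \<theta>
    proof -
      have "norm (\<theta> *\<^sub>R h) \<le> norm h" using that by (simp add: mult_left_le_one_le)
      then have "dist z (x + \<theta> *\<^sub>R h) < e"
        using that 4 \<delta> norm_triangle_ineq4[of "z - x" "\<theta> *\<^sub>R h"] by (simp add: dist_norm algebra_simps)
      then show ?thesis using e by auto
    qed
    then show ?case using 4 \<delta> by auto
  qed (use assms \<delta> in auto)
  then obtain \<phi> where "averaging_kernel \<Omega> (ball z \<delta> \<inter> \<Omega>) \<phi>" ..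
  then show ?thesis using \<delta> by (intro exI[of _ "ball z \<delta>"] exI[of _ \<phi>]) simp
qed

text \<open>Near \<open>z\<close> the domain lies above the graph of \<open>g\<close>, so the admissible displacements contain a short
  cone around \<open>e\<close>: if the component of \<open>h\<close> along \<open>e\<close> exceeds \<open>L\<close> times the norm of its tangential part, then
  moving along \<open>h\<close> raises the last coordinate faster than \<open>g\<close> can grow.\<close>
lemma averaging_kernel_near_frontier:
  fixes \<Omega> :: "'a::euclidean_space set"
  assumes "open \<Omega>" "lipschitz_boundary \<Omega>" "z \<in> frontier \<Omega>"
  shows "\<exists>A \<phi>. open A \<and> z \<in> A \<and> averaging_kernel \<Omega> (A \<inter> \<Omega>) \<phi>"
proof -
  obtain U e g L where U: "open U" "z \<in> U" "norm e = 1" 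
    and g: "L-lipschitz_on {y. y \<bullet> e = 0} (g :: 'a \<Rightarrow> real)"
    and eq: "\<Omega> \<inter> U = {x \<in> U. g (x - (x \<bullet> e) *\<^sub>R e) < x \<bullet> e}"
    using assms(2)[unfolded lipschitz_boundary_def, rule_format, OF assms(3)] by blast
  obtain \<epsilon> where \<epsilon>: "0 < \<epsilon>" "ball z \<epsilon> \<subseteq> U" using U openE by blast
  define \<delta> where "\<delta> = min 1 (\<epsilon> / 2)"
  have \<delta>: "0 < \<delta>" "\<delta> \<le> 1" "2 * \<delta> \<le> \<epsilon>" using \<epsilon> by (auto simp: \<delta>_def)
  have ee: "e \<bullet> e = 1" using U by (simp add: norm_eq_sqrt_inner)
  define C where "C = {h. norm h < \<delta>} \<inter> {h. L * norm (h - (h \<bullet> e) *\<^sub>R e) < h \<bullet> e}"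
  have "open C" unfolding C_def
    by (intro open_Int open_Collect_less continuous_intros)
  moreover have "(\<delta> / 2) *\<^sub>R e \<in> C" using \<delta> U ee by (simp add: C_def)
  ultimately obtain \<rho> where \<rho>: "0 < \<rho>" "ball ((\<delta> / 2) *\<^sub>R e) \<rho> \<subseteq> C" using openE by blast
  have "\<exists>\<phi>. averaging_kernel \<Omega> (ball z \<delta> \<inter> \<Omega>) \<phi>"
  proof (rule averaging_kernel_exists[where c="(\<delta> / 2) *\<^sub>R e" and \<rho>=\<rho>], goal_cases)
    case (4 h)
    then have h: "norm h < \<delta>" "L * norm (h - (h \<bullet> e) *\<^sub>R e) < h \<bullet> e"
      using \<rho> by (auto simp: C_def)
    have "x + \<theta> *\<^sub>R h \<in> \<Omega>" if "x \<in> ball z \<delta>" "x \<in> \<Omega>" "\<theta> \<in> {0..1}" for x \<theta>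
    proof -
      have "norm (\<theta> *\<^sub>R h) \<le> norm h" using that by (simp add: mult_left_le_one_le)
      then have "dist z (x + \<theta> *\<^sub>R h) < \<epsilon>"
        using that h \<delta> norm_triangle_ineq4[of "z - x" "\<theta> *\<^sub>R h"] by (simp add: dist_norm algebra_simps)
      then have inU: "x + \<theta> *\<^sub>R h \<in> U" using \<epsilon> by auto
      have "x \<in> U" using that \<epsilon>(2) \<delta> by (intro subsetD[OF \<epsilon>(2)]) simp
      then have gx: "g (x - (x \<bullet> e) *\<^sub>R e) < x \<bullet> e" using that eq by blast
      let ?y = "x + \<theta> *\<^sub>R h"
      have "\<bar>g (?y - (?y \<bullet> e) *\<^sub>R e) - g (x - (x \<bullet> e) *\<^sub>R e)\<bar>
         \<le> L * norm ((?y - (?y \<bullet> e) *\<^sub>R e) - (x - (x \<bullet> e) *\<^sub>R e))"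
        using lipschitz_onD[OF g, of "?y - (?y \<bullet> e) *\<^sub>R e" "x - (x \<bullet> e) *\<^sub>R e"] ee
        by (simp add: dist_norm inner_diff_left)
      also have "(?y - (?y \<bullet> e) *\<^sub>R e) - (x - (x \<bullet> e) *\<^sub>R e) = \<theta> *\<^sub>R (h - (h \<bullet> e) *\<^sub>R e)"
        by (simp add: algebra_simps)
      also have "L * norm (\<theta> *\<^sub>R (h - (h \<bullet> e) *\<^sub>R e)) = \<theta> * (L * norm (h - (h \<bullet> e) *\<^sub>R e))"
        using that by simp
      also have "\<dots> \<le> \<theta> * (h \<bullet> e)" using that h by (intro mult_left_mono) auto
      finally have "g (?y - (?y \<bullet> e) *\<^sub>R e) < ?y \<bullet> e"
        using gx by (simp add: inner_add_left)
      then show ?thesis using inU eq by blast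
    qed
    then show ?case using h \<delta> by auto
  qed (use assms \<delta> \<rho> in auto)
  then obtain \<phi> where "averaging_kernel \<Omega> (ball z \<delta> \<inter> \<Omega>) \<phi>" ..
  then show ?thesis using \<delta> by (intro exI[of _ "ball z \<delta>"] exI[of _ \<phi>]) simp
qed

lemma averaging_kernel_cover:
  fixes \<Omega> :: "'a::euclidean_space set"
  assumes "open \<Omega>" "bounded \<Omega>" "lipschitz_boundary \<Omega>"
  obtains I where "finite I" "\<And>P \<phi>. (P, \<phi>) \<in> I \<Longrightarrow> averaging_kernel \<Omega> P \<phi>" "(\<Union>(P, \<phi>)\<in>I. P) = \<Omega>"
proof -
  have "\<exists>A \<phi>. open A \<and> z \<in> A \<and> averaging_kernel \<Omega> (A \<inter> \<Omega>) \<phi>" if "z \<in> closure \<Omega>" for z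
  proof (cases "z \<in> \<Omega>")
    case True
    then show ?thesis by (rule averaging_kernel_near_interior[OF assms(1)])
  next
    case False
    then have "z \<in> frontier \<Omega>" using that assms(1) by (simp add: frontier_def interior_open)
    then show ?thesis by (rule averaging_kernel_near_frontier[OF assms(1,3)])
  qed
  then obtain A \<phi> where A: "\<And>z. z \<in> closure \<Omega> \<Longrightarrow> open (A z) \<and> z \<in> A z \<and> averaging_kernel \<Omega> (A z \<inter> \<Omega>) (\<phi> z)"
    by metis
  have comp: "compact (closure \<Omega>)" using assms by (simp add: compact_closure)
  have cov: "closure \<Omega> \<subseteq> (\<Union>z\<in>closure \<Omega>. A z)" using A by auto
  obtain D where D: "D \<subseteq> closure \<Omega>" "finite D" "closure \<Omega> \<subseteq> (\<Union>z\<in>D. A z)"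
    by (rule compactE_image[OF comp _ cov]) (use A in auto)
  show thesis
  proof (rule that[of "(\<lambda>z. (A z \<inter> \<Omega>, \<phi> z)) ` D"])
    show "(\<Union>(P, \<phi>)\<in>(\<lambda>z. (A z \<inter> \<Omega>, \<phi> z)) ` D. P) = \<Omega>"
      using D closure_subset[of \<Omega>] by auto
  qed (use D A in auto)
qed

section \<open>Integrability up to the Sobolev exponent\<close>

lemma sublinear_self_bound:
  fixes J E1 E2 \<kappa> :: real
  assumes "J \<le> E1 * J powr \<kappa> + E2" "0 \<le> J" "0 \<le> E1" "0 \<le> E2" "0 \<le> \<kappa>" "\<kappa> < 1"
  shows "J \<le> 1 + (E1 + E2) powr (1 / (1 - \<kappa>))"
proof (cases "J \<le> 1")
  case False
  then have J: "1 < J" by simp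
  have "J \<le> (E1 + E2) * J powr \<kappa>"
    using assms J ge_one_powr_ge_zero[of J \<kappa>] mult_left_mono[of 1 "J powr \<kappa>" E2]
    by (simp add: distrib_right)
  then have "J powr (1 - \<kappa>) \<le> E1 + E2"
    using J by (simp add: powr_diff divide_le_eq)
  then have "(J powr (1 - \<kappa>)) powr (1 / (1 - \<kappa>)) \<le> (E1 + E2) powr (1 / (1 - \<kappa>))"
    using assms by (intro powr_mono2) auto
  then show ?thesis using assms J by (simp add: powr_powr)
next
  case True
  then show ?thesis by (smt (verit) powr_ge_zero)
qed

text \<open>Here \<open>t\<close> stands for \<open>\<bar>w x\<bar>\<close>, \<open>b j\<close> for the distance of \<open>w x\<close> to its average at the \<open>j\<close>-th scale, and
  \<open>\<tau> j / 2\<close> for a bound on that average.  Either \<open>t \<le> \<tau> 0\<close>, or \<open>t\<close> lies between two consecutive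
  thresholds, or it exceeds the last one; as soon as \<open>t > \<tau> j\<close>, one has \<open>t \<le> 2 \<bar>b j\<bar>\<close>, and in
  \<open>t\<^sup>R = t\<^sup>R\<^sup>-\<^sup>p t\<^sup>p\<close> the first factor is estimated by the upper threshold and the second one by \<open>b j\<close>.\<close>
lemma threshold_split:
  fixes t :: real and \<tau> b :: "nat \<Rightarrow> real"
  assumes p: "0 \<le> p" "p \<le> R" and \<tau>: "\<And>j. 0 \<le> \<tau> j" and b: "\<And>j. j \<le> n \<Longrightarrow> t - \<tau> j / 2 \<le> b j"
    and t: "0 \<le> t" "t \<le> \<Lambda>"
  shows "t powr R \<le> \<tau> 0 powr (R - p) * t powr p + (\<Sum>j<n. \<tau> (Suc j) powr (R - p) * 2 powr p * \<bar>b j\<bar> powr p)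
      + (if \<Lambda> \<le> \<tau> n then 0 else \<Lambda> powr (R - p) * 2 powr p * \<bar>b n\<bar> powr p)"
proof -
  have split: "t powr R = t powr (R - p) * t powr p"
    by (simp add: flip: powr_add)
  have low: "t powr R \<le> c powr (R - p) * t powr p" if "t \<le> c" for c
    unfolding split using that t p by (intro mult_right_mono powr_mono2) auto
  have high: "t powr R \<le> c powr (R - p) * 2 powr p * \<bar>b j\<bar> powr p" if "t \<le> c" "\<tau> j < t" "j \<le> n" for c j
  proof -
    have "t \<le> 2 * \<bar>b j\<bar>" using b[of j] that by auto
    then have "t powr p \<le> (2 * \<bar>b j\<bar>) powr p" using t p by (intro powr_mono2) auto
    then have "t powr p \<le> 2 powr p * \<bar>b j\<bar> powr p" by (simp add: powr_mult)
    then show ?thesis using low[OF that(1)] mult_left_mono[of _ _ "c powr (R - p)"]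
      by (smt (verit) mult.assoc powr_ge_zero)
  qed
  have cases: "t \<le> \<tau> 0 \<or> (\<exists>j<m. \<tau> j < t \<and> t \<le> \<tau> (Suc j)) \<or> \<tau> m < t" for m
  proof (induction m)
    case (Suc m)
    then show ?case by (meson less_SucI lessI not_less)
  qed auto
  have s0: "0 \<le> (\<Sum>j<n. \<tau> (Suc j) powr (R - p) * 2 powr p * \<bar>b j\<bar> powr p)"
    by (intro sum_nonneg) auto
  have f0: "0 \<le> \<tau> 0 powr (R - p) * t powr p" by simp
  have l0: "0 \<le> (if \<Lambda> \<le> \<tau> n then 0 else \<Lambda> powr (R - p) * 2 powr p * \<bar>b n\<bar> powr p)" by simp
  consider "t \<le> \<tau> 0" | j where "j < n" "\<tau> j < t" "t \<le> \<tau> (Suc j)" | "\<tau> n < t"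
    using cases[of n] by blast
  then show ?thesis
  proof cases
    case 1
    then show ?thesis using low[OF 1] s0 l0 by linarith
  next
    case (2 j)
    have "\<tau> (Suc j) powr (R - p) * 2 powr p * \<bar>b j\<bar> powr p
        \<le> (\<Sum>j<n. \<tau> (Suc j) powr (R - p) * 2 powr p * \<bar>b j\<bar> powr p)"
      using 2 by (intro member_le_sum) auto
    then show ?thesis using high[OF 2(3,2)] 2(1) f0 l0 by linarith
  next
    case 3
    then have "\<not> \<Lambda> \<le> \<tau> n" using t by linarith
    then show ?thesis using high[OF t(2) 3] s0 f0 by (simp only: if_False) linarith
  qed
qed

text \<open>The last clause is a bound by \<open>C\<close> on the nonlocal \<open>p\<close>-energy
  \<open>\<delta>\<^sup>-\<^sup>p\<^sup>-\<^sup>d \<integral>\<integral> \<bar>w x - w y\<bar>\<^sup>p\<close> over the pairs in \<open>\<Omega>\<close> at distance at most \<open>\<delta>\<close>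
  (see \<open>increment_integral_eq_double_integral\<close>).\<close>
definition nonlocal_Sobolev_bound ::
  "'a::euclidean_space set \<Rightarrow> real \<Rightarrow> real \<Rightarrow> real \<Rightarrow> ('a \<Rightarrow> real) \<Rightarrow> bool" where
  "nonlocal_Sobolev_bound \<Omega> p C \<delta> w \<longleftrightarrow>
     w \<in> borel_measurable borel \<and> (\<exists>c. \<forall>x. \<bar>w x\<bar> \<le> c) \<and> (\<forall>x. x \<notin> \<Omega> \<longrightarrow> w x = 0) \<and> 0 < \<delta> \<and>
     (\<integral>\<^sup>+x. ennreal (\<bar>w x\<bar> powr p) \<partial>lborel) \<le> ennreal C \<and>
     (\<integral>\<^sup>+v\<in>cball 0 \<delta>. increment_integral \<Omega> p w v \<partial>lborel) \<le> ennreal (C * \<delta> powr (p + DIM('a)))"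

lemma averaging_kernels_bounded:
  assumes "finite I" "\<And>P \<phi>. (P, \<phi>) \<in> I \<Longrightarrow> averaging_kernel \<Omega> P \<phi>"
  obtains B where "0 < B" "\<And>P \<phi> h. (P, \<phi>) \<in> I \<Longrightarrow> \<phi> h \<le> B"
proof -
  have "\<forall>i\<in>I. \<exists>B>0. \<forall>h. snd i h \<le> B" 
  proof
    fix i assume "i \<in> I"
    then have "averaging_kernel \<Omega> (fst i) (snd i)" by (intro assms(2)) simp
    then show "\<exists>B>0. \<forall>h. snd i h \<le> B" by (rule averaging_kernel_bounded)
  qed
  from bchoice[OF this] obtain b where b: "\<forall>i\<in>I. 0 < b i \<and> (\<forall>h. snd i h \<le> b i)" ..
  show thesis
  proof (rule that[of "1 + sum b I"])
    show "0 < 1 + sum b I" using b by (intro add_pos_nonneg sum_nonneg) (auto intro: less_imp_le)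
    fix P \<phi> h assume *: "(P, \<phi>) \<in> I"
    then have "\<phi> h \<le> b (P, \<phi>)" using b by fastforce
    also have "\<dots> \<le> sum b I" using * b assms(1) by (intro member_le_sum) (auto intro: less_imp_le)
    finally show "\<phi> h \<le> 1 + sum b I" by simp
  qed
qed

lemma integrable_bounded_support:
  fixes w :: "'a::euclidean_space \<Rightarrow> real"
  assumes "bounded \<Omega>" "w \<in> borel_measurable borel" "\<And>x. \<bar>w x\<bar> \<le> c" "\<And>x. x \<notin> \<Omega> \<Longrightarrow> w x = 0"
  shows "integrable lborel w"
proof -
  obtain r where "\<forall>x\<in>\<Omega>. norm x \<le> r" using assms(1) bounded_iff by auto
  then have r: "\<Omega> \<subseteq> cball 0 r" by auto
  show ?thesis
  proof (rule Bochner_Integration.integrable_bound)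
    show "integrable lborel (\<lambda>x::'a. c * indicator (cball 0 r) x :: real)"
      using emeasure_lborel_cball_finite[of "0::'a" r] 
      by (intro integrable_mult_right integrable_real_indicator) auto
    show "AE x in lborel. norm (w x) \<le> norm (c * indicator (cball 0 r) x :: real)"
    proof (intro AE_I2)
      fix x
      show "norm (w x) \<le> norm (c * indicator (cball 0 r) x :: real)"
        using assms(3)[of x] assms(4)[of x] subsetD[OF r, of x] by (cases "x \<in> cball 0 r") auto
    qed
  qed (use assms in auto)
qed

lemma nn_integral_cover_le:
  assumes "finite I" "f \<in> borel_measurable M" "\<And>i. i \<in> I \<Longrightarrow> A i \<in> sets M" and "\<And>x. x \<notin> (\<Union>i\<in>I. A i) \<Longrightarrow> f x = (0::ennreal)"
  shows "(\<integral>\<^sup>+x. f x \<partial>M) \<le> (\<Sum>i\<in>I. \<integral>\<^sup>+x\<in>A i. f x \<partial>M)"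
proof -
  have "(\<integral>\<^sup>+x. f x \<partial>M) \<le> (\<integral>\<^sup>+x. (\<Sum>i\<in>I. f x * indicator (A i) x) \<partial>M)"
  proof (rule nn_integral_mono)
    fix x
    show "f x \<le> (\<Sum>i\<in>I. f x * indicator (A i) x)"
    proof (cases "x \<in> (\<Union>i\<in>I. A i)")
      case True
      then obtain i where "i \<in> I" "x \<in> A i" by blast
      then have "f x = f x * indicator (A i) x" by simp
      also have "\<dots> \<le> (\<Sum>i\<in>I. f x * indicator (A i) x)" using \<open>i \<in> I\<close> assms(1) by (intro member_le_sum) auto
      finally show ?thesis .
    qed (use assms(4) in simp)
  qed
  also have "\<dots> = (\<Sum>i\<in>I. \<integral>\<^sup>+x\<in>A i. f x \<partial>M)"
    using assms by (intro nn_integral_sum) auto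
  finally show ?thesis .
qed

text \<open>Let \<open>J = \<integral> \<bar>w\<bar>\<^sup>R\<close>.  The averages at the scale \<open>s\<^sub>j = 2\<^sup>-\<^sup>j\<close> are at most \<open>\<tau>\<^sub>j / 2 = (B J / s\<^sub>j\<^sup>d)\<close> to the power
  \<open>1 / R\<close>.  Integrating \<open>threshold_split\<close> for the scales \<open>s\<^sub>0, \<dots>, s\<^sub>n\<close>, where \<open>\<delta> \<le> s\<^sub>n \<le> 2 \<delta>\<close>, bounds \<open>J\<close>
  by a multiple of \<open>J\<^sup>\<kappa>\<close>, \<open>\<kappa> = (R - p) / R < 1\<close>, plus a contribution of the values above \<open>\<tau>\<^sub>n\<close>.  The
  series in front of \<open>J\<^sup>\<kappa>\<close> is geometric with ratio \<open>2\<close> to the power \<open>d \<kappa> - p\<close>, whence the condition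
  \<open>d \<kappa> < p\<close>, which says that \<open>R\<close> is below the Sobolev exponent.

  The top contribution is at most a multiple of \<open>\<Lambda>\<^sup>R\<^sup>-\<^sup>p \<delta>\<^sup>p\<close>.  If \<open>\<Lambda> > \<tau>\<^sub>n\<close>, then on the set where \<open>\<bar>w\<bar> = \<Lambda>\<close>
  the function is far from its average, so \<open>\<Lambda>\<^sup>p m \<le> C \<delta>\<^sup>p\<close>; together with \<open>\<delta> \<le> C' m\<^sup>\<gamma>\<close> this leaves a
  nonnegative power \<open>e\<close> of \<open>m\<close>, and \<open>m\<close> is at most the volume of \<open>\<Omega>\<close>.\<close>
lemma nonlocal_higher_integrability:
  fixes \<Omega> :: "'a::euclidean_space set"
  assumes \<Omega>: "open \<Omega>" "bounded \<Omega>"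
    and I: "finite I" "\<And>P \<phi>. (P, \<phi>) \<in> I \<Longrightarrow> averaging_kernel \<Omega> P \<phi>" "(\<Union>(P, \<phi>)\<in>I. P) = \<Omega>"
    and p: "1 \<le> p" "p < R" "DIM('a) * ((R - p) / R) < p" and \<gamma>: "1 / p - 1 / R \<le> \<gamma>"
    and C: "0 \<le> C" "0 \<le> C'"
  shows "\<exists>M\<ge>0. \<forall>w \<delta> \<Lambda> m. nonlocal_Sobolev_bound \<Omega> p C \<delta> w \<and> \<delta> \<le> 1 \<and> (\<forall>x. \<bar>w x\<bar> \<le> \<Lambda>) \<and>
      0 < m \<and> ennreal m \<le> emeasure lborel {x\<in>\<Omega>. \<bar>w x\<bar> = \<Lambda>} \<and> \<delta> \<le> C' * m powr \<gamma>
      \<longrightarrow> (\<integral>\<^sup>+x. ennreal (\<bar>w x\<bar> powr R) \<partial>lborel) \<le> ennreal M"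
proof -
  obtain B where B: "0 < B" "\<And>P \<phi> h. (P, \<phi>) \<in> I \<Longrightarrow> \<phi> h \<le> B" 
    using averaging_kernels_bounded[OF I(1,2)] by metis
  have [measurable]: "\<Omega> \<in> sets borel" using \<Omega> by auto
  define d where "d = real DIM('a)"
  define \<kappa> where "\<kappa> = (R - p) / R"
  have \<kappa>: "0 < \<kappa>" "\<kappa> < 1" "d * \<kappa> < p" using p by (auto simp: \<kappa>_def d_def field_simps)
  have R: "1 < R" "0 < R" using p by auto
  define A where "A = B * 2 powr (p + d) * C"
  have A: "0 \<le> A" using B C by (simp add: A_def)
  define N where "N = real (card I)"
  define Q where "Q = N * 2 powr p * A"
  have Q: "0 \<le> Q" using A by (simp add: Q_def N_def)
  define e where "e = R * (\<gamma> - (1 / p - 1 / R))"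
  have e: "0 \<le> e" using \<gamma> R by (simp add: e_def)
  define G where "G = 2 powr (d * \<kappa>) / (1 - 2 powr (d * \<kappa> - p))"
  have geo: "2 powr (d * \<kappa> - p) < (1::real)" using \<kappa> by (simp add: powr_less_one)
  have G: "0 \<le> G" using geo by (simp add: G_def)
  define E1 where "E1 = N * ((2 powr R * B) powr \<kappa> * (C + G * 2 powr p * A))"
  define E2 where "E2 = Q powr (R / p) * (2 * C') powr R * measure lborel \<Omega> powr e"
  have E: "0 \<le> E1" "0 \<le> E2" using B C G A by (auto simp: E1_def E2_def N_def intro!: mult_nonneg_nonneg add_nonneg_nonneg)
  show ?thesis
  proof (intro exI[of _ "1 + (E1 + E2) powr (1 / (1 - \<kappa>))"] conjI allI impI)
    show "0 \<le> 1 + (E1 + E2) powr (1 / (1 - \<kappa>))" by (simp add: add_nonneg_nonneg)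
    fix w :: "'a \<Rightarrow> real" and \<delta> \<Lambda> m :: real
    assume "nonlocal_Sobolev_bound \<Omega> p C \<delta> w \<and> \<delta> \<le> 1 \<and> (\<forall>x. \<bar>w x\<bar> \<le> \<Lambda>) \<and>
      0 < m \<and> ennreal m \<le> emeasure lborel {x\<in>\<Omega>. \<bar>w x\<bar> = \<Lambda>} \<and> \<delta> \<le> C' * m powr \<gamma>"
    then have w[measurable]: "w \<in> borel_measurable borel" and w0: "\<And>x. x \<notin> \<Omega> \<Longrightarrow> w x = 0"
      and \<delta>: "0 < \<delta>" "\<delta> \<le> 1"
      and wp: "(\<integral>\<^sup>+x. ennreal (\<bar>w x\<bar> powr p) \<partial>lborel) \<le> ennreal C"
      and wE: "(\<integral>\<^sup>+v\<in>cball 0 \<delta>. increment_integral \<Omega> p w v \<partial>lborel) \<le> ennreal (C * \<delta> powr (p + DIM('a)))"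
      and \<Lambda>: "\<And>x. \<bar>w x\<bar> \<le> \<Lambda>" and m: "0 < m" "ennreal m \<le> emeasure lborel {x\<in>\<Omega>. \<bar>w x\<bar> = \<Lambda>}"
      and \<delta>m: "\<delta> \<le> C' * m powr \<gamma>"
      unfolding nonlocal_Sobolev_bound_def by auto
    have \<Lambda>0: "0 \<le> \<Lambda>" using \<Lambda>[of 0] by linarith
    have int: "integrable lborel (\<lambda>x. \<bar>w x\<bar> powr R)"
      by (rule integrable_bounded_support[OF \<Omega>(2), where c="\<Lambda> powr R"])
         (use w0 \<Lambda> R in \<open>auto intro!: powr_mono2\<close>)
    define J where "J = (\<integral>x. \<bar>w x\<bar> powr R \<partial>lborel)"
    have J: "(\<integral>\<^sup>+x. ennreal (\<bar>w x\<bar> powr R) \<partial>lborel) = ennreal J"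
      unfolding J_def by (rule nn_integral_eq_integral[OF int]) simp
    have J0: "0 \<le> J" by (simp add: J_def)
    define s where "s j = (1/2::real) ^ j" for j
    have s: "0 < s j" "s j \<le> 1" for j by (auto simp: s_def power_le_one)
    have sp: "s j powr a = 2 powr (- a * real j)" for j a
      by (simp add: s_def power_divide powr_divide powr_realpow[symmetric] powr_powr powr_minus_divide mult.commute)
    define \<tau> where "\<tau> j = 2 * (B * J / s j ^ DIM('a)) powr (1 / R)" for j
    have \<tau>0: "0 \<le> \<tau> j" for j by (simp add: \<tau>_def)
    have \<tau>R: "\<tau> j powr (R - p) = (2 powr R * B) powr \<kappa> * J powr \<kappa> * 2 powr (d * \<kappa> * real j)" for j
    proof -
      have sd: "s j ^ DIM('a) = 2 powr (- d * real j)"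
        using sp[of j d] s[of j] by (simp add: d_def powr_realpow)
      have "\<tau> j powr (R - p) = (\<tau> j powr R) powr \<kappa>" using R by (simp add: powr_powr \<kappa>_def)
      also have "\<tau> j powr R = 2 powr R * B * J * 2 powr (d * real j)"
        using R B J0 s by (simp add: \<tau>_def powr_mult powr_powr sd powr_minus_divide)
      also have "\<dots> powr \<kappa> = (2 powr R * B) powr \<kappa> * J powr \<kappa> * 2 powr (d * \<kappa> * real j)"
        using B J0 by (simp add: powr_mult powr_powr mult_ac)
      finally show ?thesis .
    qed
    have "\<exists>n. (1/2::real) ^ n < \<delta>" by (rule real_arch_pow_inv) (use \<delta> in auto)
    \<comment> \<open>The finest dyadic scale that is still at least \<open>\<delta>\<close>.\<close>
    define n where "n = (LEAST n. s (Suc n) < \<delta>)"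
    have ex: "\<exists>n. s (Suc n) < \<delta>"
    proof -
      obtain n where "(1/2::real) ^ n < \<delta>" using \<open>\<exists>n. (1/2::real) ^ n < \<delta>\<close> by auto
      moreover have "s (Suc n) \<le> (1/2) ^ n" by (simp add: s_def)
      ultimately show ?thesis using le_less_trans by blast
    qed
    have n1: "s (Suc n) < \<delta>" unfolding n_def by (rule LeastI_ex[OF ex])
    have n2: "\<delta> \<le> s n"
    proof (cases n)
      case (Suc k)
      then show ?thesis using not_less_Least[of k "\<lambda>n. s (Suc n) < \<delta>"] unfolding n_def[symmetric] by auto
    qed (use \<delta> in \<open>simp add: s_def\<close>)
    have n3: "\<delta> \<le> s j" if "j \<le> n" for j
    proof -
      have "s n \<le> s j" using that unfolding s_def by (intro power_decreasing) auto
      then show ?thesis using n2 by simp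
    qed
    have n4: "s n \<le> 2 * \<delta>" using n1 by (simp add: s_def)
    have avg: "\<bar>local_average \<phi> (s j) w x\<bar> \<le> \<tau> j / 2" if "(P, \<phi>) \<in> I" for P \<phi> j x
    proof -
      have "ennreal (\<bar>local_average \<phi> (s j) w x\<bar> powr R) \<le> ennreal (B / s j ^ DIM('a)) * ennreal J"
        unfolding J[symmetric]
        by (rule local_average_powr_le[where c=\<Lambda>, OF I(2)[OF that] w]) (use \<Lambda> R B that s in auto)
      also have "\<dots> = ennreal (B * J / s j ^ DIM('a))"
        using B J0 s[of j] by (simp flip: ennreal_mult)
      finally have "\<bar>local_average \<phi> (s j) w x\<bar> powr R \<le> B * J / s j ^ DIM('a)"
        using B J0 s[of j] by (subst (asm) ennreal_le_iff) auto
      then have "(\<bar>local_average \<phi> (s j) w x\<bar> powr R) powr (1 / R) \<le> (B * J / s j ^ DIM('a)) powr (1 / R)"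
        using R by (intro powr_mono2) auto
      then show ?thesis using R by (simp add: powr_powr \<tau>_def)
    qed
    have err: "(\<integral>\<^sup>+x\<in>P. ennreal (\<bar>w x - local_average \<phi> (s j) w x\<bar> powr p) \<partial>lborel) \<le> ennreal (A * s j powr p)"
      if "(P, \<phi>) \<in> I" "j \<le> n" for P \<phi> j
      unfolding A_def d_def
      by (rule local_average_error[where c=\<Lambda>, OF I(2)[OF that(1)] _ w]) (use \<Lambda> p B that s n3 \<delta> wE C in auto)
    \<comment> \<open>The coefficient of the last term in \<open>threshold_split\<close>.\<close>
    define \<theta> where "\<theta> = (if \<Lambda> \<le> \<tau> n then 0 else \<Lambda> powr (R - p))"
    have \<theta>0: "0 \<le> \<theta>" by (simp add: \<theta>_def)
    have top: "\<theta> * (Q * s n powr p) \<le> E2"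
    proof (cases "\<Lambda> \<le> \<tau> n")
      case False
      have "ennreal (\<Lambda> powr p * m) \<le> ennreal (\<Lambda> powr p) * emeasure lborel {x\<in>\<Omega>. \<bar>w x\<bar> = \<Lambda>}"
        using m by (simp add: ennreal_mult mult_left_mono)
      also have "\<dots> = (\<integral>\<^sup>+x. ennreal (\<Lambda> powr p) * indicator {x\<in>\<Omega>. \<bar>w x\<bar> = \<Lambda>} x \<partial>lborel)"
        by (subst nn_integral_cmult_indicator) auto
      also have "\<dots> \<le> (\<Sum>i\<in>I. \<integral>\<^sup>+x\<in>fst i. (ennreal (\<Lambda> powr p) * indicator {x\<in>\<Omega>. \<bar>w x\<bar> = \<Lambda>} x) \<partial>lborel)"
      proof (rule nn_integral_cover_le[OF I(1)])
        show "fst i \<in> sets lborel" if "i \<in> I" for i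
          using I(2)[of "fst i" "snd i"] that by (auto simp: averaging_kernel_def)
        show "ennreal (\<Lambda> powr p) * indicator {x\<in>\<Omega>. \<bar>w x\<bar> = \<Lambda>} x = 0" if "x \<notin> \<Union> (fst ` I)" for x
        proof -
          have "x \<notin> \<Omega>" using that I(3) by force
          then show ?thesis by simp
        qed
      qed simp
      also have "\<dots> \<le> (\<Sum>i\<in>I. ennreal (2 powr p * (A * s n powr p)))"
      proof (rule sum_mono)
        fix i assume "i \<in> I"
        then have i: "(fst i, snd i) \<in> I" by simp
        note [measurable] = averaging_kernel_measurable[OF I(2)[OF i]]
        have [measurable]: "fst i \<in> sets borel" using I(2)[OF i] by (simp add: averaging_kernel_def)
        have "(\<integral>\<^sup>+x\<in>fst i. (ennreal (\<Lambda> powr p) * indicator {x\<in>\<Omega>. \<bar>w x\<bar> = \<Lambda>} x) \<partial>lborel)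
          \<le> (\<integral>\<^sup>+x. ennreal (2 powr p) * (ennreal (\<bar>w x - local_average (snd i) (s n) w x\<bar> powr p) * indicator (fst i) x) \<partial>lborel)"
        proof (rule nn_integral_mono)
          fix x
          have "\<Lambda> powr p \<le> 2 powr p * \<bar>w x - local_average (snd i) (s n) w x\<bar> powr p" if "\<bar>w x\<bar> = \<Lambda>"
          proof -
            have "\<Lambda> \<le> 2 * \<bar>w x - local_average (snd i) (s n) w x\<bar>"
            proof -
              have arith: "L \<le> 2 * y" if "b \<le> t / 2" "\<not> L \<le> t" "L - b \<le> y" for b t y L :: real
                using that by linarith
              show ?thesis
                using arith[OF avg[OF i, of n x] False] that
                  abs_triangle_ineq2[of "w x" "local_average (snd i) (s n) w x"] by simp
            qed
            then have "\<Lambda> powr p \<le> (2 * \<bar>w x - local_average (snd i) (s n) w x\<bar>) powr p"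
              using \<Lambda>0 p by (intro powr_mono2) auto
            then show ?thesis by (simp add: powr_mult)
          qed
          then show "ennreal (\<Lambda> powr p) * indicator {x\<in>\<Omega>. \<bar>w x\<bar> = \<Lambda>} x * indicator (fst i) x
             \<le> ennreal (2 powr p) * (ennreal (\<bar>w x - local_average (snd i) (s n) w x\<bar> powr p) * indicator (fst i) x)"
            by (auto simp: indicator_def ennreal_leI simp flip: ennreal_mult)
        qed
        also have "\<dots> = ennreal (2 powr p) * (\<integral>\<^sup>+x\<in>fst i. ennreal (\<bar>w x - local_average (snd i) (s n) w x\<bar> powr p) \<partial>lborel)"
          unfolding local_average_def by (rule nn_integral_cmult) measurable
        also have "\<dots> \<le> ennreal (2 powr p) * ennreal (A * s n powr p)"
          by (intro mult_left_mono err[OF i]) auto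
        finally show "(\<integral>\<^sup>+x\<in>fst i. (ennreal (\<Lambda> powr p) * indicator {x\<in>\<Omega>. \<bar>w x\<bar> = \<Lambda>} x) \<partial>lborel)
           \<le> ennreal (2 powr p * (A * s n powr p))" using A by (simp add: ennreal_mult)
      qed
      also have "\<dots> = ennreal (Q * s n powr p)"
        using A by (simp add: Q_def N_def ennreal_of_nat_eq_real_of_nat mult.assoc flip: ennreal_mult)
      finally have "\<Lambda> powr p * m \<le> Q * s n powr p"
        using Q by (subst (asm) ennreal_le_iff) auto
      then have "\<Lambda> powr p \<le> Q * s n powr p / m" using m by (simp add: field_simps)
      then have "(\<Lambda> powr p) powr ((R - p) / p) \<le> (Q * s n powr p / m) powr ((R - p) / p)"
        using p by (intro powr_mono2) auto
      then have "\<theta> \<le> (Q * s n powr p / m) powr ((R - p) / p)"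
        using False p by (simp add: powr_powr \<theta>_def)
      then have "\<theta> * (Q * s n powr p) \<le> (Q * s n powr p / m) powr ((R - p) / p) * (Q * s n powr p)"
        using Q by (intro mult_right_mono) auto
      also have "\<dots> = (Q * s n powr p) powr (R / p) * m powr (- ((R - p) / p))"
      proof -
        have "R / p = (R - p) / p + 1" using p by (simp add: field_simps)
        then have "X powr (R / p) = X powr ((R - p) / p) * X" if "0 \<le> X" for X :: real
          using that by (simp add: powr_add)
        from this[of "Q * s n powr p"] show ?thesis using Q m by (simp add: powr_divide powr_minus_divide)
      qed
      also have "\<dots> = Q powr (R / p) * s n powr R * m powr (- ((R - p) / p))"
        using Q p by (simp add: powr_mult powr_powr)
      also have "\<dots> \<le> Q powr (R / p) * (2 * (C' * m powr \<gamma>)) powr R * m powr (- ((R - p) / p))"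
        using n4 \<delta>m R s[of n] by (intro mult_right_mono mult_left_mono powr_mono2) auto
      also have "\<dots> = Q powr (R / p) * (2 * C') powr R * m powr e"
      proof -
        have "\<gamma> * R + - ((R - p) / p) = e" using p by (simp add: e_def field_simps)
        then show ?thesis using C m by (simp add: powr_mult powr_powr mult.assoc flip: powr_add)
      qed
      also have "\<dots> \<le> E2"
      proof -
        have "ennreal m \<le> emeasure lborel \<Omega>" using m(2) by (rule order_trans) (auto intro!: emeasure_mono)
        also have "\<dots> = ennreal (measure lborel \<Omega>)"
          using emeasure_bounded_finite[OF \<Omega>(2)] by (simp add: emeasure_eq_ennreal_measure)
        finally have "m \<le> measure lborel \<Omega>" by (simp add: ennreal_le_iff)
        then show ?thesis unfolding E2_def using m e by (intro mult_left_mono powr_mono2) auto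
      qed
      finally show ?thesis .
    qed (use E in \<open>simp add: \<theta>_def\<close>)
    define T where "T = \<tau> 0 powr (R - p) * C + (\<Sum>j<n. \<tau> (Suc j) powr (R - p) * 2 powr p * (A * s j powr p))
       + \<theta> * 2 powr p * (A * s n powr p)"
    have piece: "(\<integral>\<^sup>+x\<in>P. ennreal (\<bar>w x\<bar> powr R) \<partial>lborel) \<le> ennreal T" if PI: "(P, \<phi>) \<in> I" for P \<phi>
    proof -
      note [measurable] = averaging_kernel_measurable[OF I(2)[OF PI]]
      have [measurable]: "P \<in> sets borel" using I(2)[OF PI] by (simp add: averaging_kernel_def)
      have [measurable]: "(\<lambda>x. local_average \<phi> (s j) w x) \<in> borel_measurable borel" for j
        unfolding local_average_def by measurable
      let ?b = "\<lambda>j x. \<bar>w x - local_average \<phi> (s j) w x\<bar> powr p"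
      have "ennreal (\<bar>w x\<bar> powr R) * indicator P x \<le> 
          ennreal (\<tau> 0 powr (R - p)) * ennreal (\<bar>w x\<bar> powr p) 
          + (\<Sum>j<n. ennreal (\<tau> (Suc j) powr (R - p) * 2 powr p) * (ennreal (?b j x) * indicator P x))
          + ennreal (\<theta> * 2 powr p) * (ennreal (?b n x) * indicator P x)" for x
      proof (cases "x \<in> P")
        case True
        have "\<bar>w x\<bar> powr R \<le> \<tau> 0 powr (R - p) * \<bar>w x\<bar> powr p
          + (\<Sum>j<n. \<tau> (Suc j) powr (R - p) * 2 powr p * \<bar>w x - local_average \<phi> (s j) w x\<bar> powr p)
          + \<theta> * 2 powr p * \<bar>w x - local_average \<phi> (s n) w x\<bar> powr p"
        proof -
          have "\<bar>w x\<bar> - \<tau> j / 2 \<le> \<bar>w x - local_average \<phi> (s j) w x\<bar>" for j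
            using avg[OF PI, of j x] abs_triangle_ineq2[of "w x" "local_average \<phi> (s j) w x"] by linarith
          from threshold_split[of p R \<tau> n "\<bar>w x\<bar>" "\<lambda>j. \<bar>w x - local_average \<phi> (s j) w x\<bar>", OF _ _ \<tau>0 this _ \<Lambda>]
          show ?thesis using p by (simp add: \<theta>_def split: if_splits)
        qed
        then have "ennreal (\<bar>w x\<bar> powr R) \<le> ennreal (\<tau> 0 powr (R - p) * \<bar>w x\<bar> powr p
          + (\<Sum>j<n. \<tau> (Suc j) powr (R - p) * 2 powr p * \<bar>w x - local_average \<phi> (s j) w x\<bar> powr p)
          + \<theta> * 2 powr p * \<bar>w x - local_average \<phi> (s n) w x\<bar> powr p)"
          by (rule ennreal_leI)
        also have "\<dots> = ennreal (\<tau> 0 powr (R - p)) * ennreal (\<bar>w x\<bar> powr p) 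
          + (\<Sum>j<n. ennreal (\<tau> (Suc j) powr (R - p) * 2 powr p) * ennreal (?b j x))
          + ennreal (\<theta> * 2 powr p) * ennreal (?b n x)"
          using \<theta>0 by (simp add: sum_nonneg sum_ennreal flip: ennreal_mult ennreal_plus)
        finally show ?thesis using True by simp
      qed simp
      then have "(\<integral>\<^sup>+x\<in>P. ennreal (\<bar>w x\<bar> powr R) \<partial>lborel) \<le>
         (\<integral>\<^sup>+x. ennreal (\<tau> 0 powr (R - p)) * ennreal (\<bar>w x\<bar> powr p) 
          + (\<Sum>j<n. ennreal (\<tau> (Suc j) powr (R - p) * 2 powr p) * (ennreal (?b j x) * indicator P x))
          + ennreal (\<theta> * 2 powr p) * (ennreal (?b n x) * indicator P x) \<partial>lborel)"
        by (rule nn_integral_mono)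
      also have "\<dots> = ennreal (\<tau> 0 powr (R - p)) * (\<integral>\<^sup>+x. ennreal (\<bar>w x\<bar> powr p) \<partial>lborel)
          + (\<Sum>j<n. ennreal (\<tau> (Suc j) powr (R - p) * 2 powr p) * (\<integral>\<^sup>+x\<in>P. ennreal (?b j x) \<partial>lborel))
          + ennreal (\<theta> * 2 powr p) * (\<integral>\<^sup>+x\<in>P. ennreal (?b n x) \<partial>lborel)"
        by (simp add: nn_integral_add nn_integral_sum nn_integral_cmult)
      also have "\<dots> \<le> ennreal (\<tau> 0 powr (R - p)) * ennreal C
          + (\<Sum>j<n. ennreal (\<tau> (Suc j) powr (R - p) * 2 powr p) * ennreal (A * s j powr p))
          + ennreal (\<theta> * 2 powr p) * ennreal (A * s n powr p)"
        by (intro add_mono mult_left_mono sum_mono err[OF PI] wp) auto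
      also have "\<dots> = ennreal T"
        using \<theta>0 C A by (simp add: T_def sum_nonneg sum_ennreal flip: ennreal_mult ennreal_plus)
      finally show ?thesis .
    qed
    have T0: "0 \<le> T" unfolding T_def using C A \<theta>0
      by (intro add_nonneg_nonneg sum_nonneg mult_nonneg_nonneg) auto
    have "ennreal J \<le> (\<Sum>i\<in>I. \<integral>\<^sup>+x\<in>fst i. ennreal (\<bar>w x\<bar> powr R) \<partial>lborel)"
      unfolding J[symmetric]
    proof (rule nn_integral_cover_le[OF I(1)])
      show "fst i \<in> sets lborel" if "i \<in> I" for i
        using I(2)[of "fst i" "snd i"] that by (auto simp: averaging_kernel_def)
      show "ennreal (\<bar>w x\<bar> powr R) = 0" if "x \<notin> \<Union> (fst ` I)" for x
      proof -
        have "x \<notin> \<Omega>" using that I(3) by force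
        then show ?thesis by (simp add: w0)
      qed
    qed simp
    also have "\<dots> \<le> (\<Sum>i\<in>I. ennreal T)"
      by (intro sum_mono piece[of "fst i" "snd i" for i]) auto
    also have "\<dots> = ennreal (N * T)"
      using T0 by (simp add: N_def ennreal_of_nat_eq_real_of_nat flip: ennreal_mult)
    finally have JT: "J \<le> N * T" using T0 by (simp add: N_def ennreal_le_iff)
    have Tle: "N * T \<le> E1 * J powr \<kappa> + E2"
    proof -
      define X where "X = (2 powr R * B) powr \<kappa> * J powr \<kappa>"
      have X0: "0 \<le> X" by (simp add: X_def)
      have "(\<Sum>j<n. \<tau> (Suc j) powr (R - p) * 2 powr p * (A * s j powr p))
         = X * 2 powr (d * \<kappa>) * 2 powr p * A * (\<Sum>j<n. (2 powr (d * \<kappa> - p)) ^ j)"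
        unfolding sum_distrib_left
      proof (rule sum.cong)
        fix j
        have "2 powr (d * \<kappa> * real (Suc j)) * 2 powr (- p * real j) = 2 powr (d * \<kappa>) * (2 powr (d * \<kappa> - p)) ^ j"
          by (simp add: powr_powr algebra_simps flip: powr_add powr_realpow)
        then show "\<tau> (Suc j) powr (R - p) * 2 powr p * (A * s j powr p)
          = X * 2 powr (d * \<kappa>) * 2 powr p * A * (2 powr (d * \<kappa> - p)) ^ j"
          unfolding \<tau>R sp X_def by (simp add: algebra_simps del: of_nat_Suc)
      qed simp
      also have "\<dots> \<le> X * 2 powr (d * \<kappa>) * 2 powr p * A * (1 / (1 - 2 powr (d * \<kappa> - p)))"
      proof (rule mult_left_mono)
        have "(\<Sum>j<n. (2 powr (d * \<kappa> - p)) ^ j) \<le> (\<Sum>j. (2 powr (d * \<kappa> - p)) ^ j)"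
          by (rule sum_le_suminf) (use geo in \<open>auto intro: summable_geometric\<close>)
        then show "(\<Sum>j<n. (2 powr (d * \<kappa> - p)) ^ j) \<le> 1 / (1 - 2 powr (d * \<kappa> - p))"
          using geo by (simp add: suminf_geometric)
      qed (use X0 A in simp)
      finally have S: "(\<Sum>j<n. \<tau> (Suc j) powr (R - p) * 2 powr p * (A * s j powr p)) \<le> X * (G * 2 powr p * A)"
        by (simp add: G_def mult_ac)
      have Z: "\<tau> 0 powr (R - p) = X" unfolding \<tau>R X_def by simp
      have "N * T \<le> N * (X * C + X * (G * 2 powr p * A)) + \<theta> * (Q * s n powr p)"
        unfolding T_def Z using mult_left_mono[OF S, of N] by (simp add: N_def Q_def algebra_simps)
      also have "\<dots> \<le> E1 * J powr \<kappa> + E2"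
        using top by (simp add: E1_def X_def algebra_simps)
      finally show ?thesis .
    qed
    have "J \<le> 1 + (E1 + E2) powr (1 / (1 - \<kappa>))"
      by (rule sublinear_self_bound) (use JT Tle J0 E \<kappa> in auto)
    then show "(\<integral>\<^sup>+x. ennreal (\<bar>w x\<bar> powr R) \<partial>lborel) \<le> ennreal (1 + (E1 + E2) powr (1 / (1 - \<kappa>)))"
      unfolding J by (rule ennreal_leI)
  qed
qed

section \<open>Compactness\<close>

lemma equi_lipschitz_convergent:
  fixes g :: "nat \<Rightarrow> 'a::metric_space \<Rightarrow> real"
  assumes lip: "\<And>n x y. \<bar>g n x - g n y\<bar> \<le> L * dist x y" and "0 \<le> L"
    and dense: "\<And>U. open U \<Longrightarrow> U \<noteq> {} \<Longrightarrow> \<exists>q\<in>Q. q \<in> U" and conv: "\<And>q. q \<in> Q \<Longrightarrow> convergent (\<lambda>n. g n q)"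
  shows "convergent (\<lambda>n. g n x)"
proof (rule Cauchy_convergent, rule metric_CauchyI)
  fix e :: real assume "0 < e"
  define \<rho> where "\<rho> = e / (4 * (L + 1))"
  have \<rho>: "0 < \<rho>" "L * \<rho> \<le> e / 4"
    using \<open>0 < e\<close> \<open>0 \<le> L\<close> by (auto simp: \<rho>_def field_simps)
  obtain q where q: "q \<in> Q" "dist x q < \<rho>" using dense[of "ball x \<rho>"] \<rho> by auto
  have near: "\<bar>g n x - g n q\<bar> \<le> e / 4" for n
    using lip[of n x q] mult_left_mono[of "dist x q" \<rho> L] q \<rho> \<open>0 \<le> L\<close> by linarith
  obtain N where N: "\<And>m n. N \<le> m \<Longrightarrow> N \<le> n \<Longrightarrow> dist (g m q) (g n q) < e / 4"
    using metric_CauchyD[OF convergent_Cauchy[OF conv[OF q(1)]], of "e / 4"] \<open>0 < e\<close> by auto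
  have "dist (g m x) (g n x) < e" if "N \<le> m" "N \<le> n" for m n
    using near[of m] near[of n] N[OF that] unfolding dist_real_def by linarith
  then show "\<exists>N. \<forall>m\<ge>N. \<forall>n\<ge>N. dist (g m x) (g n x) < e" by blast
qed

lemma nonlocal_Sobolev_bound_integrable:
  assumes "bounded \<Omega>" and w: "nonlocal_Sobolev_bound \<Omega> p C \<delta> w"
  shows "integrable lborel w"
proof -
  obtain c where "\<And>x. \<bar>w x\<bar> \<le> c" using w unfolding nonlocal_Sobolev_bound_def by blast
  then show ?thesis
    using w by (intro integrable_bounded_support[OF assms(1)]) (auto simp: nonlocal_Sobolev_bound_def)
qed

text \<open>A Young-type inequality that trades an \<open>L\<^sup>p\<close> error of size \<open>s\<close> for an \<open>L\<^sup>1\<close> error of size \<open>s\<close>.\<close>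
lemma abs_le_add_powr:
  fixes z s p :: real
  assumes "1 \<le> p" "0 < s"
  shows "\<bar>z\<bar> \<le> s + s powr (1 - p) * \<bar>z\<bar> powr p"
proof (cases "\<bar>z\<bar> \<le> s")
  case False
  then have "\<bar>z\<bar> = \<bar>z\<bar> powr (1 - p) * \<bar>z\<bar> powr p"
    using assms by (simp flip: powr_add)
  also have "\<dots> \<le> s powr (1 - p) * \<bar>z\<bar> powr p"
    using False assms by (intro mult_right_mono powr_mono2') auto
  finally show ?thesis using assms by linarith
qed (use assms in \<open>simp add: add_increasing2\<close>)

lemma nonlocal_Sobolev_bound_L1:
  fixes \<Omega> :: "'a::euclidean_space set"
  assumes \<Omega>: "open \<Omega>" "bounded \<Omega>" and p: "1 \<le> p" and C: "0 \<le> C"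
    and w: "nonlocal_Sobolev_bound \<Omega> p C \<delta> w"
  shows "(\<integral>\<^sup>+x. ennreal \<bar>w x\<bar> \<partial>lborel) \<le> ennreal (measure lborel \<Omega> + C)"
proof -
  have [measurable]: "\<Omega> \<in> sets borel" "w \<in> borel_measurable borel" 
    using \<Omega> w by (auto simp: nonlocal_Sobolev_bound_def)
  have "(\<integral>\<^sup>+x. ennreal \<bar>w x\<bar> \<partial>lborel) \<le> (\<integral>\<^sup>+x. (indicator \<Omega> x + ennreal (\<bar>w x\<bar> powr p)) \<partial>lborel)"
  proof (rule nn_integral_mono)
    fix x
    have "ennreal \<bar>w x\<bar> \<le> 1 + ennreal (\<bar>w x\<bar> powr p)"
      using ennreal_leI[OF abs_le_add_powr[OF p, of 1 "w x"]] by simp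
    then show "ennreal \<bar>w x\<bar> \<le> indicator \<Omega> x + ennreal (\<bar>w x\<bar> powr p)"
      using w by (cases "x \<in> \<Omega>") (auto simp: nonlocal_Sobolev_bound_def)
  qed
  also have "\<dots> = emeasure lborel \<Omega> + (\<integral>\<^sup>+x. ennreal (\<bar>w x\<bar> powr p) \<partial>lborel)"
    by (subst nn_integral_add) auto
  also have "\<dots> \<le> ennreal (measure lborel \<Omega>) + ennreal C"
    using w emeasure_bounded_finite[OF \<Omega>(2)]
    by (intro add_mono) (auto simp: nonlocal_Sobolev_bound_def emeasure_eq_ennreal_measure)
  finally show ?thesis using C by simp
qed

lemma local_average_error_L1:
  fixes \<Omega> :: "'a::euclidean_space set"
  assumes \<Omega>: "open \<Omega>" "bounded \<Omega>" and ker: "averaging_kernel \<Omega> P \<phi>" and B: "\<And>h. \<phi> h \<le> B"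
    and p: "1 \<le> p" and C: "0 \<le> C" and w: "nonlocal_Sobolev_bound \<Omega> p C \<delta> w" and s: "\<delta> \<le> s" "s \<le> 1"
  shows "(\<integral>\<^sup>+x\<in>P. ennreal \<bar>w x - local_average \<phi> s w x\<bar> \<partial>lborel)
     \<le> ennreal (s * (measure lborel \<Omega> + B * 2 powr (p + DIM('a)) * C))"
proof -
  note [measurable] = averaging_kernel_measurable[OF ker]
  have "0 \<le> B" using ker B[of 0] unfolding averaging_kernel_def by (meson order_trans)
  have [measurable]: "\<Omega> \<in> sets borel" "w \<in> borel_measurable borel" "P \<in> sets borel" and P: "P \<subseteq> \<Omega>"
    using \<Omega> w ker by (auto simp: nonlocal_Sobolev_bound_def averaging_kernel_def)
  have [measurable]: "(\<lambda>x. local_average \<phi> s w x) \<in> borel_measurable borel"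
    unfolding local_average_def by measurable
  obtain c where c: "\<And>x. \<bar>w x\<bar> \<le> c" using w unfolding nonlocal_Sobolev_bound_def by blast
  have \<delta>: "0 < \<delta>" using w by (simp add: nonlocal_Sobolev_bound_def)
  then have s0: "0 < s" using s by simp
  define A where "A = B * 2 powr (p + DIM('a)) * C"
  have A: "0 \<le> A" using \<open>0 \<le> B\<close> C by (simp add: A_def)
  have err: "(\<integral>\<^sup>+x\<in>P. ennreal (\<bar>w x - local_average \<phi> s w x\<bar> powr p) \<partial>lborel) \<le> ennreal (A * s powr p)"
    unfolding A_def
    by (rule local_average_error[where c=c, OF ker]) (use w \<delta> s p C c B in \<open>auto simp: nonlocal_Sobolev_bound_def\<close>)
  have "(\<integral>\<^sup>+x\<in>P. ennreal \<bar>w x - local_average \<phi> s w x\<bar> \<partial>lborel)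
     \<le> (\<integral>\<^sup>+x. (ennreal s * indicator \<Omega> x + ennreal (s powr (1 - p)) * (ennreal (\<bar>w x - local_average \<phi> s w x\<bar> powr p) * indicator P x)) \<partial>lborel)"
  proof (rule nn_integral_mono)
    fix x
    have "ennreal \<bar>w x - local_average \<phi> s w x\<bar> \<le> ennreal s + ennreal (s powr (1 - p)) * ennreal (\<bar>w x - local_average \<phi> s w x\<bar> powr p)"
      using ennreal_leI[OF abs_le_add_powr[OF p s0, of "w x - local_average \<phi> s w x"]] s0
      by (simp add: ennreal_mult)
    then show "ennreal \<bar>w x - local_average \<phi> s w x\<bar> * indicator P x
       \<le> ennreal s * indicator \<Omega> x + ennreal (s powr (1 - p)) * (ennreal (\<bar>w x - local_average \<phi> s w x\<bar> powr p) * indicator P x)"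
      using P by (cases "x \<in> P") auto
  qed
  also have "\<dots> = ennreal s * emeasure lborel \<Omega> + ennreal (s powr (1 - p)) * (\<integral>\<^sup>+x\<in>P. ennreal (\<bar>w x - local_average \<phi> s w x\<bar> powr p) \<partial>lborel)"
    by (subst nn_integral_add) (auto simp: nn_integral_cmult nn_integral_cmult_indicator)
  also have "\<dots> \<le> ennreal s * ennreal (measure lborel \<Omega>) + ennreal (s powr (1 - p)) * ennreal (A * s powr p)"
    using emeasure_bounded_finite[OF \<Omega>(2)]
    by (intro add_mono mult_left_mono err) (auto simp: emeasure_eq_ennreal_measure)
  also have "\<dots> = ennreal (s * measure lborel \<Omega> + s powr (1 - p) * (A * s powr p))"
    using s0 A by (simp add: ennreal_mult)
  also have "s * measure lborel \<Omega> + s powr (1 - p) * (A * s powr p) = s * (measure lborel \<Omega> + A)"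
    using s0 by (simp add: algebra_simps powr_diff)
  finally show ?thesis by (simp add: A_def)
qed

text \<open>A diagonal argument over the countably many triples of a kernel, a dyadic scale and a point of a
  countable dense set; the equi-Lipschitz bound extends convergence to all points.\<close>
lemma local_averages_convergent_subsequence:
  fixes \<Omega> :: "'a::euclidean_space set" and w :: "nat \<Rightarrow> 'a \<Rightarrow> real"
  assumes \<Omega>: "open \<Omega>" "bounded \<Omega>"
    and I: "finite I" "\<And>P \<phi>. (P, \<phi>) \<in> I \<Longrightarrow> averaging_kernel \<Omega> P \<phi>"
    and p: "1 \<le> p" and C: "0 \<le> C" and w: "\<And>n. nonlocal_Sobolev_bound \<Omega> p C (\<delta> n) (w n)"
  shows "\<exists>k :: nat \<Rightarrow> nat. strict_mono k \<and> (\<forall>(P, \<phi>)\<in>I. \<forall>m.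
    (\<forall>x. convergent (\<lambda>n. local_average \<phi> ((1/2) ^ m) (w (k n)) x)) \<and>
    (\<exists>b. \<forall>n x. \<bar>local_average \<phi> ((1/2) ^ m) (w n) x\<bar> \<le> b))"
proof -
  define W where "W = measure lborel \<Omega> + C"
  have W: "0 \<le> W" using C by (simp add: W_def)
  have L1: "(\<integral>\<^sup>+x. ennreal \<bar>w n x\<bar> \<partial>lborel) \<le> ennreal W" for n
    unfolding W_def by (rule nonlocal_Sobolev_bound_L1[OF \<Omega> p C w])
  have int: "integrable lborel (w n)" for n by (rule nonlocal_Sobolev_bound_integrable[OF \<Omega>(2) w])
  have L1': "(\<integral>x. \<bar>w n x\<bar> \<partial>lborel) \<le> W" for n
  proof -
    have "ennreal (\<integral>x. \<bar>w n x\<bar> \<partial>lborel) = (\<integral>\<^sup>+x. ennreal \<bar>w n x\<bar> \<partial>lborel)"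
      using int[of n] by (subst nn_integral_eq_integral) auto
    then have "ennreal (\<integral>x. \<bar>w n x\<bar> \<partial>lborel) \<le> ennreal W" using L1[of n] by simp
    then show ?thesis using W by (subst (asm) ennreal_le_iff)
  qed
  obtain B where B: "0 < B" "\<And>P \<phi> h. (P, \<phi>) \<in> I \<Longrightarrow> \<phi> h \<le> B" 
    using averaging_kernels_bounded[OF I(1,2)] by metis
  define s where "s m = (1/2::real) ^ m" for m
  have s: "0 < s m" for m by (simp add: s_def)
  define b where "b m = B / s m ^ DIM('a) * W + 1" for m
  have b: "0 < b m" for m using B W s[of m] by (simp add: b_def add_nonneg_pos)
  have bound: "\<bar>local_average \<phi> (s m) (w n) x\<bar> \<le> b m" if PI: "(P, \<phi>) \<in> I" for P \<phi> m n x
  proof -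
    obtain c where c: "\<And>x. \<bar>w n x\<bar> \<le> c" using w[of n] unfolding nonlocal_Sobolev_bound_def by blast
    have wm: "w n \<in> borel_measurable borel" using w by (simp add: nonlocal_Sobolev_bound_def)
    have "ennreal (\<bar>local_average \<phi> (s m) (w n) x\<bar> powr 1)
       \<le> ennreal (B / s m ^ DIM('a)) * (\<integral>\<^sup>+y. ennreal (\<bar>w n y\<bar> powr 1) \<partial>lborel)"
      by (rule local_average_powr_le[where c=c, OF I(2)[OF PI] wm c]) (use B PI s in auto)
    also have "\<dots> \<le> ennreal (B / s m ^ DIM('a)) * ennreal W"
      using L1[of n] by (intro mult_left_mono) auto
    also have "\<dots> = ennreal (B / s m ^ DIM('a) * W)"
      using B W s[of m] by (simp flip: ennreal_mult)
    finally have "\<bar>local_average \<phi> (s m) (w n) x\<bar> \<le> B / s m ^ DIM('a) * W"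
      using B W s[of m] by (subst (asm) ennreal_le_iff) auto
    then show ?thesis by (simp add: b_def)
  qed
  obtain Q :: "'a set" where Q: "countable Q" "\<And>U. open U \<Longrightarrow> U \<noteq> {} \<Longrightarrow> \<exists>q\<in>Q. q \<in> U"
    using countable_dense_exists by blast
  define S where "S = I \<times> (UNIV :: nat set) \<times> Q"
  \<comment> \<open>Dividing by the bound for the scale makes the whole family bounded by \<open>1\<close>.\<close>
  define F where "F n = (\<lambda>(i :: 'a set \<times> ('a \<Rightarrow> real), m, x). local_average (snd i) (s m) (w n) x / b m)" for n
  have "countable S" unfolding S_def using I(1) Q(1) by (intro countable_SIGMA) (auto intro: countable_finite)
  moreover have "norm (F n z) \<le> 1" if "z \<in> S" for n z
  proof -
    have "(fst (fst z), snd (fst z)) \<in> I" using that by (auto simp: S_def)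
    from bound[OF this, of "fst (snd z)" n "snd (snd z)"] b[of "fst (snd z)"]
    show ?thesis by (simp add: F_def abs_divide case_prod_beta)
  qed
  ultimately obtain k where k: "strict_mono k" "\<And>z. z \<in> S \<Longrightarrow> \<exists>l. (\<lambda>n. F (k n) z) \<longlonglongrightarrow> l"
    by (rule function_convergent_subsequence[of S F 1]) (assumption | blast)+
  have conv: "convergent (\<lambda>n. local_average \<phi> (s m) (w (k n)) x)" if PI: "(P, \<phi>) \<in> I" for P \<phi> m x
  proof -
    obtain L where L: "L-lipschitz_on UNIV \<phi>" using I(2)[OF PI] unfolding averaging_kernel_def by blast
    have L0: "0 \<le> L" by (rule lipschitz_on_nonneg[OF L])
    show ?thesis
    proof (rule equi_lipschitz_convergent[where L="L / s m ^ Suc DIM('a) * W" and Q=Q])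
      fix n x y
      show "\<bar>local_average \<phi> (s m) (w (k n)) x - local_average \<phi> (s m) (w (k n)) y\<bar> \<le> L / s m ^ Suc DIM('a) * W * dist x y"
        using local_average_lipschitz[OF L int s I(2)[OF PI], of m "k n" x y]
          mult_right_mono[OF mult_left_mono[OF L1'[of "k n"], of "L / s m ^ Suc DIM('a)"], of "norm (x - y)"] L0 s[of m]
        by (simp add: dist_norm)
    next
      fix q assume "q \<in> Q"
      then obtain l where "(\<lambda>n. F (k n) ((P, \<phi>), m, q)) \<longlonglongrightarrow> l"
        using k(2)[of "((P, \<phi>), m, q)"] PI by (auto simp: S_def)
      then have "(\<lambda>n. local_average \<phi> (s m) (w (k n)) q / b m * b m) \<longlonglongrightarrow> l * b m"
        by (intro tendsto_mult_right) (simp add: F_def)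
      then show "convergent (\<lambda>n. local_average \<phi> (s m) (w (k n)) q)"
        using b[of m] by (auto simp: convergent_def)
    qed (use L0 W s[of m] Q in auto)
  qed
  show ?thesis
    using k(1) conv bound unfolding s_def
    by (intro exI[of _ k] conjI) (auto, metis)
qed

text \<open>For indices \<open>i, j\<close> so large that \<open>\<delta> < s\<close>, the triangle inequality splits \<open>w\<^sub>i - w\<^sub>j\<close> into the two
  approximation errors by averages at the scale \<open>s\<close>, of size \<open>s\<close> in \<open>L\<^sup>1\<close>, and the difference of these averages,
  which tends to \<open>0\<close> by dominated convergence.\<close>
lemma nonlocal_AE_convergent_subsequence:
  fixes \<Omega> :: "'a::euclidean_space set" and w :: "nat \<Rightarrow> 'a \<Rightarrow> real"
  assumes \<Omega>: "open \<Omega>" "bounded \<Omega>"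
    and I: "finite I" "\<And>P \<phi>. (P, \<phi>) \<in> I \<Longrightarrow> averaging_kernel \<Omega> P \<phi>" "(\<Union>(P, \<phi>)\<in>I. P) = \<Omega>"
    and p: "1 \<le> p" and C: "0 \<le> C" and w: "\<And>n. nonlocal_Sobolev_bound \<Omega> p C (\<delta> n) (w n)"
    and \<delta>: "\<delta> \<longlonglongrightarrow> 0"
  obtains k f where "strict_mono (k :: nat \<Rightarrow> nat)" "f \<in> borel_measurable borel"
    "AE x in lborel. (\<lambda>n. w (k n) x) \<longlonglongrightarrow> f x"
proof -
  have [measurable]: "\<Omega> \<in> sets borel" "w n \<in> borel_measurable borel" for n
    using \<Omega> w by (auto simp: nonlocal_Sobolev_bound_def)
  have int: "integrable lborel (w n)" for n by (rule nonlocal_Sobolev_bound_integrable[OF \<Omega>(2) w])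
  obtain k where k: "strict_mono (k :: nat \<Rightarrow> nat)"
    and conv: "\<And>P \<phi> m x. (P, \<phi>) \<in> I \<Longrightarrow> convergent (\<lambda>n. local_average \<phi> ((1/2) ^ m) (w (k n)) x)"
    and bd: "\<And>P \<phi> m. (P, \<phi>) \<in> I \<Longrightarrow> \<exists>b. \<forall>n x. \<bar>local_average \<phi> ((1/2) ^ m) (w n) x\<bar> \<le> b"
    using local_averages_convergent_subsequence[where w=w and \<delta>=\<delta>, OF \<Omega> I(1,2) p C w] by blast
  obtain B where B: "0 < B" "\<And>P \<phi> h. (P, \<phi>) \<in> I \<Longrightarrow> \<phi> h \<le> B" 
    using averaging_kernels_bounded[OF I(1,2)] by metis
  define H where "H = measure lborel \<Omega> + B * 2 powr (p + DIM('a)) * C"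
  have H: "0 \<le> H" using B C by (simp add: H_def)
  define N where "N = real (card I)"
  define a where "a i m x = lim (\<lambda>n. local_average (snd i) ((1/2) ^ m) (w (k n)) x)" for i :: "'a set \<times> ('a \<Rightarrow> real)" and m x
  have kmeas: "snd i \<in> borel_measurable borel" "fst i \<in> sets borel" if "i \<in> I" for i
    using I(2)[of "fst i" "snd i"] that averaging_kernel_measurable[OF I(2)[of "fst i" "snd i"]] by (auto simp: averaging_kernel_def)
  have avm: "(\<lambda>x. local_average (snd i) ((1/2) ^ m) (w n) x) \<in> borel_measurable borel" if "i \<in> I" for i m n
  proof -
    note [measurable] = kmeas[OF that]
    show ?thesis unfolding local_average_def by measurable
  qed
  have am: "(\<lambda>x. a i m x) \<in> borel_measurable borel" if "i \<in> I" for i m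
    unfolding a_def by (rule borel_measurable_lim_metric) (rule avm[OF that])
  have avconv: "(\<lambda>n. \<integral>\<^sup>+x\<in>fst i. ennreal \<bar>a i m x - local_average (snd i) ((1/2) ^ m) (w (k n)) x\<bar> \<partial>lborel) \<longlonglongrightarrow> 0" 
    if i: "i \<in> I" for i m
  proof -
    note [measurable] = kmeas[OF i] avm[OF i] am[OF i]
    have i': "(fst i, snd i) \<in> I" using i by simp
    obtain b where b: "\<And>n x. \<bar>local_average (snd i) ((1/2) ^ m) (w n) x\<bar> \<le> b" using bd[OF i'] by metis
    have P: "fst i \<subseteq> \<Omega>" using I(2)[OF i'] by (simp add: averaging_kernel_def)
    let ?u = "\<lambda>n x. local_average (snd i) ((1/2) ^ m) (w (k n)) x * indicator (fst i) x"
    have "(\<lambda>n. \<integral>\<^sup>+x. norm (a i m x * indicator (fst i) x - ?u n x) \<partial>lborel) \<longlonglongrightarrow> 0"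
    proof (rule nn_integral_dominated_convergence_norm[where w="\<lambda>x. b * indicator \<Omega> x"])
      show "AE x in lborel. norm (?u n x) \<le> b * indicator \<Omega> x" for n
        using b P order_trans[OF abs_ge_zero b] by (intro AE_I2) (auto simp: indicator_def)
      have "(\<integral>\<^sup>+x. ennreal (b * indicator \<Omega> x) \<partial>lborel) = (\<integral>\<^sup>+x. ennreal b * indicator \<Omega> x \<partial>lborel)"
        by (intro nn_integral_cong) (auto simp: indicator_def)
      also have "\<dots> = ennreal b * emeasure lborel \<Omega>" by (subst nn_integral_cmult_indicator) auto
      also have "\<dots> < \<infinity>" using emeasure_bounded_finite[OF \<Omega>(2)] by (simp add: ennreal_mult_less_top)
      finally show "(\<integral>\<^sup>+x. ennreal (b * indicator \<Omega> x) \<partial>lborel) < \<infinity>" .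
      have "(\<lambda>n. local_average (snd i) ((1/2) ^ m) (w (k n)) x) \<longlonglongrightarrow> a i m x" for x
        unfolding a_def using conv[OF i'] by (simp add: convergent_LIMSEQ_iff)
      then show "AE x in lborel. (\<lambda>n. ?u n x) \<longlonglongrightarrow> a i m x * indicator (fst i) x"
        by (intro AE_I2 tendsto_mult_right)
    qed measurable
    also have "(\<lambda>n. \<integral>\<^sup>+x. norm (a i m x * indicator (fst i) x - ?u n x) \<partial>lborel)
       = (\<lambda>n. \<integral>\<^sup>+x\<in>fst i. ennreal \<bar>a i m x - local_average (snd i) ((1/2) ^ m) (w (k n)) x\<bar> \<partial>lborel)"
      by (intro ext nn_integral_cong) (auto simp: indicator_def)
    finally show ?thesis .
  qed
  have cauchy: "\<exists>N. \<forall>i\<ge>N. \<forall>j\<ge>N. LINT x|lborel. norm (w (k i) x - w (k j) x) < e" if e: "0 < e" for e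
  proof -
    \<comment> \<open>A scale so small that all approximation errors together are at most \<open>e / 4\<close> for each index.\<close>
    have "\<exists>m. (1/2::real) ^ m < e / (4 * (N * H + 1))" 
      by (rule real_arch_pow_inv) (use e H in \<open>auto simp: N_def intro!: divide_pos_pos mult_pos_pos add_nonneg_pos\<close>)
    then obtain m where m: "(1/2::real) ^ m < e / (4 * (N * H + 1))" by blast
    define s where "s = (1/2::real) ^ m"
    have s: "0 < s" "s \<le> 1" by (auto simp: s_def power_le_one)
    have NH: "0 \<le> N * H" using H by (simp add: N_def)
    have se: "N * (s * H) \<le> e / 4"
    proof -
      have "N * (s * H) = s * (N * H)" by simp
      also have "\<dots> \<le> s * (N * H + 1)" using s by simp
      also have "\<dots> \<le> e / (4 * (N * H + 1)) * (N * H + 1)"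
        using m NH by (intro mult_right_mono) (auto simp: s_def)
      also have "\<dots> = e / 4" using NH by (simp add: field_simps)
      finally show ?thesis .
    qed
    define X where "X n = (\<Sum>i\<in>I. \<integral>\<^sup>+x\<in>fst i. ennreal \<bar>a i m x - local_average (snd i) s (w (k n)) x\<bar> \<partial>lborel)" for n
    have "X \<longlonglongrightarrow> (\<Sum>i\<in>I. 0)"
      unfolding X_def s_def by (intro tendsto_sum avconv)
    then have "\<forall>\<^sub>F n in sequentially. X n < ennreal (e / 8)"
      using e by (intro order_tendstoD) auto
    moreover have "\<forall>\<^sub>F n in sequentially. \<delta> (k n) < s"
      using LIMSEQ_subseq_LIMSEQ[OF \<delta> k] s by (intro order_tendstoD) (auto simp: o_def)
    ultimately have "\<forall>\<^sub>F n in sequentially. X n < ennreal (e / 8) \<and> \<delta> (k n) < s" by (rule eventually_conj)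
    then obtain N0 where N0: "\<And>n. N0 \<le> n \<Longrightarrow> X n < ennreal (e / 8) \<and> \<delta> (k n) < s"
      unfolding eventually_sequentially by blast
    have "LINT x|lborel. norm (w (k i) x - w (k j) x) < e" if ij: "N0 \<le> i" "N0 \<le> j" for i j
    proof -
      define Y where "Y = (\<lambda>n l. \<integral>\<^sup>+x\<in>fst l. ennreal \<bar>w (k n) x - local_average (snd l) s (w (k n)) x\<bar> \<partial>lborel)"
      define Z where "Z = (\<lambda>n l. \<integral>\<^sup>+x\<in>fst l. ennreal \<bar>a l m x - local_average (snd l) s (w (k n)) x\<bar> \<partial>lborel)"
      have piece: "(\<integral>\<^sup>+x\<in>fst l. ennreal \<bar>w (k i) x - w (k j) x\<bar> \<partial>lborel) \<le> Y i l + Y j l + (Z i l + Z j l)" if l: "l \<in> I" for l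
      proof -
        note [measurable] = kmeas[OF l] avm[OF l, of m, folded s_def] am[OF l]
        have "(\<integral>\<^sup>+x\<in>fst l. ennreal \<bar>w (k i) x - w (k j) x\<bar> \<partial>lborel) \<le>
          (\<integral>\<^sup>+x. (ennreal \<bar>w (k i) x - local_average (snd l) s (w (k i)) x\<bar> * indicator (fst l) x
             + ennreal \<bar>w (k j) x - local_average (snd l) s (w (k j)) x\<bar> * indicator (fst l) x
             + (ennreal \<bar>a l m x - local_average (snd l) s (w (k i)) x\<bar> * indicator (fst l) x
             + ennreal \<bar>a l m x - local_average (snd l) s (w (k j)) x\<bar> * indicator (fst l) x)) \<partial>lborel)"
          by (intro nn_integral_mono)
             (auto simp: indicator_def simp flip: ennreal_plus intro!: ennreal_leI)
        also have "\<dots> = Y i l + Y j l + (Z i l + Z j l)"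
          unfolding Y_def Z_def by (simp add: nn_integral_add)
        finally show ?thesis .
      qed
      have Y: "Y n l \<le> ennreal (s * H)" if "l \<in> I" "N0 \<le> n" for n l
        unfolding Y_def H_def
        by (rule local_average_error_L1[OF \<Omega> I(2)[of "fst l" "snd l"] _ p C w])
           (use that B(2)[of "fst l" "snd l"] N0[of n] s in auto)
      have Ysum: "(\<Sum>l\<in>I. Y n l) \<le> ennreal (e / 4)" if "N0 \<le> n" for n
      proof -
        have "(\<Sum>l\<in>I. Y n l) \<le> (\<Sum>l\<in>I. ennreal (s * H))" using Y that by (intro sum_mono) auto
        also have "\<dots> = ennreal (N * (s * H))"
          using s H by (simp add: N_def ennreal_of_nat_eq_real_of_nat flip: ennreal_mult)
        also have "\<dots> \<le> ennreal (e / 4)" using se by (rule ennreal_leI)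
        finally show ?thesis .
      qed
      have Zsum: "(\<Sum>l\<in>I. Z n l) \<le> ennreal (e / 8)" if "N0 \<le> n" for n
        using N0[OF that] unfolding X_def Z_def by (simp add: less_imp_le)
      have "ennreal (LINT x|lborel. norm (w (k i) x - w (k j) x)) = (\<integral>\<^sup>+x. ennreal \<bar>w (k i) x - w (k j) x\<bar> \<partial>lborel)"
        using int by (subst nn_integral_eq_integral) auto
      also have "\<dots> \<le> (\<Sum>l\<in>I. \<integral>\<^sup>+x\<in>fst l. ennreal \<bar>w (k i) x - w (k j) x\<bar> \<partial>lborel)"
      proof (rule nn_integral_cover_le[OF I(1)])
        show "fst i \<in> sets lborel" if "i \<in> I" for i using kmeas[OF that] by simp
        show "ennreal \<bar>w (k i) x - w (k j) x\<bar> = 0" if "x \<notin> \<Union> (fst ` I)" for x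
        proof -
          have "x \<notin> \<Omega>" using that I(3) by force
          then show ?thesis using w by (simp add: nonlocal_Sobolev_bound_def)
        qed
      qed simp
      also have "\<dots> \<le> (\<Sum>l\<in>I. Y i l + Y j l + (Z i l + Z j l))"
        by (rule sum_mono) (rule piece)
      also have "\<dots> = (\<Sum>l\<in>I. Y i l) + (\<Sum>l\<in>I. Y j l) + ((\<Sum>l\<in>I. Z i l) + (\<Sum>l\<in>I. Z j l))"
        by (simp add: sum.distrib)
      also have "\<dots> \<le> ennreal (e / 4) + ennreal (e / 4) + (ennreal (e / 8) + ennreal (e / 8))"
        by (intro add_mono Ysum Zsum ij)
      also have "\<dots> = ennreal (3 * e / 4)" using e by (simp flip: ennreal_plus)
      finally have "LINT x|lborel. norm (w (k i) x - w (k j) x) \<le> 3 * e / 4"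
        using e by (subst (asm) ennreal_le_iff) auto
      then show ?thesis using e by linarith
    qed
    then show ?thesis by blast
  qed
  obtain r where r: "strict_mono r" "AE x in lborel. Cauchy (\<lambda>i. w (k (r i)) x)"
    by (rule cauchy_L1_AE_cauchy_subseq[of lborel "\<lambda>n. w (k n)"]) (use int cauchy in auto)
  show thesis
  proof (rule that)
    show "strict_mono (k \<circ> r)" using k r(1) by (rule strict_mono_o)
    show "(\<lambda>x. lim (\<lambda>n. w ((k \<circ> r) n) x)) \<in> borel_measurable borel"
      by (rule borel_measurable_lim_metric) simp
    show "AE x in lborel. (\<lambda>n. w ((k \<circ> r) n) x) \<longlonglongrightarrow> lim (\<lambda>n. w ((k \<circ> r) n) x)"
      using r(2) by eventually_elim (simp add: Cauchy_convergent convergent_LIMSEQ_iff[symmetric])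
  qed
qed

section \<open>From the graph to the domain\<close>

lemma nn_integral_density_bounds:
  fixes f :: "'a::euclidean_space \<Rightarrow> ennreal"
  assumes "open \<Omega>" and \<mu>: "\<mu> = density (restrict_space lborel \<Omega>) (\<lambda>x. ennreal (\<rho> x))"
    and \<rho>: "continuous_on \<Omega> \<rho>" and "0 < D" and D: "\<And>x. x \<in> \<Omega> \<Longrightarrow> 1 / D \<le> \<rho> x \<and> \<rho> x \<le> D"
    and f[measurable]: "f \<in> borel_measurable borel"
  shows "(\<integral>\<^sup>+x. f x \<partial>\<mu>) \<le> ennreal D * (\<integral>\<^sup>+x\<in>\<Omega>. f x \<partial>lborel)" (is ?upper)
    and "(\<integral>\<^sup>+x\<in>\<Omega>. f x \<partial>lborel) \<le> ennreal D * (\<integral>\<^sup>+x. f x \<partial>\<mu>)" (is ?lower)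
proof -
  have \<Omega>[measurable]: "\<Omega> \<in> sets borel" using assms by auto
  have sets: "sets (restrict_space lborel \<Omega>) = sets (restrict_space borel \<Omega>)"
    by (simp add: sets_restrict_space)
  have [measurable]: "\<rho> \<in> borel_measurable (restrict_space lborel \<Omega>)"
    unfolding measurable_cong_sets[OF sets refl] by (rule borel_measurable_continuous_on_restrict[OF \<rho>])
  have [measurable]: "f \<in> borel_measurable (restrict_space lborel \<Omega>)"
    by (rule measurable_restrict_space1) simp
  have eq: "(\<integral>\<^sup>+x. f x \<partial>\<mu>) = (\<integral>\<^sup>+x. ennreal (\<rho> x) * f x * indicator \<Omega> x \<partial>lborel)"
    unfolding \<mu> by (subst nn_integral_density) (auto simp: nn_integral_restrict_space)
  have "(\<integral>\<^sup>+x. f x \<partial>\<mu>) \<le> (\<integral>\<^sup>+x. ennreal D * (f x * indicator \<Omega> x) \<partial>lborel)"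
    unfolding eq by (intro nn_integral_mono) (auto simp: indicator_def intro!: mult_right_mono ennreal_leI D[THEN conjunct2])
  then show ?upper by (simp add: nn_integral_cmult)
  have [measurable]: "(\<lambda>x. ennreal (\<rho> x) * f x * indicator \<Omega> x) \<in> borel_measurable borel"
  proof -
    have "(\<lambda>x. ennreal (\<rho> x) * f x) \<in> borel_measurable (restrict_space borel \<Omega>)"
      unfolding measurable_cong_sets[OF sets[symmetric] refl] by measurable
    then show ?thesis by (subst (asm) borel_measurable_restrict_space_iff_ennreal) auto
  qed
  have "(\<integral>\<^sup>+x\<in>\<Omega>. f x \<partial>lborel) \<le> (\<integral>\<^sup>+x. ennreal D * (ennreal (\<rho> x) * f x * indicator \<Omega> x) \<partial>lborel)"
  proof (rule nn_integral_mono)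
    fix x
    show "f x * indicator \<Omega> x \<le> ennreal D * (ennreal (\<rho> x) * f x * indicator \<Omega> x)"
    proof (cases "x \<in> \<Omega>")
      case True
      have "1 \<le> D * \<rho> x" using D[OF True] \<open>0 < D\<close> by (simp add: field_simps)
      then have "1 \<le> ennreal D * ennreal (\<rho> x)"
        using ennreal_leI[of 1 "D * \<rho> x"] \<open>0 < D\<close> by (simp add: ennreal_mult')
      then have "1 * f x \<le> ennreal D * ennreal (\<rho> x) * f x" by (rule mult_right_mono) simp
      then show ?thesis using True by (simp add: mult.assoc)
    qed simp
  qed
  also have "\<dots> = ennreal D * (\<integral>\<^sup>+x. ennreal (\<rho> x) * f x * indicator \<Omega> x \<partial>lborel)"
    by (rule nn_integral_cmult) simp
  finally show ?lower unfolding eq .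
qed

lemma nn_integral_finite_pushforward:
  fixes F :: "'b \<Rightarrow> ennreal"
  assumes "finite V" and T[measurable]: "T \<in> measurable \<mu> N" and V: "\<And>x. x \<in> space \<mu> \<Longrightarrow> T x \<in> V"
    and s: "\<And>v. v \<in> V \<Longrightarrow> {v} \<in> sets N"
  shows "(\<integral>\<^sup>+x. F (T x) \<partial>\<mu>) = (\<Sum>v\<in>V. F v * emeasure (distr \<mu> N T) {v})"
proof -
  have "(\<integral>\<^sup>+x. F (T x) \<partial>\<mu>) = (\<integral>\<^sup>+x. (\<Sum>v\<in>V. F v * indicator (T -` {v} \<inter> space \<mu>) x) \<partial>\<mu>)"
  proof (rule nn_integral_cong)
    fix x assume x: "x \<in> space \<mu>"
    have "(\<Sum>v\<in>V. F v * indicator (T -` {v} \<inter> space \<mu>) x) = (\<Sum>v\<in>V. if v = T x then F v else 0)"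
      using x by (intro sum.cong) (auto simp: indicator_def)
    then show "F (T x) = (\<Sum>v\<in>V. F v * indicator (T -` {v} \<inter> space \<mu>) x)"
      using assms(1) V[OF x] by simp
  qed
  also have "\<dots> = (\<Sum>v\<in>V. F v * emeasure \<mu> (T -` {v} \<inter> space \<mu>))"
    using s by (subst nn_integral_sum) (auto simp: nn_integral_cmult_indicator intro!: measurable_sets[OF T])
  also have "\<dots> = (\<Sum>v\<in>V. F v * emeasure (distr \<mu> N T) {v})"
    using s by (intro sum.cong) (auto simp: emeasure_distr)
  finally show ?thesis .
qed

lemma finite_pushforward_interpolant_measurable:
  fixes u :: "'a::euclidean_space \<Rightarrow> real"
  assumes [measurable]: "\<Omega> \<in> sets borel" and V: "finite V" and T: "T \<in> borel_measurable (restrict_space borel \<Omega>)" "T \<in> \<Omega> \<rightarrow> V"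
  shows "(\<lambda>x. if x \<in> \<Omega> then u (T x) else 0) \<in> borel_measurable borel"
proof -
  have [measurable]: "T -` {v} \<inter> \<Omega> \<in> sets borel" for v
    using measurable_sets[OF T(1), of "{v}"] by (simp add: space_restrict_space sets_restrict_space_iff)
  have "(\<lambda>x. if x \<in> \<Omega> then u (T x) else 0) = (\<lambda>x. \<Sum>v\<in>V. u v * indicator (T -` {v} \<inter> \<Omega>) x)"
  proof
    fix x
    show "(if x \<in> \<Omega> then u (T x) else 0) = (\<Sum>v\<in>V. u v * indicator (T -` {v} \<inter> \<Omega>) x)"
    proof (cases "x \<in> \<Omega>")
      case True
      have "(\<Sum>v\<in>V. u v * indicator (T -` {v} \<inter> \<Omega>) x) = (\<Sum>v\<in>V. if v = T x then u v else 0)"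
        using True by (intro sum.cong) (auto simp: indicator_def)
      then show ?thesis using True V T(2) by (auto simp: Pi_iff)
    qed simp
  qed
  also have "\<dots> \<in> borel_measurable borel" by measurable
  finally show ?thesis .
qed

lemma increment_integral_eq_double_integral:
  fixes w :: "'a::euclidean_space \<Rightarrow> real"
  assumes [measurable]: "\<Omega> \<in> sets borel" "w \<in> borel_measurable borel"
  shows "(\<integral>\<^sup>+v\<in>cball 0 \<delta>. increment_integral \<Omega> p w v \<partial>lborel)
    = (\<integral>\<^sup>+x\<in>\<Omega>. (\<integral>\<^sup>+y\<in>\<Omega>. (indicator (cball 0 \<delta>) (y - x) * ennreal (\<bar>w y - w x\<bar> powr p)) \<partial>lborel) \<partial>lborel)"
proof -
  have [measurable]: "cball (0::'a) \<delta> \<in> sets borel" by simp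
  have "(\<integral>\<^sup>+v\<in>cball 0 \<delta>. increment_integral \<Omega> p w v \<partial>lborel)
    = (\<integral>\<^sup>+v. (\<integral>\<^sup>+x. indicator \<Omega> x * indicator \<Omega> (x + v) * ennreal (\<bar>w (x + v) - w x\<bar> powr p) * indicator (cball 0 \<delta>) v \<partial>lborel) \<partial>lborel)"
    unfolding increment_integral_def by (intro nn_integral_cong, subst nn_integral_multc) auto
  also have "\<dots> = (\<integral>\<^sup>+x. (\<integral>\<^sup>+v. indicator \<Omega> x * indicator \<Omega> (x + v) * ennreal (\<bar>w (x + v) - w x\<bar> powr p) * indicator (cball 0 \<delta>) v \<partial>lborel) \<partial>lborel)"
    by (rule lborel_pair.Fubini') measurable
  also have "\<dots> = (\<integral>\<^sup>+x\<in>\<Omega>. (\<integral>\<^sup>+y\<in>\<Omega>. (indicator (cball 0 \<delta>) (y - x) * ennreal (\<bar>w y - w x\<bar> powr p)) \<partial>lborel) \<partial>lborel)"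
  proof (rule nn_integral_cong)
    fix x
    let ?g = "\<lambda>y. indicator (cball 0 \<delta>) (y - x) * ennreal (\<bar>w y - w x\<bar> powr p) * indicator \<Omega> y"
    have [measurable]: "?g \<in> borel_measurable borel"
      using measurable_compose[of "\<lambda>y. y - x" borel borel "indicator (cball 0 \<delta>) :: 'a \<Rightarrow> ennreal"] by simp
    have "(\<integral>\<^sup>+v. indicator \<Omega> x * indicator \<Omega> (x + v) * ennreal (\<bar>w (x + v) - w x\<bar> powr p) * indicator (cball 0 \<delta>) v \<partial>lborel)
      = (\<integral>\<^sup>+v. indicator \<Omega> x * ?g (v + x) \<partial>lborel)"
      by (intro nn_integral_cong) (simp add: mult_ac add.commute)
    also have "\<dots> = indicator \<Omega> x * (\<integral>\<^sup>+v. ?g (v + x) \<partial>lborel)"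
      by (rule nn_integral_cmult) (use measurable_compose[of "\<lambda>v. v + x" lborel borel ?g] in simp)
    also have "(\<integral>\<^sup>+v. ?g (v + x) \<partial>lborel) = (\<integral>\<^sup>+y. ?g y \<partial>lborel)"
      by (rule nn_integral_lborel_translate) measurable
    finally show "(\<integral>\<^sup>+v. indicator \<Omega> x * indicator \<Omega> (x + v) * ennreal (\<bar>w (x + v) - w x\<bar> powr p) * indicator (cball 0 \<delta>) v \<partial>lborel)
      = (\<integral>\<^sup>+y. ?g y \<partial>lborel) * indicator \<Omega> x" by (simp only: mult.commute)
  qed
  finally show ?thesis .
qed

text \<open>Integrals of functions of \<open>T\<close> against \<open>\<mu>\<close> are the sums over \<open>V\<close> weighted by \<open>\<nu>\<close>.  If
  \<open>\<bar>x - y\<bar> \<le> a \<epsilon>\<close>, then \<open>\<bar>T x - T y\<bar> \<le> (a + 2 K) \<epsilon> \<le> r0 \<epsilon>\<close>, so by monotonicity the kernel is at least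
  \<open>\<eta> r0 / \<epsilon>\<^sup>d\<close> at this pair.  Each passage between \<open>\<mu>\<close> and Lebesgue measure costs a factor \<open>D\<close>.\<close>
lemma graph_function_nonlocal_Sobolev_bound:
  fixes \<Omega> V :: "'a::euclidean_space set" and u :: "'a \<Rightarrow> real"
  assumes \<Omega>: "open \<Omega>" and \<mu>: "prob_space \<mu>" "\<mu> = density (restrict_space lborel \<Omega>) (\<lambda>x. ennreal (\<rho> x))"
    and \<rho>: "continuous_on \<Omega> \<rho>" and D: "0 < D" "\<And>x. x \<in> \<Omega> \<Longrightarrow> 1 / D \<le> \<rho> x \<and> \<rho> x \<le> D"
    and V: "finite V" "V \<subseteq> \<Omega>" and T: "T \<in> borel_measurable (restrict_space borel \<Omega>)" "T \<in> \<Omega> \<rightarrow> V"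
    and \<nu>: "distr \<mu> (restrict_space borel \<Omega>) T = \<nu>"
    and near: "\<And>x. x \<in> \<Omega> \<Longrightarrow> norm (T x - x) \<le> K * \<epsilon>" and \<epsilon>: "0 < \<epsilon>"
    and \<eta>: "\<And>r. 0 \<le> r \<Longrightarrow> 0 \<le> \<eta> r" "antimono_on {0..} \<eta>" "0 < \<eta> r0" and a: "0 < a" "a + 2 * K \<le> r0" and p: "1 \<le> p"
    and K0: "discrete_Lp_norm p V \<nu> u \<le> K0" and K1: "graph_energy \<eta> p \<epsilon> V \<nu> u \<le> K1"
    and C: "D * K0 powr p \<le> C" "D * D * K1 / (\<eta> r0 * a powr (p + DIM('a))) \<le> C"
  shows "nonlocal_Sobolev_bound \<Omega> p C (a * \<epsilon>) (\<lambda>x. if x \<in> \<Omega> then u (T x) else 0)"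
proof -
  let ?N = "restrict_space borel \<Omega> :: 'a measure"
  define w where "w x = (if x \<in> \<Omega> then u (T x) else 0)" for x
  define \<delta> where "\<delta> = a * \<epsilon>"
  have \<delta>: "0 < \<delta>" using a \<epsilon> by (simp add: \<delta>_def)
  have [measurable]: "\<Omega> \<in> sets borel" using \<Omega> by auto
  have w[measurable]: "w \<in> borel_measurable borel"
    unfolding w_def by (rule finite_pushforward_interpolant_measurable[OF _ V(1) T]) simp
  have s\<mu>: "sets \<mu> = sets ?N" unfolding \<mu>(2) by (simp add: sets_restrict_space)
  have sp\<mu>: "space \<mu> = \<Omega>" unfolding \<mu>(2) by (simp add: space_restrict_space)
  interpret \<mu>: prob_space \<mu> by fact
  have TN: "T \<in> measurable \<mu> ?N"
    unfolding measurable_cong_sets[OF s\<mu> refl] using T V by (auto intro!: measurable_restrict_space2 simp: space_restrict_space)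
  interpret \<nu>: prob_space \<nu> unfolding \<nu>[symmetric] by (rule \<mu>.prob_space_distr[OF TN])
  have single: "{v} \<in> sets ?N" if "v \<in> V" for v using that V by (auto simp: sets_restrict_space_iff)
  have push: "(\<integral>\<^sup>+x. F (T x) \<partial>\<mu>) = (\<Sum>v\<in>V. F v * ennreal (measure \<nu> {v}))" for F :: "'a \<Rightarrow> ennreal"
    using nn_integral_finite_pushforward[OF V(1) TN _ single, of F] T(2) unfolding \<nu>
    by (auto simp: sp\<mu> Pi_iff \<nu>.emeasure_eq_measure)
  note bounds = nn_integral_density_bounds[OF \<Omega> \<mu>(2) \<rho> D]
  have bd: "\<exists>c. \<forall>x. \<bar>w x\<bar> \<le> c"
  proof (intro exI allI)
    fix x
    have "\<bar>u (T x)\<bar> \<le> (\<Sum>v\<in>V. \<bar>u v\<bar>)" if "x \<in> \<Omega>"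
      using member_le_sum[of "T x" V "\<lambda>v. \<bar>u v\<bar>"] V(1) T(2) that by auto
    then show "\<bar>w x\<bar> \<le> (\<Sum>v\<in>V. \<bar>u v\<bar>)" by (auto simp: w_def sum_nonneg)
  qed
  have Lp: "(\<integral>\<^sup>+x. ennreal (\<bar>w x\<bar> powr p) \<partial>lborel) \<le> ennreal C"
  proof -
    define S where "S = (\<Sum>v\<in>V. \<bar>u v\<bar> powr p * measure \<nu> {v})"
    have S0: "0 \<le> S" by (simp add: S_def sum_nonneg)
    have "S powr (1 / p) \<le> K0" using K0 by (simp add: discrete_Lp_norm_def S_def)
    then have "(S powr (1 / p)) powr p \<le> K0 powr p" using p by (intro powr_mono2) auto
    then have S: "S \<le> K0 powr p" using p S0 by (simp add: powr_powr)
    have "(\<integral>\<^sup>+x. ennreal (\<bar>w x\<bar> powr p) \<partial>lborel) = (\<integral>\<^sup>+x\<in>\<Omega>. ennreal (\<bar>w x\<bar> powr p) \<partial>lborel)"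
      by (intro nn_integral_cong) (auto simp: w_def)
    also have "\<dots> \<le> ennreal D * (\<integral>\<^sup>+x. ennreal (\<bar>w x\<bar> powr p) \<partial>\<mu>)"
      by (rule bounds(2)) measurable
    also have "(\<integral>\<^sup>+x. ennreal (\<bar>w x\<bar> powr p) \<partial>\<mu>) = (\<integral>\<^sup>+x. ennreal (\<bar>u (T x)\<bar> powr p) \<partial>\<mu>)"
      by (intro nn_integral_cong) (auto simp: w_def sp\<mu>)
    also have "\<dots> = ennreal S"
      unfolding push[of "\<lambda>v. ennreal (\<bar>u v\<bar> powr p)"] S_def by (simp add: sum_ennreal flip: ennreal_mult)
    also have "ennreal D * ennreal S \<le> ennreal C"
      using D(1) S0 order_trans[OF mult_left_mono[OF S, of D] C(1)] by (simp add: ennreal_leI flip: ennreal_mult)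
    finally show ?thesis .
  qed
  have en: "(\<integral>\<^sup>+v\<in>cball 0 \<delta>. increment_integral \<Omega> p w v \<partial>lborel) \<le> ennreal (C * \<delta> powr (p + DIM('a)))"
  proof -
    define c where "c = \<eta> r0 / \<epsilon> ^ DIM('a)"
    have c: "0 < c" using \<eta> \<epsilon> by (simp add: c_def)
    define k where "k x y = kernel_scaled DIM('a) \<eta> \<epsilon> (norm (x - y)) * \<bar>u x - u y\<bar> powr p" for x y
    have k0: "0 \<le> k x y" for x y using \<eta>(1)[of "norm (x - y) / \<epsilon>"] \<epsilon> by (simp add: k_def kernel_scaled_def)
    let ?g = "\<lambda>x y. indicator (cball 0 \<delta>) (y - x) * ennreal (\<bar>w y - w x\<bar> powr p)"
    have [measurable]: "cball (0::'a) \<delta> \<in> sets borel" by simp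
    have gm[measurable]: "(\<lambda>z. ?g (fst z) (snd z)) \<in> borel_measurable (borel \<Otimes>\<^sub>M borel)"
      by measurable
    have g1[measurable]: "(\<lambda>y. ?g x y) \<in> borel_measurable borel" for x
      using measurable_compose[of "\<lambda>y. y - x" borel borel "indicator (cball 0 \<delta>) :: 'a \<Rightarrow> ennreal"] by simp
    have low: "ennreal c * ?g x y \<le> ennreal (k (T x) (T y))" if "x \<in> \<Omega>" "y \<in> \<Omega>" for x y
    proof (cases "norm (y - x) \<le> \<delta>")
      case True
      have "norm (T x - T y) \<le> norm (T x - x) + norm (y - x) + norm (T y - y)"
        using norm_triangle_ineq[of "T x - x" "(x - y) + (y - T y)"] norm_triangle_ineq[of "x - y" "y - T y"]
        by (simp add: norm_minus_commute)
      also have "\<dots> \<le> (a + 2 * K) * \<epsilon>" using near[OF that(1)] near[OF that(2)] True by (simp add: \<delta>_def algebra_simps)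
      also have "\<dots> \<le> r0 * \<epsilon>" using a \<epsilon> by (intro mult_right_mono) auto
      finally have le: "norm (T x - T y) / \<epsilon> \<le> r0" using \<epsilon> by (simp add: field_simps)
      have "\<eta> r0 \<le> \<eta> (norm (T x - T y) / \<epsilon>)"
        by (rule monotone_onD[OF \<eta>(2)]) (use le \<epsilon> order_trans[OF _ le, of 0] in auto)
      then have "c * \<bar>w y - w x\<bar> powr p \<le> k (T x) (T y)"
        unfolding k_def kernel_scaled_def c_def using that \<epsilon>
        by (intro mult_mono divide_right_mono) (auto simp: w_def abs_minus_commute intro!: divide_nonneg_nonneg \<eta>(1))
      then have "ennreal (c * \<bar>w y - w x\<bar> powr p) \<le> ennreal (k (T x) (T y))" by (rule ennreal_leI)
      then show ?thesis using True c by (simp add: ennreal_mult)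
    qed simp
    define X where "X = (\<integral>\<^sup>+v\<in>cball 0 \<delta>. increment_integral \<Omega> p w v \<partial>lborel)"
    have "ennreal c * X = (\<integral>\<^sup>+x\<in>\<Omega>. (\<integral>\<^sup>+y\<in>\<Omega>. (ennreal c * ?g x y) \<partial>lborel) \<partial>lborel)"
    proof -
      have "ennreal c * X = (\<integral>\<^sup>+x. ennreal c * ((\<integral>\<^sup>+y\<in>\<Omega>. ?g x y \<partial>lborel) * indicator \<Omega> x) \<partial>lborel)"
        unfolding X_def increment_integral_eq_double_integral[OF \<open>\<Omega> \<in> sets borel\<close> w]
        by (rule nn_integral_cmult[symmetric]) measurable
      also have "\<dots> = (\<integral>\<^sup>+x\<in>\<Omega>. (\<integral>\<^sup>+y\<in>\<Omega>. (ennreal c * ?g x y) \<partial>lborel) \<partial>lborel)"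
      proof (rule nn_integral_cong)
        fix x
        have "(\<integral>\<^sup>+y\<in>\<Omega>. (ennreal c * ?g x y) \<partial>lborel) = (\<integral>\<^sup>+y. ennreal c * (?g x y * indicator \<Omega> y) \<partial>lborel)"
          by (simp add: mult.assoc)
        also have "\<dots> = ennreal c * (\<integral>\<^sup>+y\<in>\<Omega>. ?g x y \<partial>lborel)"
          by (rule nn_integral_cmult) measurable
        finally show "ennreal c * ((\<integral>\<^sup>+y\<in>\<Omega>. ?g x y \<partial>lborel) * indicator \<Omega> x)
          = (\<integral>\<^sup>+y\<in>\<Omega>. (ennreal c * ?g x y) \<partial>lborel) * indicator \<Omega> x" by (simp add: mult.assoc)
      qed
      finally show ?thesis .
    qed
    also have "\<dots> \<le> ennreal D * (\<integral>\<^sup>+x. (\<integral>\<^sup>+y\<in>\<Omega>. (ennreal c * ?g x y) \<partial>lborel) \<partial>\<mu>)"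
      by (rule bounds(2)) measurable
    also have "(\<integral>\<^sup>+x. (\<integral>\<^sup>+y\<in>\<Omega>. (ennreal c * ?g x y) \<partial>lborel) \<partial>\<mu>)
       \<le> (\<integral>\<^sup>+x. ennreal D * (\<integral>\<^sup>+y. ennreal (k (T x) (T y)) \<partial>\<mu>) \<partial>\<mu>)"
    proof (rule nn_integral_mono)
      fix x assume "x \<in> space \<mu>"
      then have x: "x \<in> \<Omega>" by (simp add: sp\<mu>)
      have "(\<integral>\<^sup>+y\<in>\<Omega>. (ennreal c * ?g x y) \<partial>lborel) \<le> ennreal D * (\<integral>\<^sup>+y. ennreal c * ?g x y \<partial>\<mu>)"
        by (rule bounds(2)) measurable
      also have "\<dots> \<le> ennreal D * (\<integral>\<^sup>+y. ennreal (k (T x) (T y)) \<partial>\<mu>)"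
        using low[OF x] by (intro mult_left_mono nn_integral_mono) (auto simp: sp\<mu>)
      finally show "(\<integral>\<^sup>+y\<in>\<Omega>. (ennreal c * ?g x y) \<partial>lborel) \<le> ennreal D * (\<integral>\<^sup>+y. ennreal (k (T x) (T y)) \<partial>\<mu>)" .
    qed
    also have "(\<integral>\<^sup>+x. ennreal D * (\<integral>\<^sup>+y. ennreal (k (T x) (T y)) \<partial>\<mu>) \<partial>\<mu>)
      = (\<Sum>x\<in>V. ennreal D * (\<Sum>y\<in>V. ennreal (k x y) * ennreal (measure \<nu> {y})) * ennreal (measure \<nu> {x}))"
      unfolding push[of "\<lambda>y. ennreal (k z y)" for z]
      by (rule push[of "\<lambda>x. ennreal D * (\<Sum>y\<in>V. ennreal (k x y) * ennreal (measure \<nu> {y}))"])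
    also have "\<dots> = ennreal (\<Sum>x\<in>V. D * (\<Sum>y\<in>V. k x y * measure \<nu> {y}) * measure \<nu> {x})"
      using D(1) k0 by (simp add: sum_ennreal sum_nonneg flip: ennreal_mult)
    also have "(\<Sum>x\<in>V. D * (\<Sum>y\<in>V. k x y * measure \<nu> {y}) * measure \<nu> {x}) = D * (\<epsilon> powr p * graph_energy \<eta> p \<epsilon> V \<nu> u)"
      using \<epsilon> by (simp add: graph_energy_def k_def sum_distrib_left sum_distrib_right mult_ac)
    also have "ennreal D * ennreal (D * (\<epsilon> powr p * graph_energy \<eta> p \<epsilon> V \<nu> u)) \<le> ennreal (D * (D * (\<epsilon> powr p * K1)))"
      using D(1) K1 by (subst ennreal_mult'[symmetric]) (auto intro!: ennreal_leI mult_left_mono)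
    finally have "ennreal c * X \<le> ennreal (D * (D * (\<epsilon> powr p * K1)))"
      by (simp add: mult_left_mono)
    then have "ennreal (1 / c) * (ennreal c * X) \<le> ennreal (1 / c) * ennreal (D * (D * (\<epsilon> powr p * K1)))"
      by (intro mult_left_mono) auto
    also have "ennreal (1 / c) * (ennreal c * X) = X"
      using c by (simp add: mult.assoc[symmetric] flip: ennreal_mult)
    also have "ennreal (1 / c) * ennreal (D * (D * (\<epsilon> powr p * K1))) = ennreal (1 / c * (D * (D * (\<epsilon> powr p * K1))))"
      using c by (intro ennreal_mult'[symmetric]) simp
    also have "1 / c * (D * (D * (\<epsilon> powr p * K1))) = D * D * K1 / (\<eta> r0 * a powr (p + DIM('a))) * \<delta> powr (p + DIM('a))"
      using \<epsilon> a \<eta>(3) by (simp add: c_def \<delta>_def powr_mult powr_add powr_realpow)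
    also have "ennreal \<dots> \<le> ennreal (C * \<delta> powr (p + DIM('a)))"
      by (intro ennreal_leI mult_right_mono C(2)) auto
    finally show ?thesis unfolding X_def .
  qed
  show ?thesis
    unfolding nonlocal_Sobolev_bound_def w_def[symmetric] \<delta>_def[symmetric]
    using w bd \<delta> Lp en by (auto simp: w_def)
qed

text \<open>The maximum of \<open>\<bar>u\<bar>\<close> over \<open>V\<close> is attained at some \<open>v\<close>, and the cell \<open>T -` {v}\<close> has \<open>\<mu>\<close>-measure
  \<open>\<nu> {v} \<ge> m\<close>, hence Lebesgue measure at least \<open>m / D\<close>.\<close>
lemma graph_function_level_set:
  fixes \<Omega> V :: "'a::euclidean_space set" and u :: "'a \<Rightarrow> real"
  assumes \<Omega>: "open \<Omega>" and \<mu>: "prob_space \<mu>" "\<mu> = density (restrict_space lborel \<Omega>) (\<lambda>x. ennreal (\<rho> x))"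
    and \<rho>: "continuous_on \<Omega> \<rho>" and D: "0 < D" "\<And>x. x \<in> \<Omega> \<Longrightarrow> 1 / D \<le> \<rho> x \<and> \<rho> x \<le> D"
    and V: "finite V" "V \<noteq> {}" "V \<subseteq> \<Omega>" and T: "T \<in> borel_measurable (restrict_space borel \<Omega>)" "T \<in> \<Omega> \<rightarrow> V"
    and \<nu>: "distr \<mu> (restrict_space borel \<Omega>) T = \<nu>" and mass: "\<And>v. v \<in> V \<Longrightarrow> m \<le> measure \<nu> {v}"
  shows "\<exists>\<Lambda>. (\<forall>x. \<bar>if x \<in> \<Omega> then u (T x) else 0\<bar> \<le> \<Lambda>) \<and>
    ennreal (m / D) \<le> emeasure lborel {x\<in>\<Omega>. \<bar>if x \<in> \<Omega> then u (T x) else 0\<bar> = \<Lambda>}"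
proof -
  let ?N = "restrict_space borel \<Omega> :: 'a measure"
  have [measurable]: "\<Omega> \<in> sets borel" using \<Omega> by auto
  define w where "w x = (if x \<in> \<Omega> then u (T x) else 0)" for x
  have [measurable]: "w \<in> borel_measurable borel"
    unfolding w_def by (rule finite_pushforward_interpolant_measurable[OF _ V(1) T]) simp
  have s\<mu>: "sets \<mu> = sets ?N" unfolding \<mu>(2) by (simp add: sets_restrict_space)
  have sp\<mu>: "space \<mu> = \<Omega>" unfolding \<mu>(2) by (simp add: space_restrict_space)
  interpret \<mu>: prob_space \<mu> by fact
  have TN: "T \<in> measurable \<mu> ?N"
    unfolding measurable_cong_sets[OF s\<mu> refl] using T V by (auto intro!: measurable_restrict_space2 simp: space_restrict_space)
  interpret \<nu>: prob_space \<nu> unfolding \<nu>[symmetric] by (rule \<mu>.prob_space_distr[OF TN])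
  have "Max ((\<lambda>v. \<bar>u v\<bar>) ` V) \<in> (\<lambda>v. \<bar>u v\<bar>) ` V" using V by (intro Max_in) auto
  then obtain v where v: "v \<in> V" "\<bar>u v\<bar> = Max ((\<lambda>v. \<bar>u v\<bar>) ` V)" by auto
  have max: "\<bar>u v'\<bar> \<le> \<bar>u v\<bar>" if "v' \<in> V" for v' unfolding v(2) using that V by (intro Max_ge) auto
  have "{v} \<in> sets ?N" using v V by (auto simp: sets_restrict_space_iff)
  then have "ennreal (measure \<nu> {v}) = emeasure \<mu> (T -` {v} \<inter> \<Omega>)"
    using emeasure_distr[OF TN, of "{v}"] by (simp add: \<nu> sp\<mu> flip: \<nu>.emeasure_eq_measure)
  also have "\<dots> \<le> (\<integral>\<^sup>+x. indicator {x\<in>\<Omega>. \<bar>w x\<bar> = \<bar>u v\<bar>} x \<partial>\<mu>)"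
  proof -
    have lev: "{x\<in>\<Omega>. \<bar>w x\<bar> = \<bar>u v\<bar>} \<in> sets \<mu>" unfolding s\<mu> by (simp add: sets_restrict_space_iff)
    have "T -` {v} \<inter> \<Omega> \<subseteq> {x\<in>\<Omega>. \<bar>w x\<bar> = \<bar>u v\<bar>}" by (auto simp: w_def)
    then show ?thesis using emeasure_mono[OF _ lev] lev by simp
  qed
  also have "\<dots> \<le> ennreal D * (\<integral>\<^sup>+x\<in>\<Omega>. indicator {x\<in>\<Omega>. \<bar>w x\<bar> = \<bar>u v\<bar>} x \<partial>lborel)"
    by (rule nn_integral_density_bounds(1)[OF \<Omega> \<mu>(2) \<rho> D]) measurable
  also have "(\<integral>\<^sup>+x\<in>\<Omega>. indicator {x\<in>\<Omega>. \<bar>w x\<bar> = \<bar>u v\<bar>} x \<partial>lborel) = emeasure lborel {x\<in>\<Omega>. \<bar>w x\<bar> = \<bar>u v\<bar>}"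
  proof -
    have "(\<integral>\<^sup>+x\<in>\<Omega>. indicator {x\<in>\<Omega>. \<bar>w x\<bar> = \<bar>u v\<bar>} x \<partial>lborel) = (\<integral>\<^sup>+x. indicator {x\<in>\<Omega>. \<bar>w x\<bar> = \<bar>u v\<bar>} x \<partial>lborel)"
      by (intro nn_integral_cong) (simp add: indicator_def)
    also have "\<dots> = emeasure lborel {x\<in>\<Omega>. \<bar>w x\<bar> = \<bar>u v\<bar>}" by (rule nn_integral_indicator) measurable
    finally show ?thesis .
  qed
  finally have "ennreal m \<le> ennreal D * emeasure lborel {x\<in>\<Omega>. \<bar>w x\<bar> = \<bar>u v\<bar>}"
    using ennreal_leI[OF mass[OF v(1)]] by (rule order_trans[rotated])
  then have "ennreal (1 / D) * ennreal m \<le> ennreal (1 / D) * (ennreal D * emeasure lborel {x\<in>\<Omega>. \<bar>w x\<bar> = \<bar>u v\<bar>})"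
    by (intro mult_left_mono) auto
  also have "\<dots> = emeasure lborel {x\<in>\<Omega>. \<bar>w x\<bar> = \<bar>u v\<bar>}"
    using D(1) by (simp add: mult.assoc[symmetric] flip: ennreal_mult)
  also have "ennreal (1 / D) * ennreal m = ennreal (m / D)"
    using D(1) by (subst ennreal_mult'[symmetric]) auto
  finally have level: "ennreal (m / D) \<le> emeasure lborel {x\<in>\<Omega>. \<bar>w x\<bar> = \<bar>u v\<bar>}" .
  have "\<bar>w x\<bar> \<le> \<bar>u v\<bar>" for x using max T(2) by (auto simp: w_def)
  with level show ?thesis unfolding w_def by blast
qed

section \<open>Convergence in the transport distance\<close>

text \<open>The coupling is the image of \<open>\<mu>\<close> under \<open>x \<mapsto> (T x, x)\<close>.\<close>
lemma TL_dist_transport_le: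
  fixes T :: "'a::euclidean_space \<Rightarrow> 'a"
  assumes \<mu>: "borel_prob_on \<Omega> \<mu>" and \<nu>: "borel_prob_on \<Omega> \<nu>"
    and T: "T \<in> borel_measurable (restrict_space borel \<Omega>)" "T \<in> \<Omega> \<rightarrow> \<Omega>"
    and push: "distr \<mu> (restrict_space borel \<Omega>) T = \<nu>"
    and [measurable]: "g \<in> borel_measurable \<nu>" "f \<in> borel_measurable \<mu>"
  shows "0 \<le> TL_dist r (g, \<nu>) (f, \<mu>)"
    and "TL_dist r (g, \<nu>) (f, \<mu>) \<le> (\<integral>x. norm (T x - x) powr r + \<bar>g (T x) - f x\<bar> powr r \<partial>\<mu>) powr (1 / r)"
proof -
  have s\<mu>: "sets \<mu> = sets (restrict_space borel \<Omega>)" and s\<nu>: "sets \<nu> = sets (restrict_space borel \<Omega>)"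
    using \<mu> \<nu> by (auto simp: borel_prob_on_def)
  have [measurable]: "T \<in> measurable \<mu> \<nu>"
    unfolding measurable_cong_sets[OF s\<mu> s\<nu>] using T by (auto intro!: measurable_restrict_space2 simp: space_restrict_space)
  have id\<mu>: "(\<lambda>x. x) \<in> borel_measurable \<mu>" and id\<nu>: "(\<lambda>x. x) \<in> borel_measurable \<nu>"
    unfolding measurable_cong_sets[OF s\<mu> refl] measurable_cong_sets[OF s\<nu> refl]
    by (auto intro!: measurable_restrict_space1)
  define \<pi> where "\<pi> = distr \<mu> (\<nu> \<Otimes>\<^sub>M \<mu>) (\<lambda>x. (T x, x))"
  have pair[measurable]: "(\<lambda>x. (T x, x)) \<in> measurable \<mu> (\<nu> \<Otimes>\<^sub>M \<mu>)" by (rule measurable_Pair) auto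
  have "distr \<pi> \<nu> fst = distr \<mu> \<nu> T" unfolding \<pi>_def by (subst distr_distr) (auto simp: o_def)
  also have "\<dots> = distr \<mu> (restrict_space borel \<Omega>) T" using s\<nu> by (intro distr_cong) auto
  finally have 1: "distr \<pi> \<nu> fst = \<nu>" using push by simp
  have 2: "distr \<pi> \<mu> snd = \<mu>" unfolding \<pi>_def by (subst distr_distr) (auto simp: o_def distr_id2)
  have \<pi>: "\<pi> \<in> couplings \<nu> \<mu>" using 1 2 by (simp add: couplings_def \<pi>_def)
  let ?G = "\<lambda>\<pi>. (\<integral>z. norm (fst z - snd z) powr r + \<bar>g (fst z) - f (snd z)\<bar> powr r \<partial>\<pi>) powr (1 / r)"
  have TL: "TL_dist r (g, \<nu>) (f, \<mu>) = (INF \<pi>\<in>couplings \<nu> \<mu>. ?G \<pi>)" by (simp add: TL_dist_def)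
  show "0 \<le> TL_dist r (g, \<nu>) (f, \<mu>)" unfolding TL using \<pi> by (intro cINF_greatest) auto
  have "TL_dist r (g, \<nu>) (f, \<mu>) \<le> ?G \<pi>"
    unfolding TL using \<pi> by (intro cINF_lower bdd_belowI2[of _ 0]) auto
  also have "(\<integral>z. norm (fst z - snd z) powr r + \<bar>g (fst z) - f (snd z)\<bar> powr r \<partial>\<pi>)
     = (\<integral>x. norm (T x - x) powr r + \<bar>g (T x) - f x\<bar> powr r \<partial>\<mu>)"
  proof -
    have 1: "(\<lambda>z. fst z) \<in> borel_measurable (\<nu> \<Otimes>\<^sub>M \<mu>)"
      by (rule measurable_compose[OF measurable_fst id\<nu>])
    have 2: "(\<lambda>z. snd z) \<in> borel_measurable (\<nu> \<Otimes>\<^sub>M \<mu>)"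
      by (rule measurable_compose[OF measurable_snd id\<mu>])
    have [measurable]: "(\<lambda>z. fst z - snd z) \<in> borel_measurable (\<nu> \<Otimes>\<^sub>M \<mu>)"
      by (rule borel_measurable_diff[OF 1 2])
    have "(\<lambda>z. norm (fst z - snd z) powr r + \<bar>g (fst z) - f (snd z)\<bar> powr r) \<in> borel_measurable (\<nu> \<Otimes>\<^sub>M \<mu>)"
      by measurable
    then show ?thesis unfolding \<pi>_def by (subst integral_distr) auto
  qed
  finally show "TL_dist r (g, \<nu>) (f, \<mu>) \<le> (\<integral>x. norm (T x - x) powr r + \<bar>g (T x) - f x\<bar> powr r \<partial>\<mu>) powr (1 / r)" .
qed

text \<open>Truncate at a height \<open>H\<close>: below it dominated convergence applies, and above it
  \<open>\<bar>v\<bar>\<^sup>r \<le> H\<^sup>r\<^sup>-\<^sup>R \<bar>v\<bar>\<^sup>R\<close> with \<open>r < R\<close>.\<close>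
lemma nn_integral_powr_tendsto_zero:
  fixes v :: "nat \<Rightarrow> 'b \<Rightarrow> real"
  assumes "finite_measure M" and [measurable]: "\<And>n. v n \<in> borel_measurable M"
    and lim: "AE x in M. (\<lambda>n. v n x) \<longlonglongrightarrow> 0" and rR: "0 < r" "r < R" and "0 \<le> K"
    and K: "\<And>n. (\<integral>\<^sup>+x. ennreal (\<bar>v n x\<bar> powr R) \<partial>M) \<le> ennreal K"
  shows "(\<lambda>n. \<integral>\<^sup>+x. ennreal (\<bar>v n x\<bar> powr r) \<partial>M) \<longlonglongrightarrow> 0"
proof (rule order_tendstoI)
  interpret finite_measure M by fact
  fix a :: ennreal assume "0 < a"
  obtain e where e: "0 < e" "ennreal e \<le> a"
  proof (cases a)
    case (real a')
    then show ?thesis using \<open>0 < a\<close> that[of a'] by simp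
  next
    case top
    then show ?thesis using that[of 1] by simp
  qed
  \<comment> \<open>Chosen such that \<open>H powr (r - R) = e / (2 * (K + 1))\<close>.\<close>
  define H where "H = (2 * (K + 1) / e) powr (1 / (R - r))"
  have H: "0 < H" using e \<open>0 \<le> K\<close> by (simp add: H_def)
  have HK: "H powr (r - R) * K \<le> e / 2"
  proof -
    have "1 / (R - r) * (r - R) = -1" using rR by (simp add: field_simps)
    then have "H powr (r - R) = (2 * (K + 1) / e) powr (-1)"
      unfolding H_def powr_powr by simp
    also have "\<dots> = e / (2 * (K + 1))" using e \<open>0 \<le> K\<close> by (simp add: powr_minus_divide)
    finally have eq: "H powr (r - R) = e / (2 * (K + 1))" .
    show ?thesis unfolding eq using e \<open>0 \<le> K\<close> by (simp add: field_simps)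
  qed
  have "(\<lambda>n. \<integral>\<^sup>+x. ennreal (min \<bar>v n x\<bar> H powr r) \<partial>M) \<longlonglongrightarrow> (\<integral>\<^sup>+x. 0 \<partial>M)"
  proof (rule nn_integral_dominated_convergence[where w="\<lambda>_. ennreal (H powr r)"])
    show "AE x in M. ennreal (min \<bar>v j x\<bar> H powr r) \<le> ennreal (H powr r)" for j
      using rR H by (intro AE_I2 ennreal_leI powr_mono2) auto
    show "(\<integral>\<^sup>+x. ennreal (H powr r) \<partial>M) < \<infinity>"
      by (simp add: ennreal_mult_less_top emeasure_eq_measure)
    show "AE x in M. (\<lambda>n. ennreal (min \<bar>v n x\<bar> H powr r)) \<longlonglongrightarrow> 0"
      using lim
    proof eventually_elim
      case (elim x)
      have "(\<lambda>n. min \<bar>v n x\<bar> H) \<longlonglongrightarrow> min \<bar>0\<bar> H"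
        by (intro tendsto_min tendsto_rabs elim tendsto_const)
      then have m: "(\<lambda>n. min \<bar>v n x\<bar> H) \<longlonglongrightarrow> 0" using H by simp
      have "(\<lambda>n. min \<bar>v n x\<bar> H powr r) \<longlonglongrightarrow> 0 powr r"
        by (rule tendsto_powr'[OF m tendsto_const]) (use rR H in auto)
      then show ?case using rR tendsto_ennrealI by fastforce
    qed
  qed auto
  then have "\<forall>\<^sub>F n in sequentially. (\<integral>\<^sup>+x. ennreal (min \<bar>v n x\<bar> H powr r) \<partial>M) < ennreal (e / 4)"
    using e by (intro order_tendstoD) auto
  then show "\<forall>\<^sub>F n in sequentially. (\<integral>\<^sup>+x. ennreal (\<bar>v n x\<bar> powr r) \<partial>M) < a"
  proof eventually_elim
    case (elim n)
    have "\<bar>v n x\<bar> powr r \<le> min \<bar>v n x\<bar> H powr r + H powr (r - R) * \<bar>v n x\<bar> powr R" for x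
    proof (cases "\<bar>v n x\<bar> \<le> H")
      case False
      then have "\<bar>v n x\<bar> powr r = \<bar>v n x\<bar> powr (r - R) * \<bar>v n x\<bar> powr R" using H by (simp flip: powr_add)
      also have "\<dots> \<le> H powr (r - R) * \<bar>v n x\<bar> powr R"
        using False H rR by (intro mult_right_mono powr_mono2') auto
      finally show ?thesis by (simp add: add_increasing)
    qed simp
    then have "(\<integral>\<^sup>+x. ennreal (\<bar>v n x\<bar> powr r) \<partial>M) 
       \<le> (\<integral>\<^sup>+x. (ennreal (min \<bar>v n x\<bar> H powr r) + ennreal (H powr (r - R)) * ennreal (\<bar>v n x\<bar> powr R)) \<partial>M)"
      by (intro nn_integral_mono) (auto simp: ennreal_leI simp flip: ennreal_mult ennreal_plus)
    also have "\<dots> = (\<integral>\<^sup>+x. ennreal (min \<bar>v n x\<bar> H powr r) \<partial>M) + ennreal (H powr (r - R)) * (\<integral>\<^sup>+x. ennreal (\<bar>v n x\<bar> powr R) \<partial>M)"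
      by (subst nn_integral_add) (auto simp: nn_integral_cmult)
    also have "\<dots> \<le> ennreal (e / 4) + ennreal (H powr (r - R)) * ennreal K"
      using elim by (intro add_mono mult_left_mono K) auto
    also have "\<dots> = ennreal (e / 4 + H powr (r - R) * K)" using e \<open>0 \<le> K\<close> by (simp add: ennreal_mult)
    also have "\<dots> < ennreal e" using e HK by (intro ennreal_lessI) auto
    also have "\<dots> \<le> a" by fact
    finally show ?case .
  qed
qed simp

lemma integrable_powr_le_exponent:
  fixes v :: "'b \<Rightarrow> real"
  assumes "finite_measure M" and [measurable]: "v \<in> borel_measurable M" and r: "0 \<le> r" "r \<le> R"
    and fin: "(\<integral>\<^sup>+x. ennreal (\<bar>v x\<bar> powr R) \<partial>M) \<le> ennreal K"
  shows "integrable M (\<lambda>x. \<bar>v x\<bar> powr r)"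
proof -
  interpret finite_measure M by fact
  have "(\<integral>\<^sup>+x. ennreal (\<bar>v x\<bar> powr R) \<partial>M) < \<infinity>"
    using fin by (rule le_less_trans) simp
  then have int: "integrable M (\<lambda>x. \<bar>v x\<bar> powr R)" by (intro integrableI_nonneg) auto
  show ?thesis
  proof (rule Bochner_Integration.integrable_bound)
    show "integrable M (\<lambda>x. 1 + \<bar>v x\<bar> powr R)" using int by simp
    have "\<bar>t\<bar> powr r \<le> 1 + \<bar>t\<bar> powr R" for t :: real
    proof (cases "\<bar>t\<bar> \<le> 1")
      case True
      then show ?thesis using r powr_mono2[of r "\<bar>t\<bar>" 1] by (simp add: add_increasing2)
    next
      case False
      then show ?thesis using powr_mono[OF r(2), of "\<bar>t\<bar>"] by linarith
    qed
    then show "AE x in M. norm (\<bar>v x\<bar> powr r) \<le> norm (1 + \<bar>v x\<bar> powr R)" by (simp add: add_nonneg_nonneg)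
  qed measurable
qed

text \<open>The limit inherits the \<open>L\<^sup>R\<close> bound by Fatou, so the differences \<open>g\<^sub>n \<circ> T\<^sub>n - f\<close> are bounded in \<open>L\<^sup>R\<close> and
  tend to \<open>0\<close> almost everywhere, hence in \<open>L\<^sup>r\<close>.\<close>
lemma TL_dist_tendsto_zero:
  fixes T :: "nat \<Rightarrow> 'a::euclidean_space \<Rightarrow> 'a"
  assumes \<mu>: "borel_prob_on \<Omega> \<mu>" and \<nu>: "\<And>n. borel_prob_on \<Omega> (\<nu> n)"
    and T: "\<And>n. T n \<in> borel_measurable (restrict_space borel \<Omega>)" "\<And>n. T n \<in> \<Omega> \<rightarrow> \<Omega>"
    and push: "\<And>n. distr \<mu> (restrict_space borel \<Omega>) (T n) = \<nu> n"
    and near: "\<And>n x. x \<in> \<Omega> \<Longrightarrow> norm (T n x - x) \<le> b n" and b: "b \<longlonglongrightarrow> 0" "\<And>n. 0 \<le> b n"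
    and g[measurable]: "\<And>n. g n \<in> borel_measurable (\<nu> n)" and f[measurable]: "f \<in> borel_measurable \<mu>"
    and lim: "AE x in \<mu>. (\<lambda>n. g n (T n x)) \<longlonglongrightarrow> f x"
    and r: "0 < r" "r < R" and M: "0 \<le> M" "\<And>n. (\<integral>\<^sup>+x. ennreal (\<bar>g n (T n x)\<bar> powr R) \<partial>\<mu>) \<le> ennreal M"
  shows "(\<lambda>n. TL_dist r (g n, \<nu> n) (f, \<mu>)) \<longlonglongrightarrow> 0" and "integrable \<mu> (\<lambda>x. \<bar>f x\<bar> powr r)"
proof -
  interpret prob_space \<mu> using \<mu> by (simp add: borel_prob_on_def)
  have s\<mu>: "sets \<mu> = sets (restrict_space borel \<Omega>)" and s\<nu>: "\<And>n. sets (\<nu> n) = sets (restrict_space borel \<Omega>)"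
    using \<mu> \<nu> by (auto simp: borel_prob_on_def)
  have sp\<mu>: "space \<mu> = \<Omega>" using sets_eq_imp_space_eq[OF s\<mu>] by (simp add: space_restrict_space)
  have T\<nu>: "T n \<in> measurable \<mu> (\<nu> n)" for n
    unfolding measurable_cong_sets[OF s\<mu> s\<nu>] using T(1)[of n] T(2)[of n]
    by (auto intro!: measurable_restrict_space2 simp: space_restrict_space)
  have gT[measurable]: "(\<lambda>x. g n (T n x)) \<in> borel_measurable \<mu>" for n
    by (rule measurable_compose[OF T\<nu> g])
  have id: "(\<lambda>x. x) \<in> borel_measurable \<mu>"
    unfolding measurable_cong_sets[OF s\<mu> refl] by (auto intro!: measurable_restrict_space1)
  have TB: "T n \<in> borel_measurable \<mu>" for n
    unfolding measurable_cong_sets[OF s\<mu> refl] by (rule T)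
  have [measurable]: "(\<lambda>x. T n x - x) \<in> borel_measurable \<mu>" for n
    by (rule borel_measurable_diff[OF TB id])
  have fM: "(\<integral>\<^sup>+x. ennreal (\<bar>f x\<bar> powr R) \<partial>\<mu>) \<le> ennreal M"
  proof -
    have "(\<integral>\<^sup>+x. ennreal (\<bar>f x\<bar> powr R) \<partial>\<mu>) \<le> (\<integral>\<^sup>+x. liminf (\<lambda>n. ennreal (\<bar>g n (T n x)\<bar> powr R)) \<partial>\<mu>)"
    proof (rule nn_integral_mono_AE)
      show "AE x in \<mu>. ennreal (\<bar>f x\<bar> powr R) \<le> liminf (\<lambda>n. ennreal (\<bar>g n (T n x)\<bar> powr R))"
        using lim
      proof eventually_elim
        case (elim x)
        have "(\<lambda>n. \<bar>g n (T n x)\<bar> powr R) \<longlonglongrightarrow> \<bar>f x\<bar> powr R"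
          by (rule tendsto_powr'[OF tendsto_rabs[OF elim] tendsto_const]) (use r in auto)
        then have "(\<lambda>n. ennreal (\<bar>g n (T n x)\<bar> powr R)) \<longlonglongrightarrow> ennreal (\<bar>f x\<bar> powr R)" by (rule tendsto_ennrealI)
        then show ?case by (subst lim_imp_Liminf) auto
      qed
    qed
    also have "\<dots> \<le> liminf (\<lambda>n. \<integral>\<^sup>+x. ennreal (\<bar>g n (T n x)\<bar> powr R) \<partial>\<mu>)"
      by (rule nn_integral_liminf) measurable
    also have "\<dots> \<le> liminf (\<lambda>n. ennreal M)"
      by (rule Liminf_mono) (use M in auto)
    finally show ?thesis by (simp add: Liminf_const)
  qed
  show "integrable \<mu> (\<lambda>x. \<bar>f x\<bar> powr r)"
    by (rule integrable_powr_le_exponent[OF finite_measure_axioms _ _ _ fM]) (use r in auto)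
  define v where "v n x = g n (T n x) - f x" for n x
  have [measurable]: "v n \<in> borel_measurable \<mu>" for n unfolding v_def by measurable
  have vM: "(\<integral>\<^sup>+x. ennreal (\<bar>v n x\<bar> powr R) \<partial>\<mu>) \<le> ennreal (2 powr R * (M + M))" for n
  proof -
    have "\<bar>x - y\<bar> powr R \<le> 2 powr R * (\<bar>x\<bar> powr R + \<bar>y\<bar> powr R)" for x y :: real
    proof -
      have "\<bar>x - y\<bar> powr R \<le> (2 * max \<bar>x\<bar> \<bar>y\<bar>) powr R" using r by (intro powr_mono2) auto
      also have "\<dots> = 2 powr R * max \<bar>x\<bar> \<bar>y\<bar> powr R" by (simp add: powr_mult)
      also have "max \<bar>x\<bar> \<bar>y\<bar> powr R \<le> \<bar>x\<bar> powr R + \<bar>y\<bar> powr R" by (simp add: max_def)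
      finally show ?thesis by simp
    qed
    then have "(\<integral>\<^sup>+x. ennreal (\<bar>v n x\<bar> powr R) \<partial>\<mu>)
      \<le> (\<integral>\<^sup>+x. ennreal (2 powr R) * (ennreal (\<bar>g n (T n x)\<bar> powr R) + ennreal (\<bar>f x\<bar> powr R)) \<partial>\<mu>)"
      unfolding v_def by (intro nn_integral_mono) (auto simp: ennreal_leI simp flip: ennreal_mult ennreal_plus)
    also have "\<dots> = ennreal (2 powr R) * ((\<integral>\<^sup>+x. ennreal (\<bar>g n (T n x)\<bar> powr R) \<partial>\<mu>) + (\<integral>\<^sup>+x. ennreal (\<bar>f x\<bar> powr R) \<partial>\<mu>))"
      by (subst nn_integral_cmult) (auto simp: nn_integral_add)
    also have "\<dots> \<le> ennreal (2 powr R) * (ennreal M + ennreal M)"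
      by (intro mult_left_mono add_mono M fM) auto
    also have "\<dots> = ennreal (2 powr R * (M + M))" using M(1) by (simp flip: ennreal_mult ennreal_plus)
    finally show ?thesis .
  qed
  have vint: "integrable \<mu> (\<lambda>x. \<bar>v n x\<bar> powr r)" for n
    by (rule integrable_powr_le_exponent[OF finite_measure_axioms _ _ _ vM]) (use r in auto)
  have "(\<lambda>n. \<integral>\<^sup>+x. ennreal (\<bar>v n x\<bar> powr r) \<partial>\<mu>) \<longlonglongrightarrow> 0"
  proof (rule nn_integral_powr_tendsto_zero[OF finite_measure_axioms _ _ r _ vM])
    show "AE x in \<mu>. (\<lambda>n. v n x) \<longlonglongrightarrow> 0"
      using lim unfolding v_def by eventually_elim (use LIM_zero in blast)
  qed (use M in auto)
  also have "(\<lambda>n. \<integral>\<^sup>+x. ennreal (\<bar>v n x\<bar> powr r) \<partial>\<mu>) = (\<lambda>n. ennreal (\<integral>x. \<bar>v n x\<bar> powr r \<partial>\<mu>))"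
    using vint by (subst nn_integral_eq_integral) auto
  finally have vlim: "(\<lambda>n. \<integral>x. \<bar>v n x\<bar> powr r \<partial>\<mu>) \<longlonglongrightarrow> 0"
    using tendsto_ennreal_iff[of "\<lambda>n. \<integral>x. \<bar>v n x\<bar> powr r \<partial>\<mu>" sequentially 0] by simp
  have "(\<lambda>n. b n powr r) \<longlonglongrightarrow> 0 powr r"
    by (rule tendsto_powr'[OF b(1) tendsto_const]) (use r b(2) in auto)
  then have "(\<lambda>n. b n powr r + (\<integral>x. \<bar>v n x\<bar> powr r \<partial>\<mu>)) \<longlonglongrightarrow> 0"
    using tendsto_add[OF _ vlim] r by fastforce
  then have "(\<lambda>n. (b n powr r + (\<integral>x. \<bar>v n x\<bar> powr r \<partial>\<mu>)) powr (1 / r)) \<longlonglongrightarrow> 0 powr (1 / r)"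
    by (rule tendsto_powr'[OF _ tendsto_const]) (use r in \<open>auto intro!: always_eventually add_nonneg_nonneg\<close>)
  then have up: "(\<lambda>n. (b n powr r + (\<integral>x. \<bar>v n x\<bar> powr r \<partial>\<mu>)) powr (1 / r)) \<longlonglongrightarrow> 0" using r by simp
  have TL: "0 \<le> TL_dist r (g n, \<nu> n) (f, \<mu>)"
    "TL_dist r (g n, \<nu> n) (f, \<mu>) \<le> (\<integral>x. norm (T n x - x) powr r + \<bar>v n x\<bar> powr r \<partial>\<mu>) powr (1 / r)" for n
    unfolding v_def by (rule TL_dist_transport_le[OF \<mu> \<nu> T push g f])+
  have "TL_dist r (g n, \<nu> n) (f, \<mu>) \<le> (b n powr r + (\<integral>x. \<bar>v n x\<bar> powr r \<partial>\<mu>)) powr (1 / r)" for n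
  proof -
    have nb: "norm (T n x - x) powr r \<le> b n powr r" if "x \<in> space \<mu>" for x
      using near[of x n] that r by (intro powr_mono2) (auto simp: sp\<mu>)
    then have nint: "integrable \<mu> (\<lambda>x. norm (T n x - x) powr r)"
      by (intro integrable_const_bound[of _ "b n powr r"]) (auto intro!: AE_I2)
    have "(\<integral>x. norm (T n x - x) powr r \<partial>\<mu>) \<le> (\<integral>x. b n powr r \<partial>\<mu>)"
      using nint nb by (intro integral_mono) auto
    then have "(\<integral>x. norm (T n x - x) powr r + \<bar>v n x\<bar> powr r \<partial>\<mu>) \<le> b n powr r + (\<integral>x. \<bar>v n x\<bar> powr r \<partial>\<mu>)"
      using nint vint[of n] by (simp add: prob_space)
    moreover have "0 \<le> (\<integral>x. norm (T n x - x) powr r + \<bar>v n x\<bar> powr r \<partial>\<mu>)"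
      by (intro Bochner_Integration.integral_nonneg) auto
    ultimately have "(\<integral>x. norm (T n x - x) powr r + \<bar>v n x\<bar> powr r \<partial>\<mu>) powr (1 / r)
       \<le> (b n powr r + (\<integral>x. \<bar>v n x\<bar> powr r \<partial>\<mu>)) powr (1 / r)"
      using r by (intro powr_mono2) auto
    then show ?thesis using TL(2)[of n] by linarith
  qed
  with TL(1) show "(\<lambda>n. TL_dist r (g n, \<nu> n) (f, \<mu>)) \<longlonglongrightarrow> 0"
    by (intro tendsto_sandwich[OF _ _ tendsto_const up]) auto
qed

section \<open>Relative compactness of graph functions\<close>

lemma bounded_range_le:
  fixes f :: "nat \<Rightarrow> real"
  assumes "bounded (range f)"
  obtains c where "0 \<le> c" "\<And>n. f n \<le> c"
proof -
  obtain c where c: "\<And>n. norm (f n) \<le> c" using assms unfolding bounded_iff by auto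
  have "f n \<le> c" for n using c[of n] by simp
  moreover have "0 \<le> c" using c[of 0] norm_ge_zero[of "f 0"] by linarith
  ultimately show thesis using that by blast
qed

text \<open>The exponent \<open>R\<close> in which the functions are bounded is \<open>p\<close> if \<open>r < p\<close>.  Otherwise \<open>p \<le> r < q\<close>, and any \<open>R\<close>
  strictly between \<open>r\<close> and \<open>q\<close> satisfies \<open>1 / p - 1 / R < \<gamma> \<le> 1 / d\<close>, which is what
  \<open>nonlocal_higher_integrability\<close> asks for.\<close>
lemma graph_functions_relatively_compact:
  fixes \<Omega> :: "'a::euclidean_space set" and V :: "nat \<Rightarrow> 'a set" and u :: "nat \<Rightarrow> 'a \<Rightarrow> real"
  assumes \<Omega>: "open \<Omega>" "bounded \<Omega>" "lipschitz_boundary \<Omega>"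
    and \<eta>: "\<And>r. 0 \<le> r \<Longrightarrow> 0 \<le> \<eta> r" "antimono_on {0..} \<eta>" "0 < \<eta> r0" and a: "0 < a" "a + 2 * K \<le> r0"
    and p: "1 \<le> p" "p < real DIM('a)" and \<gamma>: "\<gamma> \<le> 1 / real DIM('a)"
    and \<mu>: "prob_space \<mu>" "\<mu> = density (restrict_space lborel \<Omega>) (\<lambda>x. ennreal (\<rho> x))" and \<rho>: "continuous_on \<Omega> \<rho>"
    and V: "\<And>n. finite (V n)" "\<And>n. V n \<subseteq> \<Omega>"
    and \<mu>s: "\<And>n. borel_prob_on \<Omega> (\<mu>s n)" "\<And>n. measure (\<mu>s n) (V n) = 1"
    and \<epsilon>: "\<And>n. \<epsilon> n > 0" "\<epsilon> \<longlonglongrightarrow> 0" and K: "0 < K"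
    and T: "\<And>n. T n \<in> borel_measurable (restrict_space borel \<Omega>)" "\<And>n. T n \<in> \<Omega> \<rightarrow> V n"
    and push: "\<And>n. distr \<mu> (restrict_space borel \<Omega>) (T n) = \<mu>s n"
    and near: "\<And>n x. x \<in> \<Omega> \<Longrightarrow> norm (T n x - x) \<le> K * \<epsilon> n"
    and D: "D > 0" "\<And>x. x \<in> \<Omega> \<Longrightarrow> 1 / D \<le> \<rho> x \<and> \<rho> x \<le> D"
    and D': "D' > 0" "\<And>n x. x \<in> V n \<Longrightarrow> 1 / (D' * real (card (V n))) \<le> measure (\<mu>s n) {x}"
    and sparse: "bounded (range (\<lambda>n. \<epsilon> n * real (card (V n)) powr \<gamma>))"
    and Lp: "bounded (range (\<lambda>n. discrete_Lp_norm p (V n) (\<mu>s n) (u n)))"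
    and en: "bounded (range (\<lambda>n. graph_energy \<eta> p (\<epsilon> n) (V n) (\<mu>s n) (u n)))"
    and r: "1 \<le> r" "r < p / (1 - p * \<gamma>)"
  shows "TL_relatively_compact \<Omega> r (\<lambda>n. (\<lambda>x. if x \<in> V n then u n x else 0, \<mu>s n))"
proof -
  obtain I where I: "finite I" "\<And>P \<phi>. (P, \<phi>) \<in> I \<Longrightarrow> averaging_kernel \<Omega> P \<phi>" "(\<Union>(P, \<phi>)\<in>I. P) = \<Omega>"
    using averaging_kernel_cover[OF \<Omega>] by metis
  obtain K0 where K0: "0 \<le> K0" "\<And>n. discrete_Lp_norm p (V n) (\<mu>s n) (u n) \<le> K0"
    using bounded_range_le[OF Lp] by metis
  obtain K1 where K1: "0 \<le> K1" "\<And>n. graph_energy \<eta> p (\<epsilon> n) (V n) (\<mu>s n) (u n) \<le> K1"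
    using bounded_range_le[OF en] by metis
  obtain K2 where K2: "0 \<le> K2" "\<And>n. \<epsilon> n * real (card (V n)) powr \<gamma> \<le> K2"
    using bounded_range_le[OF sparse] by metis
  have [measurable]: "\<Omega> \<in> sets borel" using \<Omega> by auto
  have s\<mu>: "sets \<mu> = sets (restrict_space borel \<Omega>)" unfolding \<mu>(2) by (simp add: sets_restrict_space)
  have sp\<mu>: "space \<mu> = \<Omega>" unfolding \<mu>(2) by (simp add: space_restrict_space)
  have \<mu>on: "borel_prob_on \<Omega> \<mu>" using \<mu>(1) s\<mu> by (simp add: borel_prob_on_def)
  interpret \<mu>: prob_space \<mu> by fact
  define w where "w n x = (if x \<in> \<Omega> then u n (T n x) else 0)" for n x
  define C where "C = D * K0 powr p + D * D * K1 / (\<eta> r0 * a powr (p + DIM('a)))"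
  have C0: "0 \<le> D * K0 powr p" "0 \<le> D * D * K1 / (\<eta> r0 * a powr (p + DIM('a)))" using D K1 \<eta>(3) by auto
  have C: "0 \<le> C" using C0 by (simp add: C_def)
  have bound: "nonlocal_Sobolev_bound \<Omega> p C (a * \<epsilon> n) (w n)" for n
    unfolding w_def
    by (rule graph_function_nonlocal_Sobolev_bound[OF \<Omega>(1) \<mu> \<rho> D V T push near \<epsilon>(1) \<eta> a p(1) K0(2) K1(2)])
       (use C0 in \<open>auto simp: C_def\<close>)
  have Vne: "V n \<noteq> {}" for n using \<mu>s(2)[of n] by auto
  \<comment> \<open>A lower bound for the Lebesgue measure of each cell of \<open>T n\<close>.\<close>
  define m where "m n = 1 / (D' * real (card (V n))) / D" for n
  have card: "0 < real (card (V n))" for n using V Vne by (simp add: card_gt_0_iff)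
  have m: "0 < m n" for n using D D' card by (simp add: m_def)
  define C' where "C' = a * K2 * (D * D') powr \<gamma>"
  have C': "0 \<le> C'" using a K2 by (simp add: C'_def)
  have \<delta>m: "a * \<epsilon> n \<le> C' * m n powr \<gamma>" for n
  proof -
    have "C' * m n powr \<gamma> = a * (K2 / real (card (V n)) powr \<gamma>)"
      using D(1) D'(1) card[of n] by (simp add: C'_def m_def powr_divide powr_mult)
    moreover have "\<epsilon> n \<le> K2 / real (card (V n)) powr \<gamma>"
      using K2(2)[of n] card[of n] by (simp add: field_simps)
    ultimately show ?thesis using a mult_left_mono[of "\<epsilon> n" "K2 / real (card (V n)) powr \<gamma>" a] by simp
  qed
  have lim\<delta>: "(\<lambda>n. a * \<epsilon> n) \<longlonglongrightarrow> 0" using tendsto_mult_right_zero[OF \<epsilon>(2)] by simp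
  have p\<gamma>: "p * \<gamma> < 1"
  proof -
    have "p * \<gamma> \<le> p * (1 / real DIM('a))" using p \<gamma> by (intro mult_left_mono) auto
    also have "\<dots> < 1" using p by simp
    finally show ?thesis .
  qed
  obtain R M N where R: "r < R" and M: "0 \<le> M"
    and high: "\<And>n. N \<le> n \<Longrightarrow> (\<integral>\<^sup>+x. ennreal (\<bar>w n x\<bar> powr R) \<partial>lborel) \<le> ennreal M"
  proof (cases "r < p")
    case True
    show ?thesis
      by (rule that[OF True C]) (use bound in \<open>auto simp: nonlocal_Sobolev_bound_def\<close>)
  next
    case False
    define q where "q = p / (1 - p * \<gamma>)"
    define R where "R = (r + q) / 2"
    have "r < q" using r by (simp add: q_def)
    then have R: "p < R" "r < R" "R < q" using False by (auto simp: R_def)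
    have "1 / q < 1 / R" using R p by (intro divide_strict_left_mono) auto
    moreover have "1 / q = 1 / p - \<gamma>" using p p\<gamma> by (simp add: q_def field_simps)
    ultimately have qR: "1 / p - 1 / R < \<gamma>" by linarith
    have crit: "real DIM('a) * ((R - p) / R) < p"
    proof -
      have "1 / p - 1 / R < 1 / real DIM('a)" using qR \<gamma> by linarith
      then have "real DIM('a) * p * (1 / p - 1 / R) < real DIM('a) * p * (1 / real DIM('a))"
        using p by (intro mult_strict_left_mono) auto
      moreover have "real DIM('a) * p * (1 / p - 1 / R) = real DIM('a) * ((R - p) / R)"
        using p R by (simp add: field_simps)
      moreover have "real DIM('a) * p * (1 / real DIM('a)) = p" by simp
      ultimately show ?thesis by argo
    qed
    obtain M where M: "0 \<le> M" "\<forall>w \<delta> \<Lambda> m. nonlocal_Sobolev_bound \<Omega> p C \<delta> w \<and> \<delta> \<le> 1 \<and> (\<forall>x. \<bar>w x\<bar> \<le> \<Lambda>) \<and>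
      0 < m \<and> ennreal m \<le> emeasure lborel {x\<in>\<Omega>. \<bar>w x\<bar> = \<Lambda>} \<and> \<delta> \<le> C' * m powr \<gamma>
      \<longrightarrow> (\<integral>\<^sup>+x. ennreal (\<bar>w x\<bar> powr R) \<partial>lborel) \<le> ennreal M"
      using nonlocal_higher_integrability[OF \<Omega>(1,2) I p(1) R(1) crit less_imp_le[OF qR] C C'] by blast
    have "\<forall>\<^sub>F n in sequentially. a * \<epsilon> n < 1" using lim\<delta> by (rule order_tendstoD) simp
    then obtain N where N: "\<And>n. N \<le> n \<Longrightarrow> a * \<epsilon> n < 1" unfolding eventually_sequentially by blast
    show ?thesis
    proof (rule that[OF R(2) M(1)])
      fix n assume n: "N \<le> n"
      have "\<exists>\<Lambda>. (\<forall>x. \<bar>w n x\<bar> \<le> \<Lambda>) \<and> ennreal (m n) \<le> emeasure lborel {x\<in>\<Omega>. \<bar>w n x\<bar> = \<Lambda>}"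
        unfolding w_def m_def
        by (rule graph_function_level_set[OF \<Omega>(1) \<mu> \<rho> D V(1) Vne V(2) T push D'(2)])
      then obtain \<Lambda> where \<Lambda>: "\<forall>x. \<bar>w n x\<bar> \<le> \<Lambda>" "ennreal (m n) \<le> emeasure lborel {x\<in>\<Omega>. \<bar>w n x\<bar> = \<Lambda>}"
        by blast
      show "(\<integral>\<^sup>+x. ennreal (\<bar>w n x\<bar> powr R) \<partial>lborel) \<le> ennreal M"
        using M(2)[rule_format, of "a * \<epsilon> n" "w n" \<Lambda> "m n"] bound[of n] N[OF n] \<Lambda> m[of n] \<delta>m[of n] by auto
    qed
  qed
  define g where "g n x = (if x \<in> V n then u n x else 0)" for n x
  have gT: "g n (T n x) = w n x" if "x \<in> \<Omega>" for n x
    using that T(2)[of n] by (auto simp: g_def w_def)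
  have gm: "g n \<in> borel_measurable (\<mu>s n)" for n
  proof -
    have [measurable]: "{v} \<in> sets (\<mu>s n)" if "v \<in> V n" for v
      using that V \<mu>s(1)[of n] by (auto simp: borel_prob_on_def sets_restrict_space_iff)
    have "g n = (\<lambda>x. \<Sum>v\<in>V n. u n v * indicator {v} x)"
    proof
      fix x
      have "(\<Sum>v\<in>V n. u n v * indicator {v} x) = (\<Sum>v\<in>V n. if v = x then u n v else 0)"
        by (intro sum.cong) (auto simp: indicator_def)
      then show "g n x = (\<Sum>v\<in>V n. u n v * indicator {v} x)" using V by (simp add: g_def)
    qed
    also have "\<dots> \<in> borel_measurable (\<mu>s n)"
      by (intro borel_measurable_sum borel_measurable_times borel_measurable_indicator) auto
    finally show ?thesis .
  qed
  have moment: "integrable \<kappa> (\<lambda>x. norm x powr r)" if \<kappa>: "borel_prob_on \<Omega> \<kappa>" for \<kappa>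
  proof -
    interpret \<kappa>: prob_space \<kappa> using \<kappa> by (simp add: borel_prob_on_def)
    have s\<kappa>: "sets \<kappa> = sets (restrict_space borel \<Omega>)" using \<kappa> by (simp add: borel_prob_on_def)
    have sp\<kappa>: "space \<kappa> = \<Omega>" using sets_eq_imp_space_eq[OF s\<kappa>] by (simp add: space_restrict_space)
    obtain b where b: "\<forall>x\<in>\<Omega>. norm x \<le> b" using \<Omega>(2) unfolding bounded_iff by blast
    show ?thesis
    proof (rule \<kappa>.integrable_const_bound)
      show "AE x in \<kappa>. norm (norm x powr r) \<le> b powr r"
        using b r by (intro AE_I2) (auto simp: sp\<kappa> intro!: powr_mono2)
      show "(\<lambda>x. norm x powr r) \<in> borel_measurable \<kappa>"
        unfolding measurable_cong_sets[OF s\<kappa> refl] by (rule measurable_restrict_space1) measurable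
    qed
  qed
  have inTL: "(g n, \<mu>s n) \<in> TL \<Omega> r" for n
  proof -
    interpret prob_space "\<mu>s n" using \<mu>s(1)[of n] by (simp add: borel_prob_on_def)
    have gb: "\<bar>g n x\<bar> \<le> (\<Sum>v\<in>V n. \<bar>u n v\<bar>)" for x
      using member_le_sum[of x "V n" "\<lambda>v. \<bar>u n v\<bar>"] V by (auto simp: g_def sum_nonneg)
    have "integrable (\<mu>s n) (\<lambda>x. \<bar>g n x\<bar> powr r)"
    proof (rule integrable_const_bound)
      show "AE x in \<mu>s n. norm (\<bar>g n x\<bar> powr r) \<le> (\<Sum>v\<in>V n. \<bar>u n v\<bar>) powr r"
        using gb r by (intro AE_I2) (auto intro!: powr_mono2)
    qed (use gm[of n] in measurable)
    then show ?thesis using \<mu>s(1) gm moment by (auto simp: TL_def)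
  qed
  have conv: "\<exists>s' :: nat \<Rightarrow> nat. strict_mono s' \<and> (\<exists>Y\<in>TL \<Omega> r. (\<lambda>k. TL_dist r (g (s (s' k)), \<mu>s (s (s' k))) Y) \<longlonglongrightarrow> 0)"
    if s: "strict_mono (s :: nat \<Rightarrow> nat)" for s
  proof -
    \<comment> \<open>The first \<open>N\<close> indices are skipped because the \<open>L\<^sup>R\<close> bound holds from \<open>N\<close> on.\<close>
    define \<sigma> where "\<sigma> n = s (n + N)" for n
    have \<sigma>: "strict_mono \<sigma>" using s by (auto simp: \<sigma>_def strict_mono_def)
    have \<sigma>N: "N \<le> \<sigma> n" for n using seq_suble[OF s, of "n + N"] by (simp add: \<sigma>_def)
    have lim\<sigma>: "(\<lambda>n. a * \<epsilon> (\<sigma> n)) \<longlonglongrightarrow> 0" using LIMSEQ_subseq_LIMSEQ[OF lim\<delta> \<sigma>] by (simp add: o_def)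
    obtain k f where k: "strict_mono (k :: nat \<Rightarrow> nat)" and f: "f \<in> borel_measurable borel"
      and AE: "AE x in lborel. (\<lambda>n. w (\<sigma> (k n)) x) \<longlonglongrightarrow> f x"
      by (rule nonlocal_AE_convergent_subsequence[where w="\<lambda>n. w (\<sigma> n)" and \<delta>="\<lambda>n. a * \<epsilon> (\<sigma> n)",
            OF \<Omega>(1,2) I p(1) C bound lim\<sigma>])
    define \<tau> where "\<tau> n = \<sigma> (k n)" for n
    have f\<mu>: "f \<in> borel_measurable \<mu>"
      unfolding measurable_cong_sets[OF s\<mu> refl] using f by (rule measurable_restrict_space1)
    have AE\<mu>: "AE x in \<mu>. (\<lambda>n. g (\<tau> n) (T (\<tau> n) x)) \<longlonglongrightarrow> f x"
    proof -
      have m: "\<rho> \<in> borel_measurable (restrict_space lborel \<Omega>)"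
        using borel_measurable_continuous_on_restrict[OF \<rho>]
        by (subst measurable_cong_sets[of _ "restrict_space borel \<Omega>" _ borel]) (auto simp: sets_restrict_space)
      have "AE x in restrict_space lborel \<Omega>. (\<lambda>n. w (\<sigma> (k n)) x) \<longlonglongrightarrow> f x"
        by (subst AE_restrict_space_iff) (use AE in auto)
      then have "AE x in \<mu>. (\<lambda>n. w (\<sigma> (k n)) x) \<longlonglongrightarrow> f x"
        unfolding \<mu>(2) using m by (subst AE_density) auto
      then show ?thesis
        using AE_space by eventually_elim (simp add: sp\<mu> gT \<tau>_def)
    qed
    have RM: "(\<integral>\<^sup>+x. ennreal (\<bar>g (\<tau> n) (T (\<tau> n) x)\<bar> powr R) \<partial>\<mu>) \<le> ennreal (D * M)" for n
    proof -
      have [measurable]: "w (\<tau> n) \<in> borel_measurable borel" using bound by (simp add: nonlocal_Sobolev_bound_def)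
      have "(\<integral>\<^sup>+x. ennreal (\<bar>g (\<tau> n) (T (\<tau> n) x)\<bar> powr R) \<partial>\<mu>) = (\<integral>\<^sup>+x. ennreal (\<bar>w (\<tau> n) x\<bar> powr R) \<partial>\<mu>)"
        by (intro nn_integral_cong) (simp add: sp\<mu> gT)
      also have "\<dots> \<le> ennreal D * (\<integral>\<^sup>+x\<in>\<Omega>. ennreal (\<bar>w (\<tau> n) x\<bar> powr R) \<partial>lborel)"
        by (rule nn_integral_density_bounds(1)[OF \<Omega>(1) \<mu>(2) \<rho> D]) measurable
      also have "\<dots> \<le> ennreal D * (\<integral>\<^sup>+x. ennreal (\<bar>w (\<tau> n) x\<bar> powr R) \<partial>lborel)"
        by (intro mult_left_mono nn_integral_mono) (auto simp: indicator_def)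
      also have "\<dots> \<le> ennreal D * ennreal M"
        using high[of "\<tau> n"] \<sigma>N by (intro mult_left_mono) (auto simp: \<tau>_def)
      also have "\<dots> = ennreal (D * M)" using D M by (simp add: ennreal_mult)
      finally show ?thesis .
    qed
    have \<tau>: "strict_mono \<tau>" using strict_mono_o[OF \<sigma> k] by (simp add: \<tau>_def[abs_def] o_def)
    have b: "(\<lambda>n. K * \<epsilon> (\<tau> n)) \<longlonglongrightarrow> 0"
      using tendsto_mult_right_zero[OF LIMSEQ_subseq_LIMSEQ[OF \<epsilon>(2) \<tau>], of K] by (simp add: o_def)
    have T\<Omega>: "T n \<in> \<Omega> \<rightarrow> \<Omega>" for n using T(2)[of n] V(2)[of n] by auto
    have b0: "0 \<le> K * \<epsilon> (\<tau> n)" for n using K \<epsilon>(1)[of "\<tau> n"] by simp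
    have r0: "0 < r" using r by simp
    have DM: "0 \<le> D * M" using D M by simp
    note lim = TL_dist_tendsto_zero[where \<nu>="\<lambda>n. \<mu>s (\<tau> n)" and T="\<lambda>n. T (\<tau> n)" and g="\<lambda>n. g (\<tau> n)" and b="\<lambda>n. K * \<epsilon> (\<tau> n)",
        OF \<mu>on \<mu>s(1) T(1) T\<Omega> push near b b0 gm f\<mu> AE\<mu> r0 R DM RM]
    have "(f, \<mu>) \<in> TL \<Omega> r" using \<mu>on moment[OF \<mu>on] f\<mu> lim(2) by (simp add: TL_def)
    moreover have "strict_mono (\<lambda>n. k n + N)" using k by (auto simp: strict_mono_def)
    ultimately show ?thesis using lim(1) by (intro exI[of _ "\<lambda>n. k n + N"]) (auto simp: \<tau>_def \<sigma>_def)
  qed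
  show ?thesis
    unfolding TL_relatively_compact_def g_def[symmetric] using inTL conv by auto
qed

theorem corollary5p13:
  fixes \<Omega> :: "'a::euclidean_space set" and \<eta> :: "real \<Rightarrow> real"
  assumes "open \<Omega>" and "bounded \<Omega>" and "lipschitz_boundary \<Omega>"
    and "\<forall>r\<ge>0. \<eta> r \<ge> 0"
  shows "\<exists>S>0. \<forall>(p::real) (\<gamma>::real) (q::real)
      (\<mu> :: 'a measure) (\<rho> :: 'a \<Rightarrow> real)
      (V :: nat \<Rightarrow> 'a set) (\<mu>s :: nat \<Rightarrow> 'a measure) (\<epsilon> :: nat \<Rightarrow> real)
      (K::real) (T :: nat \<Rightarrow> 'a \<Rightarrow> 'a) (D::real) (D'::real) (t::real)
      (u :: nat \<Rightarrow> 'a \<Rightarrow> real) (r::real).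
    1 \<le> p \<and> p < real DIM('a) \<and> 0 \<le> \<gamma> \<and> \<gamma> \<le> 1 / real DIM('a) \<and> q = p / (1 - p * \<gamma>) \<and>
    prob_space \<mu> \<and> continuous_on \<Omega> \<rho> \<and>
    \<mu> = density (restrict_space lborel \<Omega>) (\<lambda>x. ennreal (\<rho> x)) \<and>
    (\<forall>n. finite (V n) \<and> V n \<subseteq> \<Omega> \<and> borel_prob_on \<Omega> (\<mu>s n) \<and> measure (\<mu>s n) (V n) = 1) \<and>
    (\<forall>n. \<epsilon> n > 0) \<and> \<epsilon> \<longlonglongrightarrow> 0 \<and>
    0 < K \<and> K \<le> S \<and>
    (\<forall>n. T n \<in> borel_measurable (restrict_space borel \<Omega>) \<and> T n \<in> \<Omega> \<rightarrow> V n \<and>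
         distr \<mu> (restrict_space borel \<Omega>) (T n) = \<mu>s n \<and>
         (\<forall>x\<in>\<Omega>. norm (T n x - x) \<le> K * \<epsilon> n)) \<and>
    continuous (at 0 within {0..}) \<eta> \<and> antimono_on {0..} \<eta> \<and> \<eta> 0 > 0 \<and>
    D > 0 \<and> (\<forall>x\<in>\<Omega>. 1 / D \<le> \<rho> x \<and> \<rho> x \<le> D) \<and>
    D' > 0 \<and>
    (\<forall>n. \<forall>x\<in>V n. 1 / (D' * real (card (V n))) \<le> measure (\<mu>s n) {x} \<and>
                  measure (\<mu>s n) {x} \<le> D' / real (card (V n))) \<and>
    t > q \<and> aleph DIM('a) \<eta> t < \<infinity> \<and>
    bounded (range (\<lambda>n. \<epsilon> n * real (card (V n)) powr \<gamma>)) \<and>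
    bounded (range (\<lambda>n. discrete_Lp_norm p (V n) (\<mu>s n) (u n))) \<and>
    bounded (range (\<lambda>n. graph_energy \<eta> p (\<epsilon> n) (V n) (\<mu>s n) (u n))) \<and>
    1 \<le> r \<and> r < p / (1 - p * \<gamma>)
    \<longrightarrow> TL_relatively_compact \<Omega> r (\<lambda>n. (\<lambda>x. if x \<in> V n then u n x else 0, \<mu>s n))"
proof -
  \<comment> \<open>Only \<open>\<Omega>\<close> and \<open>\<eta>\<close> are fixed at this point, and \<open>r0\<close> has to be chosen before \<open>\<eta>\<close> is known to be
    continuous and positive at \<open>0\<close>.\<close>
  have "\<exists>r0>0. continuous (at 0 within {0..}) \<eta> \<and> \<eta> 0 > 0 \<longrightarrow> 0 < \<eta> r0"
  proof (cases "continuous (at 0 within {0..}) \<eta> \<and> \<eta> 0 > 0")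
    case True
    then obtain d where d: "0 < d" "\<And>x. x \<in> {0..} \<Longrightarrow> dist x 0 < d \<Longrightarrow> dist (\<eta> x) (\<eta> 0) < \<eta> 0"
      unfolding continuous_within_eps_delta by metis
    have "dist (\<eta> (d / 2)) (\<eta> 0) < \<eta> 0" using d by auto
    then have "0 < \<eta> (d / 2)" unfolding dist_real_def by linarith
    then show ?thesis using d by (intro exI[of _ "d / 2"]) auto
  qed (auto intro: exI[of _ 1])
  then obtain r0 where r0: "0 < r0" "continuous (at 0 within {0..}) \<eta> \<Longrightarrow> \<eta> 0 > 0 \<Longrightarrow> 0 < \<eta> r0" by blast
  show ?thesis
  proof (intro exI[of _ "r0 / 4"] conjI allI impI, goal_cases)
    case 1
    then show ?case using r0 by simp
  next
    case (2 p \<gamma> q \<mu> \<rho> V \<mu>s \<epsilon> K T D D' t u r)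
    then have K: "r0 / 2 + 2 * K \<le> r0" by linarith
    note R = graph_functions_relatively_compact[OF assms(1-3), of \<eta> r0 "r0 / 2" K p \<gamma> \<mu> \<rho> V \<mu>s \<epsilon> T D D' u r]
    show ?case
    proof (rule R)
    qed (use 2 K r0 assms(4) in \<open>blast | simp\<close>)+
  qed
qed

end
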